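(* Let $n\ge 1$. For every integer $s$ with $0\le s\le n$, $$\frac{v_{2n}^{(s)}}{2^{2n+s}}=\sum_{\substack{J\subseteq\{1,\dots,n\}\\ |J|=s}}\det\big(c_{j,k}(J)\big)_{1\le j,k\le n}=\sum_{\substack{J\subseteq\{1,\dots,n\}\\ |J|=s}}\det\big(c'_{j,k}(J)\big)_{1\le j,k\le n},$$ where $$c_{j,k}(J)=\begin{cases}\dfrac{1}{(2j)^2-(2k-1)^2} & \text{for } j\in J,\\[2mm] \dfrac{1}{(2k-1)(2j+2k-1)} & \text{for } j\notin J,\end{cases}\qquad c'_{j,k}(J)=\begin{cases}\dfrac{1}{(2j)^2-(2k-1)^2} & \text{for } k\in J,\\[2mm] \dfrac{1}{(2k-1)(2j+2k-1)} & \text{for } k\notin J.\end{cases}$$ Moreover, for every integer $s$ with $0\le s\le n-1$, $$\frac{v_{2n-1}^{(s)}}{2^{2n+s-1}}=\sum_{\substack{J\subseteq\{1,\dots,n-1\}\\ |J|=s}}\det\big(\tilde c_{j,k}(J)\big)_{1\le j,k\le n},$$ where $$\tilde c_{j,k}(J)=\begin{cases}\dfrac{1}{(2j)^2-(2k-1)^2} & \text{for } j\in J,\\[2mm] \dfrac{1}{(2k-1)(2j+2k-1)} & \text{for } j\notin J,\ j\ne n,\\[2mm] \dfrac{1}{2k-1} & \text{for } j=n.\end{cases}$$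
   Context: For a positive integer $d$ and an integer $s$ with $0\le s\le d/2$, let $\mathcal{E}_d^{(s)}$ be the set of all $(a_1,\dots,a_d)\in\mathbb{R}^d$ such that every complex root $\xi$ of the polynomial $X^d+a_1X^{d-1}+\cdots+a_{d-1}X+a_d$ satisfies $|\xi|<1$ and this polynomial has exactly $s$ pairs of complex conjugate nonreal roots (roots counted with multiplicity; so it has $r=d-2s$ real roots). Let $v_d^{(s)}=\lambda_d(\mathcal{E}_d^{(s)})$, where $\lambda_d$ is $d$-dimensional Lebesgue measure. *)

theory Defs
  imports "HOL-Analysis.Analysis" "Jordan_Normal_Form.Determinant"
begin

text \<open>A point \<open>(a\<^sub>1, \<dots>, a\<^sub>d)\<close> of \<open>\<real>\<^sup>d\<close> is an extensional function on \<open>{1..d}\<close>.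
  The polynomial \<open>X\<^sup>d + a\<^sub>1 X\<^bsup>d-1\<^esup> + \<dots> + a\<^sub>d\<close> is taken over the complex numbers,
  since all its complex roots matter.\<close>

definition monic_poly :: "nat \<Rightarrow> (nat \<Rightarrow> real) \<Rightarrow> complex poly" where
  "monic_poly d a = monom 1 d + (\<Sum>i = 1..d. monom (complex_of_real (a i)) (d - i))"

text \<open>The coefficients being real, a pair of conjugate nonreal roots has a common multiplicity
  and exactly one member in the upper half-plane, by which the pair is counted.\<close>

definition num_conj_pairs :: "complex poly \<Rightarrow> nat" where
  "num_conj_pairs p = (\<Sum>z | poly p z = 0 \<and> Im z > 0. Polynomial.order z p)"

definition E_set :: "nat \<Rightarrow> nat \<Rightarrow> (nat \<Rightarrow> real) set" where
  "E_set d s = {a \<in> {1..d} \<rightarrow>\<^sub>E (UNIV :: real set).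
     (\<forall>\<xi>. poly (monic_poly d a) \<xi> = 0 \<longrightarrow> cmod \<xi> < 1) \<and>
     num_conj_pairs (monic_poly d a) = s}"

text \<open>Lebesgue measure is the completion of the \<open>d\<close>-fold product of Borel-Lebesgue measure.\<close>

definition lebesgue_dim :: "nat \<Rightarrow> (nat \<Rightarrow> real) measure" where
  "lebesgue_dim d = completion (Pi\<^sub>M {1..d} (\<lambda>_. lborel))"

definition root_vol :: "nat \<Rightarrow> nat \<Rightarrow> real" where
  "root_vol d s = measure (lebesgue_dim d) (E_set d s)"

definition c_entry :: "nat set \<Rightarrow> nat \<Rightarrow> nat \<Rightarrow> real" where
  "c_entry J j k =
    (if j \<in> J then 1 / ((2 * real j)\<^sup>2 - (2 * real k - 1)\<^sup>2)
     else 1 / ((2 * real k - 1) * (2 * real j + 2 * real k - 1)))"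

definition c'_entry :: "nat set \<Rightarrow> nat \<Rightarrow> nat \<Rightarrow> real" where
  "c'_entry J j k =
    (if k \<in> J then 1 / ((2 * real j)\<^sup>2 - (2 * real k - 1)\<^sup>2)
     else 1 / ((2 * real k - 1) * (2 * real j + 2 * real k - 1)))"

definition c_tilde_entry :: "nat \<Rightarrow> nat set \<Rightarrow> nat \<Rightarrow> nat \<Rightarrow> real" where
  "c_tilde_entry n J j k =
    (if j \<in> J then 1 / ((2 * real j)\<^sup>2 - (2 * real k - 1)\<^sup>2)
     else if j \<noteq> n then 1 / ((2 * real k - 1) * (2 * real j + 2 * real k - 1))
     else 1 / (2 * real k - 1))"

text \<open>Matrix rows and columns are numbered from 0, the entries \<open>c j k\<close> from 1.
  Qualified names are needed because HOL-Analysis has its own \<open>mat\<close> and \<open>det\<close>.\<close>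

definition det_of :: "nat \<Rightarrow> (nat \<Rightarrow> nat \<Rightarrow> real) \<Rightarrow> real" where
  "det_of n c = Determinant.det (Matrix.mat n n (\<lambda>(i, l). c (i + 1) (l + 1)))"

end

theory Submission
  imports Defs "HOL-Computational_Algebra.Fundamental_Theorem_Algebra"
begin

text \<open>
  Why the theorem holds. Give every monic real polynomial with all roots in the open unit disc the
  weight \<open>t\<^sup>s\<close>, where \<open>s\<close> is its number of conjugate pairs, and all others the weight \<open>0\<close>. This
  weight is multiplicative, and its integral over the coefficient space of dimension \<open>d\<close> is the
  generating function \<open>\<Sum>\<^sub>s t\<^sup>s v\<^sub>d\<^sup>(\<^sup>s\<^sup>)\<close>. It is computed by splitting off one real quadratic
  factor at a time.

  Fix a squarefree monic real polynomial \<open>p\<close> of degree \<open>d\<close> and give a monic real quadratic factor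
  \<open>g\<close> the sign of the resultant of \<open>g\<close> and \<open>p / g\<close>. A conjugate pair gets \<open>+1\<close>, and a pair of real
  roots gets \<open>(-1)\<^sup>k\<close>, with \<open>k\<close> the number of real roots between them. These signs add up to
  \<open>d div 2\<close> (\<open>signed_count_quad_factors\<close>). On the other hand, when the first \<open>d - 2\<close> coefficients of
  \<open>p = g q\<close> are fixed, the last two are polynomial functions of the two coefficients of \<open>g\<close>, and the
  Jacobian determinant of this planar map is exactly the resultant of \<open>g\<close> and \<open>q\<close>. A degree
  formula for planar maps then gives \<open>weighted_integral_recursion\<close>: \<open>d div 2\<close> times an integral in
  degree \<open>d\<close> is an integral over \<open>g\<close> and over \<open>q\<close> in degree \<open>d - 2\<close>, with the resultant as density.
  The resultant enters with its sign, so no absolute value of a Vandermonde product ever appears and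
  the root coordinates need not be ordered.

  The integrands that arise are products of values \<open>p(z)\<close> at a list of points \<open>z\<close>, since the
  resultant is the product of the values of \<open>q\<close> at the two roots of \<open>g\<close>. After multiplication by the
  Vandermonde product of the points, iterating the recursion builds up a Vandermonde determinant whose
  rows are integrated two at a time. Expanding it over permutations gives \<open>vand_times_weighted_integral\<close>:
  a Pfaffian-like sum in the moments of \<open>(\<alpha>\<^sup>j \<beta>\<^sup>k - \<alpha>\<^sup>k \<beta>\<^sup>j) / (\<beta> - \<alpha>)\<close>, where \<open>\<alpha>\<close> and \<open>\<beta>\<close> are the roots
  of a quadratic polynomial. In odd degree one real root is left over and contributes a row of moments
  of \<open>x\<^sup>l\<close> on \<open>(-1, 1)\<close>.

  These moments vanish unless \<open>j\<close> and \<open>k\<close> have opposite parity, so only permutations that respect parity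
  count, and the sum collapses to \<open>n!\<close> times an ordinary determinant (\<open>pfaffian_sum_eq_leibniz\<close>). Its
  entries are \<open>4 (a + 2 t b)\<close>, where \<open>a\<close> and \<open>b\<close> are the two kinds of entries in the theorem. Expansion
  in powers of \<open>t\<close> along the rows and along the columns gives the two formulas for even degree, and
  along the rows the formula for odd degree.
\<close>

section \<open>Quadratic factors of a monic polynomial\<close>

definition quad :: "real \<Rightarrow> real \<Rightarrow> complex poly" where
  "quad u w = [:of_real w, of_real u, 1:]"

text \<open>With leading coefficient \<open>1\<close> in place of \<open>a 0\<close>, the value at
  \<open>Suc k\<close> is the coefficient of \<open>X\<^sup>-\<^sup>k\<close> in the expansion of
  \<open>1 + a\<^sub>1 X\<^sup>-\<^sup>1 + a\<^sub>2 X\<^sup>-\<^sup>2 + \<dots>\<close> divided by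
  \<open>1 + u X\<^sup>-\<^sup>1 + w X\<^sup>-\<^sup>2\<close>, so that it lists the coefficients of
  the quotient of a monic polynomial by \<open>X\<^sup>2 + u X + w\<close>. The index is shifted by
  one so that the coefficient before the leading one, which is \<open>0\<close>, has a place as
  well.\<close>

fun quo :: "real \<Rightarrow> real \<Rightarrow> (nat \<Rightarrow> real) \<Rightarrow> nat \<Rightarrow> real" where
  "quo u w a 0 = 0"
| "quo u w a (Suc 0) = 1"
| "quo u w a (Suc (Suc k)) = a (Suc k) - u * quo u w a (Suc k) - w * quo u w a k"

definition root_minus :: "real \<Rightarrow> real \<Rightarrow> complex" where
  "root_minus u w = (- of_real u - csqrt (of_real (u\<^sup>2 - 4 * w))) / 2"

definition root_plus :: "real \<Rightarrow> real \<Rightarrow> complex" where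
  "root_plus u w = (- of_real u + csqrt (of_real (u\<^sup>2 - 4 * w))) / 2"

lemma monic_poly_0 [simp]: "monic_poly 0 a = 1"
  by (simp add: monic_poly_def)

lemma monic_poly_Suc: "monic_poly (Suc d) a = pCons (of_real (a (Suc d))) (monic_poly d a)"
proof -
  have "(\<Sum>i = 1..d. monom (complex_of_real (a i)) (Suc d - i))
      = pCons 0 (\<Sum>i = 1..d. monom (complex_of_real (a i)) (d - i))"
  proof (rule poly_eqI)
    fix n
    show "coeff (\<Sum>i = 1..d. monom (complex_of_real (a i)) (Suc d - i)) n
        = coeff (pCons 0 (\<Sum>i = 1..d. monom (complex_of_real (a i)) (d - i))) n"
      by (cases n) (auto simp: coeff_sum coeff_pCons Suc_diff_le intro!: sum.cong sum.neutral)
  qed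
  then show ?thesis
    unfolding monic_poly_def
    by (simp add: monom_Suc monom_0)
qed

lemma degree_monic_poly [simp]: "degree (monic_poly d a) = d"
  and lead_coeff_monic_poly [simp]: "coeff (monic_poly d a) d = 1"
  and monic_poly_nonzero [simp]: "monic_poly d a \<noteq> 0"
proof -
  have *: "degree (monic_poly d a) = d \<and> monic_poly d a \<noteq> 0 \<and> coeff (monic_poly d a) d = 1"
    by (induction d) (auto simp: monic_poly_Suc)
  then show "degree (monic_poly d a) = d" "coeff (monic_poly d a) d = 1" "monic_poly d a \<noteq> 0"
    by auto
qed

lemma monic_poly_cong: "(\<And>i. 1 \<le> i \<Longrightarrow> i \<le> d \<Longrightarrow> a i = b i) \<Longrightarrow> monic_poly d a = monic_poly d b"
  unfolding monic_poly_def by (intro arg_cong2[where f = "(+)"] sum.cong) auto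

text \<open>Division with remainder: both coefficients of the remainder are affine in the last two
  coefficients of the dividend, which do not enter the quotient.\<close>

lemma monic_poly_divide_quad:
  "monic_poly (Suc (Suc N)) a = quad u w * monic_poly N (\<lambda>k. quo u w a (Suc k))
     + [:of_real (a (Suc (Suc N)) - w * quo u w a (Suc N)),
         of_real (a (Suc N) - u * quo u w a (Suc N) - w * quo u w a N):]"
proof (induction N)
  case 0
  then show ?case by (simp add: monic_poly_Suc quad_def)
next
  case (Suc N)
  have "monic_poly (Suc (Suc (Suc N))) a
    = pCons (of_real (a (Suc (Suc (Suc N))))) (monic_poly (Suc (Suc N)) a)"
    by (rule monic_poly_Suc)
  then show ?case
    unfolding Suc.IH monic_poly_Suc[of N]
    by (simp add: quad_def algebra_simps)
qed

lemma roots_quad: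
  "root_minus u w + root_plus u w = - of_real u" "root_minus u w * root_plus u w = of_real w"
proof -
  show "root_minus u w + root_plus u w = - of_real u"
    by (simp add: root_minus_def root_plus_def field_simps)
  have "csqrt (of_real (u\<^sup>2 - 4 * w)) ^ 2 = of_real (u\<^sup>2 - 4 * w)" by (rule power2_csqrt)
  then show "root_minus u w * root_plus u w = of_real w"
    by (simp add: root_minus_def root_plus_def field_simps power2_eq_square)
qed

lemma quad_factor: "quad u w = [:- root_minus u w, 1:] * [:- root_plus u w, 1:]"
proof -
  have "[:- root_minus u w, 1:] * [:- root_plus u w, 1:]
    = [:root_minus u w * root_plus u w, - (root_minus u w + root_plus u w), 1:]"
    by simp
  then show ?thesis
    unfolding roots_quad quad_def by simp
qed

lemma poly_quad_eq_0_iff: "poly (quad u w) z = 0 \<longleftrightarrow> z = root_minus u w \<or> z = root_plus u w"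
  unfolding quad_factor poly_mult mult_eq_0_iff by (simp add: algebra_simps)

lemma root_minus_eq_root_plus_iff: "root_minus u w = root_plus u w \<longleftrightarrow> u\<^sup>2 = 4 * w"
proof -
  have "root_minus u w = root_plus u w \<longleftrightarrow> csqrt (of_real (u\<^sup>2 - 4 * w)) = 0"
    by (auto simp: root_minus_def root_plus_def field_simps)
  also have "\<dots> \<longleftrightarrow> u\<^sup>2 = 4 * w" by (simp only: csqrt_eq_0 of_real_eq_0_iff) simp
  finally show ?thesis .
qed

text \<open>Dividing the quotient a second time: reduction modulo the quadratic polynomial leaves a
  linear remainder, given by the same recursion.\<close>

lemma poly_monic_poly_mod_quad:
  assumes "poly (quad u w) z = 0"
  shows "poly (monic_poly N b) z
    = of_real (quo u w b N) * z + of_real (quo u w b (Suc N) + u * quo u w b N)"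
proof (induction N)
  case (Suc N)
  have z: "z * z = - of_real u * z - of_real w"
  proof -
    have "z * z + of_real u * z + of_real w = 0"
      using assms by (simp add: quad_def algebra_simps)
    moreover have "z * z = (z * z + of_real u * z + of_real w) - of_real u * z - of_real w"
      by simp
    ultimately show ?thesis by simp
  qed
  have "poly (monic_poly (Suc N) b) z = of_real (b (Suc N)) + of_real (quo u w b N) * (z * z)
     + of_real (quo u w b (Suc N) + u * quo u w b N) * z"
    by (simp add: monic_poly_Suc Suc.IH algebra_simps)
  also have "\<dots> = of_real (quo u w b (Suc N)) * z + of_real (quo u w b (Suc (Suc N)) + u * quo u w b (Suc N))"
    unfolding z by (simp add: algebra_simps)
  finally show ?case .
qed simp

definition quad_resultant :: "real \<Rightarrow> real \<Rightarrow> complex poly \<Rightarrow> complex" where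
  "quad_resultant u w m = poly m (root_minus u w) * poly m (root_plus u w)"

text \<open>The resultant through the linear remainder \<open>e X + f\<close>: the product of
  \<open>e \<alpha> + f\<close> and \<open>e \<beta> + f\<close> is symmetric in the roots. The same
  expression is the Jacobian determinant further below.\<close>

lemma quad_resultant_monic_poly:
  "quad_resultant u w (monic_poly N b)
    = of_real (quo u w b (Suc N) * (quo u w b (Suc N) + u * quo u w b N) + w * (quo u w b N)\<^sup>2)"
proof -
  define e f where "e = complex_of_real (quo u w b N)"
    and "f = complex_of_real (quo u w b (Suc N) + u * quo u w b N)"
  define x y where "x = root_minus u w" and "y = root_plus u w"
  have "quad_resultant u w (monic_poly N b) = (e * x + f) * (e * y + f)"
    unfolding quad_resultant_def e_def f_def x_def y_def
    by (subst (1 2) poly_monic_poly_mod_quad[where u = u and w = w]) (simp_all add: poly_quad_eq_0_iff)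
  also have "\<dots> = e\<^sup>2 * (x * y) + e * f * (x + y) + f\<^sup>2"
    by (simp add: algebra_simps power2_eq_square)
  also have "\<dots> = e\<^sup>2 * of_real w - e * f * of_real u + f\<^sup>2"
    using roots_quad[of u w] by (simp add: x_def y_def)
  also have "\<dots> = of_real (quo u w b (Suc N) * (quo u w b (Suc N) + u * quo u w b N) + w * (quo u w b N)\<^sup>2)"
    by (simp add: e_def f_def algebra_simps power2_eq_square)
  finally show ?thesis .
qed

section \<open>A multiplicative weight\<close>

text \<open>Summing over a common superset of the roots makes the count additive for
  products.\<close>

lemma num_conj_pairs_superset:
  assumes "p \<noteq> 0" "finite S" "{z. poly p z = 0 \<and> Im z > 0} \<subseteq> S" "\<And>z. z \<in> S \<Longrightarrow> Im z > 0"
  shows "num_conj_pairs p = (\<Sum>z\<in>S. Polynomial.order z p)"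
  unfolding num_conj_pairs_def
  by (rule sum.mono_neutral_left) (use assms in \<open>auto simp: order_root\<close>)

lemma num_conj_pairs_mult:
  assumes "p \<noteq> 0" "q \<noteq> 0"
  shows "num_conj_pairs (p * q) = num_conj_pairs p + num_conj_pairs q"
proof -
  define S where "S = {z. poly (p * q) z = 0 \<and> Im z > 0}"
  have pq: "p * q \<noteq> 0" using assms by simp
  have fin: "finite S" unfolding S_def by (rule finite_subset[OF _ poly_roots_finite[OF pq]]) auto
  have "num_conj_pairs (p * q) = (\<Sum>z\<in>S. Polynomial.order z (p * q))"
    by (rule num_conj_pairs_superset[OF pq fin]) (auto simp: S_def)
  also have "\<dots> = (\<Sum>z\<in>S. Polynomial.order z p) + (\<Sum>z\<in>S. Polynomial.order z q)"
    by (simp add: order_mult[OF pq] sum.distrib)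
  also have "(\<Sum>z\<in>S. Polynomial.order z p) = num_conj_pairs p"
    by (rule num_conj_pairs_superset[symmetric]) (use assms fin in \<open>auto simp: S_def\<close>)
  also have "(\<Sum>z\<in>S. Polynomial.order z q) = num_conj_pairs q"
    by (rule num_conj_pairs_superset[symmetric]) (use assms fin in \<open>auto simp: S_def\<close>)
  finally show ?thesis .
qed

lemma num_conj_pairs_linear: "num_conj_pairs [:- x, 1:] = (if Im x > 0 then 1 else 0)"
proof -
  have "num_conj_pairs [:- x, 1:] = (\<Sum>z\<in>(if Im x > 0 then {x} else {}). Polynomial.order z [:- x, 1:])"
    by (rule num_conj_pairs_superset) (auto split: if_splits)
  then show ?thesis using order_power_n_n[of x 1] by auto
qed

text \<open>The variable \<open>t\<close> marks conjugate pairs. It is treated as a number in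
  \<open>[0, 1]\<close>, which suffices to compare coefficients of polynomials in
  \<open>t\<close>.\<close>

definition weight :: "real \<Rightarrow> complex poly \<Rightarrow> real" where
  "weight t p = (if \<forall>\<xi>. poly p \<xi> = 0 \<longrightarrow> cmod \<xi> < 1 then t ^ num_conj_pairs p else 0)"

lemma weight_mult: "p \<noteq> 0 \<Longrightarrow> q \<noteq> 0 \<Longrightarrow> weight t (p * q) = weight t p * weight t q"
  by (auto simp: weight_def num_conj_pairs_mult power_add)

lemma weight_1 [simp]: "weight t 1 = 1"
  by (simp add: weight_def num_conj_pairs_def)

lemma weight_linear: "weight t [:- x, 1:] = (if cmod x < 1 then if Im x > 0 then t else 1 else 0)"
  by (auto simp: weight_def num_conj_pairs_linear)

lemma quad_nonzero [simp]: "quad u w \<noteq> 0"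
  by (simp add: quad_def)

section \<open>The signed number of quadratic factors\<close>

text \<open>At the points of \<open>R\<close> the terms are the signs of the derivative of
  \<open>\<Prod>y\<in>R. (X - y)\<close>. They alternate, and the last one is \<open>+1\<close>.
  Adjoining a new maximum flips all signs and adds a \<open>+1\<close>.\<close>

lemma sum_prod_sgn_differences:
  fixes R :: "real set"
  assumes "finite R"
  shows "(\<Sum>x\<in>R. \<Prod>y\<in>R - {x}. sgn (x - y)) = (if odd (card R) then 1 else 0)"
  using assms
proof (induction R rule: finite_linorder_max_induct)
  case (insert b A)
  have b: "b \<notin> A" using insert.hyps by auto
  have top: "(\<Prod>y\<in>insert b A - {b}. sgn (b - y)) = 1"
    by (rule prod.neutral) (use insert.hyps in \<open>auto simp: sgn_if\<close>)
  have other: "(\<Prod>y\<in>insert b A - {x}. sgn (x - y)) = - (\<Prod>y\<in>A - {x}. sgn (x - y))"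
    if "x \<in> A" for x
  proof -
    have "insert b A - {x} = insert b (A - {x})" using that b by auto
    moreover have "sgn (x - b) = -1" using that insert.hyps by auto
    ultimately show ?thesis
      using that insert.hyps b by simp
  qed
  have "(\<Sum>x\<in>insert b A. \<Prod>y\<in>insert b A - {x}. sgn (x - y))
      = 1 + (\<Sum>x\<in>A. - (\<Prod>y\<in>A - {x}. sgn (x - y)))"
    using b insert.hyps top other by (subst sum.insert) (auto cong: sum.cong)
  then show ?case
    using insert b by (simp add: sum_negf)
qed simp

text \<open>As the values \<open>\<tau> x\<close> are \<open>\<plusminus>1\<close>, the square of
  their sum is \<open>card R\<close> plus twice the sum of \<open>\<tau> x * \<tau> y\<close> over
  pairs, and that square is \<open>0\<close> or \<open>1\<close> by parity.\<close>

lemma sum_pairs_sgn_differences: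
  fixes R :: "real set"
  assumes "finite R"
  defines "\<tau> \<equiv> \<lambda>x. \<Prod>y\<in>R - {x}. sgn (x - y)"
  shows "(\<Sum>(x, y) | x \<in> R \<and> y \<in> R \<and> x < y. - \<tau> x * \<tau> y) = real (card R div 2)"
proof -
  define T where "T = {(x, y). x \<in> R \<and> y \<in> R \<and> x < y}"
  define T' where "T' = {(x, y). x \<in> R \<and> y \<in> R \<and> y < x}"
  define D where "D = (\<lambda>x. (x, x)) ` R"
  have fin: "finite T" "finite T'" "finite D"
    unfolding T_def T'_def D_def
    by (rule finite_subset[of _ "R \<times> R"], use assms in auto)+
  have sq: "\<tau> x * \<tau> x = 1" for x
  proof -
    have "\<tau> x * \<tau> x = (\<Prod>y\<in>R - {x}. sgn (x - y) * sgn (x - y))"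
      unfolding \<tau>_def by (rule prod.distrib[symmetric])
    also have "\<dots> = 1" by (rule prod.neutral) (auto simp: sgn_if)
    finally show ?thesis .
  qed
  have "(\<Sum>x\<in>R. \<tau> x) * (\<Sum>y\<in>R. \<tau> y) = (\<Sum>(x, y)\<in>R \<times> R. \<tau> x * \<tau> y)"
    by (simp add: sum_product sum.cartesian_product)
  also have "R \<times> R = T \<union> T' \<union> D"
    by (auto simp: T_def T'_def D_def)
  also have "(\<Sum>(x, y)\<in>T \<union> T' \<union> D. \<tau> x * \<tau> y)
      = (\<Sum>(x, y)\<in>T. \<tau> x * \<tau> y) + (\<Sum>(x, y)\<in>T'. \<tau> x * \<tau> y) + (\<Sum>(x, y)\<in>D. \<tau> x * \<tau> y)"
    using fin by (subst sum.union_disjoint sum.union_disjoint; auto simp: T_def T'_def D_def)+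
  also have "(\<Sum>(x, y)\<in>T'. \<tau> x * \<tau> y) = (\<Sum>(x, y)\<in>T. \<tau> x * \<tau> y)"
    by (rule sum.reindex_bij_witness[of _ prod.swap prod.swap]) (auto simp: T_def T'_def)
  also have "(\<Sum>(x, y)\<in>D. \<tau> x * \<tau> y) = real (card R)"
    by (simp add: D_def sum.reindex inj_on_def sq)
  finally have "2 * (\<Sum>(x, y)\<in>T. \<tau> x * \<tau> y)
      = (\<Sum>x\<in>R. \<tau> x) * (\<Sum>y\<in>R. \<tau> y) - real (card R)" by simp
  also have "(\<Sum>x\<in>R. \<tau> x) = (if odd (card R) then 1 else 0)"
    unfolding \<tau>_def by (rule sum_prod_sgn_differences[OF assms(1)])
  finally have "2 * (\<Sum>(x, y)\<in>T. \<tau> x * \<tau> y) = - 2 * real (card R div 2)"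
    by (cases "even (card R)") (auto elim!: evenE oddE)
  moreover have "(\<Sum>(x, y) | x \<in> R \<and> y \<in> R \<and> x < y. - \<tau> x * \<tau> y) = - (\<Sum>(x, y)\<in>T. \<tau> x * \<tau> y)"
    by (simp add: T_def case_prod_unfold sum_negf)
  ultimately show ?thesis by simp
qed

text \<open>The resultant does not depend on which root is called \<open>root_minus\<close>.\<close>

lemma quad_resultant_eq:
  assumes "quad u w = [:- x, 1:] * [:- y, 1:]"
  shows "quad_resultant u w m = poly m x * poly m y"
proof -
  have xy: "x + y = - of_real u"
  proof -
    have "coeff (quad u w) 1 = - (x + y)" by (simp add: assms)
    then show ?thesis by (simp add: quad_def)
  qed
  have "poly (quad u w) x = 0" by (simp add: assms)
  then consider "x = root_minus u w" | "x = root_plus u w" by (auto simp: poly_quad_eq_0_iff)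
  then show ?thesis
  proof cases
    case 1
    then have "y = root_plus u w" using xy roots_quad(1)[of u w] by (metis add_left_cancel)
    with 1 show ?thesis by (simp add: quad_resultant_def)
  next
    case 2
    then have "y = root_minus u w" using xy roots_quad(1)[of u w] by (metis add.commute add_left_cancel)
    with 2 show ?thesis by (simp add: quad_resultant_def)
  qed
qed

lemma quad_real: "quad (- (x + y)) (x * y) = [:- of_real x, 1:] * [:- of_real y, 1:]"
  by (simp add: quad_def)

lemma quad_cnj: "quad (- 2 * Re z) ((cmod z)\<^sup>2) = [:- z, 1:] * [:- cnj z, 1:]"
  by (simp add: quad_def complex_norm_square complex_add_cnj[symmetric] del: of_real_power)
     (simp add: complex_eq_iff)

lemma poly_monic_poly_cnj: "poly (monic_poly d a) (cnj z) = cnj (poly (monic_poly d a) z)"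
  by (induction d) (simp_all add: monic_poly_Suc)

text \<open>A multiple real root \<open>z\<close> gives the factor \<open>(X - z)\<^sup>2\<close>,
  and a multiple nonreal root \<open>z\<close> gives the factor \<open>(X - z) (X - cnj z)\<close>
  whose cofactor still vanishes at \<open>z\<close>.\<close>

lemma rsquarefree_monic_poly:
  assumes sep: "\<And>u w. quad u w dvd monic_poly d a \<Longrightarrow>
    u\<^sup>2 \<noteq> 4 * w \<and> quad_resultant u w (monic_poly d a div quad u w) \<noteq> 0"
  shows "rsquarefree (monic_poly d a)"
  unfolding rsquarefree_def
proof (intro conjI allI)
  let ?p = "monic_poly d a"
  fix z
  show "Polynomial.order z ?p = 0 \<or> Polynomial.order z ?p = 1"
  proof (rule ccontr)
    assume "\<not> ?thesis"
    then have "2 \<le> Polynomial.order z ?p" by linarith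
    then have "[:- z, 1:] ^ 2 dvd ?p"
      by (meson order_1 dvd_trans le_imp_power_dvd)
    then obtain s where s: "?p = [:- z, 1:] ^ 2 * s" by (elim dvdE)
    show False
    proof (cases "Im z = 0")
      case True
      then have z: "z = of_real (Re z)" by (simp add: complex_eq_iff)
      have "quad (- (Re z + Re z)) (Re z * Re z) = [:- z, 1:] ^ 2"
        by (subst quad_real) (simp add: z[symmetric] power2_eq_square)
      then have "quad (- (Re z + Re z)) (Re z * Re z) dvd ?p" using s by simp
      from sep[OF this] show False by (simp add: power2_eq_square algebra_simps)
    next
      case False
      then have ne: "cnj z \<noteq> z" by (auto simp: complex_eq_iff)
      have "poly ?p (cnj z) = 0" unfolding poly_monic_poly_cnj by (simp add: s)
      then have "poly s (cnj z) = 0" using ne by (simp add: s)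
      then obtain s' where s': "s = [:- cnj z, 1:] * s'" by (metis poly_eq_0_iff_dvd dvdE)
      have p: "?p = quad (- 2 * Re z) ((cmod z)\<^sup>2) * ([:- z, 1:] * s')"
        unfolding quad_cnj s s' by (simp only: power2_eq_square mult_ac)
      then have dvd: "quad (- 2 * Re z) ((cmod z)\<^sup>2) dvd ?p" by simp
      have "?p div quad (- 2 * Re z) ((cmod z)\<^sup>2) = [:- z, 1:] * s'"
        unfolding p by (rule nonzero_mult_div_cancel_left) simp
      moreover have "quad_resultant (- 2 * Re z) ((cmod z)\<^sup>2) ([:- z, 1:] * s') = 0"
        by (subst quad_resultant_eq[OF quad_cnj]) simp
      ultimately have "quad_resultant (- 2 * Re z) ((cmod z)\<^sup>2) (?p div quad (- 2 * Re z) ((cmod z)\<^sup>2)) = 0"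
        by (simp only:)
      with sep[OF dvd] show False by blast
    qed
  qed
qed simp

lemma sgn_prod_real: "sgn (\<Prod>x\<in>A. f x :: real) = (\<Prod>x\<in>A. sgn (f x))"
  by (induction A rule: infinite_finite_induct) (simp_all add: sgn_mult)

text \<open>Each conjugate pair contributes \<open>+1\<close>, because the cofactor takes conjugate
  values at \<open>z\<close> and \<open>cnj z\<close>. For a pair of real roots the nonreal roots
  contribute positive factors to the resultant, and what remains is \<open>- \<tau> x * \<tau>
  y\<close>, with \<open>\<tau>\<close> the signs of the differences among the real roots. The sum
  is the number of conjugate pairs plus half the number of real roots, rounded down.\<close>

theorem signed_count_quad_factors:
  assumes "rsquarefree (monic_poly d a)"
  defines "p \<equiv> monic_poly d a"
  defines "Q \<equiv> {(u, w). quad u w dvd p}"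
  shows "finite Q"
    and "(\<Sum>(u, w)\<in>Q. sgn (Re (quad_resultant u w (p div quad u w)))) = real (d div 2)"
proof -
  define Z where "Z = {z. poly p z = 0}"
  define R where "R = {x. poly p (complex_of_real x) = 0}"
  define P where "P = {z \<in> Z. Im z > 0}"
  have finZ: "finite Z" unfolding Z_def p_def by (rule poly_roots_finite) simp
  have finP: "finite P" using finZ by (simp add: P_def)
  have "of_real ` R \<subseteq> Z" by (auto simp: R_def Z_def)
  then have "finite (complex_of_real ` R)" by (rule finite_subset) (rule finZ)
  then have finR: "finite R" by (rule finite_imageD) (simp add: inj_on_def)
  have pZ: "p = (\<Prod>z\<in>Z. [:- z, 1:])"
    using complex_poly_decompose_rsquarefree[OF assms(1)] by (simp add: p_def Z_def)
  have cnjZ: "cnj z \<in> Z" if "z \<in> Z" for z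
    using that by (simp add: Z_def p_def poly_monic_poly_cnj)
  have Zeq: "Z = of_real ` R \<union> (P \<union> cnj ` P)"
  proof (intro equalityI subsetI)
    fix z assume z: "z \<in> Z"
    consider "Im z = 0" | "Im z > 0" | "Im z < 0" by linarith
    then show "z \<in> of_real ` R \<union> (P \<union> cnj ` P)"
    proof cases
      case 1
      then have "z = of_real (Re z)" by (simp add: complex_eq_iff)
      then show ?thesis using z by (auto simp: R_def Z_def intro!: image_eqI[of _ _ "Re z"])
    next
      case 3
      then have "cnj z \<in> P" using cnjZ[OF z] by (simp add: P_def)
      then show ?thesis by (metis UnI2 complex_cnj_cnj imageI)
    qed (use z in \<open>auto simp: P_def\<close>)
  qed (auto simp: R_def Z_def P_def dest: cnjZ[unfolded Z_def, simplified])
  have disj: "of_real ` R \<inter> (P \<union> cnj ` P) = {}" "P \<inter> cnj ` P = {}"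
    by (auto simp: P_def complex_eq_iff)
  have inj: "inj_on complex_of_real A" "inj_on cnj B" for A B
    by (auto simp: inj_on_def)
  have "degree p = card Z"
    unfolding pZ by (subst degree_prod_sum_eq) auto
  then have "d = card Z" by (simp add: p_def)
  also have "\<dots> = card R + (card P + card P)"
    unfolding Zeq using finR finP disj inj by (subst card_Un_disjoint card_Un_disjoint; simp add: card_image)+
  finally have d: "d div 2 = card R div 2 + card P" by simp

  define qr where "qr = (\<lambda>(x, y). (- (x + y), x * y :: real))"
  define qc where "qc = (\<lambda>z. (- 2 * Re z, (cmod z)\<^sup>2))"
  define T where "T = {(x, y). x \<in> R \<and> y \<in> R \<and> x < y}"
  have finT: "finite T" unfolding T_def by (rule finite_subset[of _ "R \<times> R"]) (use finR in auto)
  have p2: "p = ([:- x, 1:] * [:- y, 1:]) * (\<Prod>z\<in>Z - {x, y}. [:- z, 1:])"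
    if "x \<in> Z" "y \<in> Z" "x \<noteq> y" for x y
  proof -
    have "Z = insert x (insert y (Z - {x, y}))" using that by auto
    then have "p = (\<Prod>z\<in>insert x (insert y (Z - {x, y})). [:- z, 1:])" using pZ by simp
    also have "\<dots> = [:- x, 1:] * ([:- y, 1:] * (\<Prod>z\<in>Z - {x, y}. [:- z, 1:]))"
      using finZ that by (subst prod.insert, simp, simp, subst prod.insert, auto)
    finally show ?thesis by (simp only: mult.assoc)
  qed
  have dv: "p div quad u w = (\<Prod>z\<in>Z - {x, y}. [:- z, 1:])" "quad u w dvd p"
    if "quad u w = [:- x, 1:] * [:- y, 1:]" "x \<in> Z" "y \<in> Z" "x \<noteq> y" for u w x y
  proof -
    show "p div quad u w = (\<Prod>z\<in>Z - {x, y}. [:- z, 1:])"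
      unfolding p2[OF that(2-4)] that(1)[symmetric] by (rule nonzero_mult_div_cancel_left) simp
    show "quad u w dvd p"
      unfolding p2[OF that(2-4)] that(1)[symmetric] by simp
  qed
  have sub: "qr ` T \<union> qc ` P \<subseteq> Q"
  proof -
    have "(- (x + y), x * y) \<in> Q" if "x \<in> R" "y \<in> R" "x < y" for x y
      using dv(2)[OF quad_real[of x y]] that by (auto simp: Q_def Zeq)
    moreover have "(- 2 * Re z, (cmod z)\<^sup>2) \<in> Q" if "z \<in> P" for z
      using dv(2)[OF quad_cnj[of z]] that disj(2) by (auto simp: Q_def Zeq)
    ultimately show ?thesis by (auto simp: qr_def qc_def T_def)
  qed
  have sup: "Q \<subseteq> qr ` T \<union> qc ` P"
  proof
    fix v assume "v \<in> Q"
    then obtain u w where v: "v = (u, w)" and dvd: "quad u w dvd p" by (auto simp: Q_def)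
    define x y where "x = root_minus u w" and "y = root_plus u w"
    have f: "quad u w = [:- x, 1:] * [:- y, 1:]" unfolding x_def y_def by (rule quad_factor)
    have xZ: "x \<in> Z" and yZ: "y \<in> Z"
      using dvd poly_eq_0_iff_dvd dvd_trans by (auto simp: Z_def x_def y_def poly_quad_eq_0_iff elim!: dvdE)
    have neq: "x \<noteq> y"
    proof
      assume "x = y"
      then have "[:- x, 1:] ^ 2 dvd p" using dvd by (simp add: f power2_eq_square)
      then have "2 \<le> Polynomial.order x p" by (simp add: order_divides p_def)
      then show False using assms(1) unfolding rsquarefree_def p_def
        by (metis numeral_le_one_iff not_numeral_le_zero semiring_norm(69))
    qed
    have disc: "u\<^sup>2 - 4 * w \<noteq> 0" using neq by (auto simp: x_def y_def root_minus_eq_root_plus_iff)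
    show "v \<in> qr ` T \<union> qc ` P"
    proof (cases "u\<^sup>2 - 4 * w > 0")
      case True
      define s where "s = sqrt (u\<^sup>2 - 4 * w)"
      have s: "s > 0" "s * s = u\<^sup>2 - 4 * w" using True by (auto simp: s_def)
      have "csqrt (of_real (u\<^sup>2 - 4 * w)) = of_real s"
        using True unfolding s_def by (subst of_real_sqrt) auto
      then have x: "x = of_real ((- u - s) / 2)" and y: "y = of_real ((- u + s) / 2)"
        by (simp_all add: x_def y_def root_minus_def root_plus_def)
      have "((- u - s) / 2, (- u + s) / 2) \<in> T"
        using s(1) xZ yZ by (simp add: T_def R_def Z_def x y)
      moreover have "v = qr ((- u - s) / 2, (- u + s) / 2)"
        using s(2) by (simp add: v qr_def field_simps power2_eq_square)
      ultimately show ?thesis by blast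
    next
      case False
      then have neg: "u\<^sup>2 - 4 * w < 0" using disc by linarith
      define s where "s = sqrt (4 * w - u\<^sup>2)"
      have s: "s > 0" "s * s = 4 * w - u\<^sup>2" using neg by (auto simp: s_def)
      have "csqrt (of_real (u\<^sup>2 - 4 * w)) = \<i> * of_real s"
        using neg unfolding s_def
        by (metis csqrt_of_real_nonpos abs_of_neg minus_diff_eq less_imp_le Re_complex_of_real Im_complex_of_real)
      then have y: "y = Complex (- u / 2) (s / 2)"
        by (simp add: y_def root_plus_def complex_eq_iff)
      have "y \<in> P" using yZ s(1) by (simp add: P_def y)
      moreover have "v = qc y"
      proof -
        have "(cmod y)\<^sup>2 = (u / 2)\<^sup>2 + (s / 2)\<^sup>2" by (simp add: y cmod_power2)
        then have "(cmod y)\<^sup>2 = w" using s(2) by (simp add: power2_eq_square field_simps)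
        then show ?thesis by (simp add: v qc_def) (simp add: y)
      qed
      ultimately show ?thesis by blast
    qed
  qed
  have Qeq: "Q = qr ` T \<union> qc ` P" using sub sup by blast
  show "finite Q" unfolding Qeq using finT finP by simp
  \<comment> \<open>Discriminants of the two kinds have opposite signs.\<close>
  have disjQ: "qr ` T \<inter> qc ` P = {}"
  proof -
    have False if "x < y" "Im z > 0" "- (x + y) = - 2 * Re z" "x * y = (cmod z)\<^sup>2" for x y z
    proof -
      have "(x - y)\<^sup>2 = (x + y)\<^sup>2 - 4 * (x * y)" by (simp add: power2_eq_square algebra_simps)
      also have "x + y = 2 * Re z" using that(3) by simp
      also have "(2 * Re z)\<^sup>2 - 4 * (x * y) = - 4 * (Im z)\<^sup>2"
        unfolding that(4) by (simp add: cmod_power2 power_mult_distrib)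
      finally have "(x - y)\<^sup>2 + 4 * (Im z)\<^sup>2 = 0" by simp
      then have "Im z = 0" using that(2) by (simp add: add_nonneg_eq_0_iff)
      then show False using that(2) by simp
    qed
    then show ?thesis by (fastforce simp: qr_def qc_def T_def P_def)
  qed
  have injr: "inj_on qr T"
  proof (rule inj_onI)
    fix v v' assume A: "v \<in> T" "v' \<in> T" "qr v = qr v'"
    obtain x y x' y' where v: "v = (x, y)" "v' = (x', y')" by fastforce
    have lt: "x < y" "x' < y'" and e: "x + y = x' + y'" "x * y = x' * y'"
      using A by (auto simp: v T_def qr_def)
    have "(y - x)\<^sup>2 = (x + y)\<^sup>2 - 4 * (x * y)" by (simp add: power2_eq_square algebra_simps)
    also have "\<dots> = (y' - x')\<^sup>2" unfolding e by (simp add: power2_eq_square algebra_simps)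
    finally have "y - x = y' - x'" using lt by (simp add: power2_eq_iff)
    then show "v = v'" using e(1) by (simp add: v)
  qed
  have injc: "inj_on qc P"
  proof (rule inj_onI)
    fix z z' assume A: "z \<in> P" "z' \<in> P" "qc z = qc z'"
    then have "Re z = Re z'" "(Im z)\<^sup>2 = (Im z')\<^sup>2" by (auto simp: qc_def cmod_power2)
    then show "z = z'" using A(1,2) by (simp add: complex_eq_iff P_def power2_eq_iff)
  qed

  define \<tau> where "\<tau> = (\<lambda>x. \<Prod>y\<in>R - {x}. sgn (x - y))"
  let ?S = "\<lambda>(u, w). sgn (Re (quad_resultant u w (p div quad u w)))"
  have real_pair: "?S (qr (x, y)) = - \<tau> x * \<tau> y" if "x \<in> R" "y \<in> R" "x < y" for x y
  proof -
    let ?m = "\<Prod>z\<in>Z - {of_real x, of_real y}. [:- z, 1:]"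
    define A where "A = (\<lambda>\<xi>. \<Prod>r\<in>R - {x, y}. \<xi> - r)"
    define B where "B = (\<lambda>\<xi>::real. \<Prod>z\<in>P. (cmod (of_real \<xi> - z))\<^sup>2)"
    have Zxy: "Z - {of_real x, of_real y} = of_real ` (R - {x, y}) \<union> (P \<union> cnj ` P)"
      using that disj(1) unfolding Zeq by auto
    have m: "poly ?m (of_real \<xi>) = of_real (A \<xi> * B \<xi>)" for \<xi>
    proof -
      have "poly ?m (of_real \<xi>) = (\<Prod>z\<in>of_real ` (R - {x, y}) \<union> (P \<union> cnj ` P). of_real \<xi> - z)"
        unfolding Zxy poly_prod by simp
      also have "\<dots> = (\<Prod>z\<in>of_real ` (R - {x, y}). of_real \<xi> - z)
          * ((\<Prod>z\<in>P. of_real \<xi> - z) * (\<Prod>z\<in>cnj ` P. of_real \<xi> - z))"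
        using finR finP disj by (subst prod.union_disjoint, simp, simp, blast, subst prod.union_disjoint, auto)
      also have "(\<Prod>z\<in>complex_of_real ` (R - {x, y}). of_real \<xi> - z) = of_real (A \<xi>)"
        by (subst prod.reindex[OF inj(1)]) (simp add: A_def)
      also have "(\<Prod>z\<in>P. of_real \<xi> - z) * (\<Prod>z\<in>cnj ` P. of_real \<xi> - z) = of_real (B \<xi>)"
        by (subst prod.reindex[OF inj(2)])
           (simp add: B_def prod.distrib[symmetric] complex_norm_square del: of_real_power)
      finally show ?thesis by simp
    qed
    have B: "B \<xi> > 0" for \<xi>
      unfolding B_def by (rule prod_pos) (auto simp: P_def)
    have xyZ: "of_real x \<in> Z" "of_real y \<in> Z" "complex_of_real x \<noteq> of_real y"
      using that by (auto simp: Zeq)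
    have "quad_resultant (- (x + y)) (x * y) (p div quad (- (x + y)) (x * y))
        = of_real (A x * B x) * of_real (A y * B y)"
      unfolding quad_resultant_eq[OF quad_real] dv(1)[OF quad_real xyZ] m ..
    then have "?S (qr (x, y)) = sgn (A x) * sgn (A y)"
      using B by (simp add: qr_def sgn_mult)
    also have "\<dots> = - \<tau> x * \<tau> y"
    proof -
      have ins: "R - {x} = insert y (R - {x, y})" "R - {y} = insert x (R - {x, y})"
        using that by auto
      have "\<tau> x = sgn (x - y) * sgn (A x)" "\<tau> y = sgn (y - x) * sgn (A y)"
        unfolding \<tau>_def A_def sgn_prod_real
        by (subst ins, rule prod.insert, use finR in auto)+
      then show ?thesis using that(3) by simp
    qed
    finally show ?thesis .
  qed
  have cnj_pair: "?S (qc z) = 1" if "z \<in> P" for z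
  proof -
    let ?m = "\<Prod>\<xi>\<in>Z - {z, cnj z}. [:- \<xi>, 1:]"
    have zZ: "z \<in> Z" "cnj z \<in> Z" "z \<noteq> cnj z" using that disj(2) by (auto simp: Zeq)
    have im: "cnj ` (Z - {z, cnj z}) = Z - {z, cnj z}"
    proof -
      have "z \<in> cnj ` Z" if "z \<in> Z" for z
        using imageI[OF cnjZ[OF that], of cnj] by simp
      then have "cnj ` Z = Z" using cnjZ by blast
      moreover have "cnj ` (Z - {z, cnj z}) = cnj ` Z - cnj ` {z, cnj z}"
        by (rule image_set_diff) (simp add: inj_on_def)
      ultimately show ?thesis by (simp add: insert_commute)
    qed
    have "poly ?m (cnj z) = (\<Prod>\<xi>\<in>cnj ` (Z - {z, cnj z}). cnj z - \<xi>)"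
      unfolding im by (simp add: poly_prod)
    also have "\<dots> = cnj (poly ?m z)"
      by (subst prod.reindex[OF inj(2)]) (simp add: poly_prod)
    finally have "poly ?m z * poly ?m (cnj z) = of_real ((cmod (poly ?m z))\<^sup>2)"
      by (simp add: complex_norm_square del: of_real_power)
    moreover have "poly ?m z \<noteq> 0" using finZ by (simp add: poly_prod)
    moreover have "quad_resultant (- 2 * Re z) ((cmod z)\<^sup>2) (p div quad (- 2 * Re z) ((cmod z)\<^sup>2))
        = poly ?m z * poly ?m (cnj z)"
      unfolding quad_resultant_eq[OF quad_cnj] dv(1)[OF quad_cnj zZ] ..
    ultimately show ?thesis
      by (simp add: qc_def del: of_real_power)
  qed
  have "(\<Sum>v\<in>Q. ?S v) = (\<Sum>v\<in>T. ?S (qr v)) + (\<Sum>z\<in>P. ?S (qc z))"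
    unfolding Qeq using finT finP disjQ
    by (subst sum.union_disjoint) (simp_all add: sum.reindex[OF injr] sum.reindex[OF injc])
  also have "(\<Sum>v\<in>T. ?S (qr v)) = (\<Sum>(x, y)\<in>T. - \<tau> x * \<tau> y)"
    by (rule sum.cong) (use real_pair in \<open>auto simp: T_def\<close>)
  also have "\<dots> = real (card R div 2)"
    unfolding T_def \<tau>_def by (rule sum_pairs_sgn_differences[OF finR])
  also have "(\<Sum>z\<in>P. ?S (qc z)) = real (card P)"
    using cnj_pair by simp
  finally show "(\<Sum>(u, w)\<in>Q. sgn (Re (quad_resultant u w (p div quad u w)))) = real (d div 2)"
    by (simp add: d)
qed

section \<open>A degree formula for planar maps\<close>

text \<open>Change of variables for real integrands, reduced to integrands with values in
  \<open>\<real>\<^sup>1\<close>.\<close>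

lemma integral_image_injective:
  fixes g :: "real^2 \<Rightarrow> real^2" and K :: "real^2 \<Rightarrow> real"
  assumes A: "A \<in> sets lebesgue"
    and der: "\<And>x. x \<in> A \<Longrightarrow> (g has_derivative (*v) (J x)) (at x)"
    and inj: "inj_on g A"
    and int: "set_integrable lebesgue A (\<lambda>x. \<bar>Determinants.det (J x)\<bar> * K (g x))"
  shows "set_integrable lebesgue (g ` A) K"
    and "(LINT c:g ` A|lebesgue. K c) = (LINT x:A|lebesgue. \<bar>Determinants.det (J x)\<bar> * K (g x))"
proof -
  let ?v = "Finite_Cartesian_Product.vec :: real \<Rightarrow> real^1"
  define b where "b = integral A (\<lambda>x. \<bar>Determinants.det (J x)\<bar> * K (g x))"
  have der': "(g has_derivative (*v) (J x)) (at x within A)" if "x \<in> A" for x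
    using der[OF that] by (rule has_derivative_at_withinI)
  have "(\<lambda>x. \<bar>Determinants.det (matrix ((*v) (J x)))\<bar> *\<^sub>R ?v (K (g x))) absolutely_integrable_on A \<and>
        integral A (\<lambda>x. \<bar>Determinants.det (matrix ((*v) (J x)))\<bar> *\<^sub>R ?v (K (g x))) = ?v b
     \<longleftrightarrow> (\<lambda>c. ?v (K c)) absolutely_integrable_on g ` A \<and> integral (g ` A) (\<lambda>c. ?v (K c)) = ?v b"
    by (rule has_absolute_integral_change_of_variables[OF A der' inj])
  then have "set_integrable lebesgue (g ` A) K \<and> integral (g ` A) K = b"
    using int by (simp add: absolutely_integrable_on_1_iff integral_on_1_eq b_def)
  then show "set_integrable lebesgue (g ` A) K"
    "(LINT c:g ` A|lebesgue. K c) = (LINT x:A|lebesgue. \<bar>Determinants.det (J x)\<bar> * K (g x))"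
    using set_lebesgue_integral_eq_integral(2)[OF int]
    by (simp_all add: set_lebesgue_integral_eq_integral(2) b_def)
qed

text \<open>By the inverse function theorem every point with nonzero Jacobian has a ball on which
  the map is injective and the sign of the Jacobian constant. Countably many balls suffice, and they
  are made disjoint.\<close>

lemma locally_injective_cover:
  fixes g :: "real^2 \<Rightarrow> real^2"
  assumes der: "\<And>x. (g has_derivative (*v) (J x)) (at x)"
    and cont: "\<And>i j. continuous_on UNIV (\<lambda>x. vec_nth (vec_nth (J x) i) j)"
    and Z: "closed Z"
  obtains A \<epsilon> where "\<And>n::nat. A n \<in> sets borel" "disjoint_family A"
    "(\<Union>n. A n) = {x. Determinants.det (J x) \<noteq> 0} - Z"
    "\<And>n. inj_on g (A n)" "\<And>n x. x \<in> A n \<Longrightarrow> sgn (Determinants.det (J x)) = (\<epsilon> n :: real)"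
proof -
  define D where "D = (\<lambda>x. Determinants.det (J x))"
  define U where "U = {x. D x \<noteq> 0} - Z"
  have contD: "continuous_on UNIV D"
    unfolding D_def det_2 by (intro continuous_intros cont)
  have "open {x. D x > 0}" "open {x. D x < 0}"
    using contD by (auto intro!: open_Collect_less continuous_intros)
  then have opn: "open ({x. D x > 0} - Z)" "open ({x. D x < 0} - Z)"
    using Z by (auto intro: open_Diff)
  define good where "good = (\<lambda>B. open B \<and> B \<subseteq> U \<and> inj_on g B \<and> (\<exists>e. \<forall>x\<in>B. sgn (D x) = e))"
  have ball: "\<exists>B. x \<in> B \<and> good B" if "x \<in> U" for x
  proof -
    define S where "S = (if D x > 0 then {x. D x > 0} - Z else {x. D x < 0} - Z)"
    have S: "x \<in> S" "open S" "S \<subseteq> U" using that opn by (auto simp: S_def U_def)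
    have sg: "\<forall>y\<in>S. sgn (D y) = (if D x > 0 then 1 else - 1)"
      by (auto simp: S_def)
    have "invertible (J x)" using that by (simp add: U_def D_def invertible_det_nz)
    then obtain M where M: "M ** J x = Finite_Cartesian_Product.mat 1" unfolding invertible_def by auto
    have left: "((*v) M) \<circ> ((*v) (J x)) = id"
      using M by (simp add: fun_eq_iff matrix_vector_mul_assoc)
    have close: "\<exists>d>0. \<forall>y. dist x y < d \<longrightarrow> onorm (\<lambda>v. J y *v v - J x *v v) < e" if "e > 0" for e
    proof -
      have "\<exists>d>0. \<forall>y. dist x y < d \<longrightarrow> \<bar>vec_nth (vec_nth (J y) i) j - vec_nth (vec_nth (J x) i) j\<bar> < e / 5" for i j
        using cont[of i j] \<open>e > 0\<close> unfolding continuous_on_iff dist_real_def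
        by (metis UNIV_I dist_commute zero_less_divide_iff zero_less_numeral)
      then obtain d where d: "\<And>i j. d i j > 0"
        "\<And>i j y. dist x y < d i j \<Longrightarrow> \<bar>vec_nth (vec_nth (J y) i) j - vec_nth (vec_nth (J x) i) j\<bar> < e / 5"
        by metis
      define d0 where "d0 = Min (range (\<lambda>(i, j). d i j))"
      have d0: "d0 > 0" "d0 \<le> d i j" for i j
      proof -
        show "d0 > 0" unfolding d0_def by (subst Min_gr_iff) (auto simp: d(1))
        show "d0 \<le> d i j" unfolding d0_def by (rule Min_le) (auto intro: image_eqI[of _ _ "(i, j)"])
      qed
      show ?thesis
      proof (intro exI[of _ d0] conjI allI impI d0(1))
        fix y assume y: "dist x y < d0"
        have "(\<lambda>v. J y *v v - J x *v v) = (*v) (J y - J x)"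
          by (rule ext) (simp add: matrix_vector_mult_diff_rdistrib)
        then have "onorm (\<lambda>v. J y *v v - J x *v v) = onorm ((*v) (J y - J x))"
          by (rule arg_cong)
        also have "\<dots> \<le> real CARD(2) * real CARD(2) * (e / 5)"
        proof (rule onorm_le_matrix_component)
          fix i j
          show "\<bar>vec_nth (vec_nth (J y - J x) i) j\<bar> \<le> e / 5"
            using d(2)[OF less_le_trans[OF y d0(2)], of i j] by simp
        qed
        also have "\<dots> < e" using \<open>e > 0\<close> by simp
        finally show "onorm (\<lambda>v. J y *v v - J x *v v) < e" .
      qed
    qed
    obtain r where "r > 0" "ball x r \<subseteq> S" "inj_on g (ball x r)"
      by (rule has_derivative_locally_injective[OF S(1,2) matrix_vector_mul_bounded_linear left der close])
    then show ?thesis using S(3) sg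
      by (intro exI[of _ "ball x r"]) (force simp: good_def)
  qed
  \<comment> \<open>The empty set is added below so that the countable cover can be enumerated even
    if \<open>U\<close> is empty.\<close>
  obtain F where F: "F \<subseteq> Collect good" "countable F" "\<Union>F = \<Union>(Collect good)"
    by (rule Lindelof[of "Collect good"]) (auto simp: good_def)
  have "good {}" by (auto simp: good_def)
  define B where "B = from_nat_into (insert {} F)"
  have range_B: "range B = insert {} F"
    unfolding B_def by (rule range_from_nat_into) (use F(2) in auto)
  have goodB: "good (B n)" for n
  proof -
    have "B n \<in> insert {} F" using range_B by auto
    then show ?thesis using F(1) \<open>good {}\<close> by auto
  qed
  have UB: "(\<Union>n. B n) = U"
  proof -
    have "\<Union>(Collect good) \<subseteq> U" by (auto simp: good_def)
    moreover have "U \<subseteq> \<Union>(Collect good)" using ball by blast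
    ultimately show ?thesis using range_B F(3) by auto
  qed
  obtain \<epsilon> where \<epsilon>: "\<And>n x. x \<in> B n \<Longrightarrow> sgn (D x) = \<epsilon> n"
    using goodB unfolding good_def by metis
  have sub: "disjointed B n \<subseteq> B n" for n by (rule disjointed_subset)
  show ?thesis
  proof (rule that[of "disjointed B" \<epsilon>])
    show "disjointed B n \<in> sets borel" for n
    proof -
      have "range B \<subseteq> sets borel" using goodB by (auto simp: good_def)
      from sets.range_disjointed_sets[OF this] show ?thesis by auto
    qed
    show "disjoint_family (disjointed B)" by (rule disjoint_family_disjointed)
    show "(\<Union>n. disjointed B n) = {x. Determinants.det (J x) \<noteq> 0} - Z"
      using UB by (simp add: UN_disjointed_eq U_def D_def)
    show "inj_on g (disjointed B n)" for n
      using goodB sub by (meson good_def inj_on_subset)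
    show "sgn (Determinants.det (J x)) = \<epsilon> n" if "x \<in> disjointed B n" for n x
      using \<epsilon> sub that unfolding D_def by blast
  qed
qed

text \<open>A map whose regular values, as far as they matter, have the same signed number
  \<open>n\<close> of preimages behaves under integration like a map of degree \<open>n\<close>. On
  each piece of a disjoint cover the change of variables turns the left integral into an integral
  over the image with a sign, and summed over the pieces these signs count preimages. Critical
  values are negligible by Sard's theorem. The further negligible set \<open>Z\<close> allows
  additional degenerate points to be discarded.\<close>

theorem degree_formula_plane:
  fixes g :: "real^2 \<Rightarrow> real^2" and H :: "real^2 \<Rightarrow> real"
  assumes der: "\<And>x. (g has_derivative (*v) (J x)) (at x)"
    and cont: "\<And>i j. continuous_on UNIV (\<lambda>x. vec_nth (vec_nth (J x) i) j)"
    and Z: "closed Z" "negligible Z"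
    and intH: "integrable lborel H"
    and intf: "integrable lborel (\<lambda>x. Determinants.det (J x) * H (g x))"
    and count: "\<And>c. H c \<noteq> 0 \<Longrightarrow> c \<notin> g ` ({x. Determinants.det (J x) = 0} \<union> Z) \<Longrightarrow>
      finite {x. g x = c} \<and> (\<Sum>x | g x = c. sgn (Determinants.det (J x))) = n"
  shows "(\<integral>x. Determinants.det (J x) * H (g x) \<partial>lborel) = n * (\<integral>c. H c \<partial>lborel)"
proof -
  define D where "D x = Determinants.det (J x)" for x
  define f where "f = (\<lambda>x. D x * H (g x))"
  define U where "U = {x. D x \<noteq> 0} - Z"
  obtain A \<epsilon> where A: "\<And>k::nat. A k \<in> sets borel" "disjoint_family A" "(\<Union>k. A k) = U"
    "\<And>k. inj_on g (A k)" "\<And>k x. x \<in> A k \<Longrightarrow> sgn (D x) = (\<epsilon> k :: real)"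
    unfolding U_def D_def by (rule locally_injective_cover[OF der cont Z(1)]) blast
  have Al: "A k \<in> sets lebesgue" for k using A(1)[of k] by simp
  have fL: "integrable lebesgue f"
    using intf borel_measurable_integrable[OF intf] by (simp add: f_def D_def integrable_completion)
  have HL: "integrable lebesgue H"
    using intH borel_measurable_integrable[OF intH] by (simp add: integrable_completion)
  have fA: "set_integrable lebesgue (A k) f" for k
    unfolding set_integrable_def by (rule integrable_mult_indicator[OF Al fL])
  have diff: "g differentiable_on S" for S
    using der unfolding differentiable_on_def differentiable_def by (blast intro: has_derivative_at_withinI)
  have gA: "g ` A k \<in> sets lebesgue" for k
    by (rule differentiable_image_in_sets_lebesgue[OF Al _ diff]) simp
  have absf: "\<bar>D x\<bar> * H (g x) = \<epsilon> k * f x" if "x \<in> A k" for k x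
    unfolding A(5)[OF that, symmetric] f_def by (auto simp: sgn_if)
  have \<epsilon>: "\<epsilon> k * \<epsilon> k * y = y" if "x \<in> A k" for k x y
  proof -
    have "x \<in> U" using that A(3) by blast
    then have "D x \<noteq> 0" by (simp add: U_def)
    then show ?thesis unfolding A(5)[OF that, symmetric] by (auto simp: sgn_if)
  qed
  have int1: "set_integrable lebesgue (A k) (\<lambda>x. \<bar>D x\<bar> * H (g x))" for k
  proof -
    have "set_integrable lebesgue (A k) (\<lambda>x. \<epsilon> k * f x)"
      using fA by (rule set_integrable_mult_right)
    then show ?thesis
      unfolding set_integrable_def by (rule Bochner_Integration.integrable_cong[THEN iffD1, rotated -1])
        (auto simp: absf indicator_def)
  qed
  have int2: "set_integrable lebesgue (A k) (\<lambda>x. \<bar>D x\<bar> * \<bar>H (g x)\<bar>)" for k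
    using set_integrable_abs[OF int1[of k]] by (simp add: abs_mult)
  note piece = integral_image_injective[OF Al der A(4), folded D_def]
  define G where "G = (\<lambda>k c. indicator (g ` A k) c * (\<epsilon> k * H c))"
  define F where "F = (\<lambda>k x. indicator (A k) x * f x)"
  have intF: "integrable lebesgue (F k)" for k
    using fA[of k] by (simp add: F_def set_integrable_def)
  have intG: "integrable lebesgue (G k)" for k
  proof -
    have "set_integrable lebesgue (g ` A k) (\<lambda>c. \<epsilon> k * H c)"
      by (rule set_integrable_mult_right) (rule piece(1)[OF int1])
    then show ?thesis by (simp add: G_def set_integrable_def)
  qed
  have eq: "(\<integral>c. G k c \<partial>lebesgue) = (\<integral>x. F k x \<partial>lebesgue)" for k
  proof -
    have "(\<integral>c. G k c \<partial>lebesgue) = \<epsilon> k * (LINT c:g ` A k|lebesgue. H c)"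
      by (simp add: G_def set_lebesgue_integral_def mult.left_commute)
    also have "(LINT c:g ` A k|lebesgue. H c) = (LINT x:A k|lebesgue. \<bar>D x\<bar> * H (g x))"
      by (rule piece(2)[OF int1])
    also have "\<epsilon> k * \<dots> = (LINT x:A k|lebesgue. \<epsilon> k * (\<bar>D x\<bar> * H (g x)))"
      by simp
    also have "\<dots> = (LINT x:A k|lebesgue. f x)"
      by (rule set_lebesgue_integral_cong) (use Al \<epsilon> in \<open>auto simp: absf mult.assoc[symmetric]\<close>)
    finally show ?thesis by (simp add: F_def set_lebesgue_integral_def)
  qed
  have normeq: "(\<integral>c. norm (G k c) \<partial>lebesgue) \<le> (\<integral>x. norm (F k x) \<partial>lebesgue)" for k
  proof -
    have "(\<integral>c. norm (G k c) \<partial>lebesgue) = \<bar>\<epsilon> k\<bar> * (LINT c:g ` A k|lebesgue. \<bar>H c\<bar>)"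
      by (simp add: G_def set_lebesgue_integral_def mult.left_commute abs_mult)
    also have "(LINT c:g ` A k|lebesgue. \<bar>H c\<bar>) = (LINT x:A k|lebesgue. \<bar>D x\<bar> * \<bar>H (g x)\<bar>)"
      by (rule piece(2)[OF int2])
    also have "\<dots> = (\<integral>x. norm (F k x) \<partial>lebesgue)"
      by (simp add: F_def f_def set_lebesgue_integral_def abs_mult)
    also have "\<bar>\<epsilon> k\<bar> * \<dots> \<le> \<dots>"
    proof (cases "A k = {}")
      case False
      then obtain x where "x \<in> A k" by auto
      from A(5)[OF this] have "\<bar>\<epsilon> k\<bar> \<le> 1" by (auto simp: sgn_if split: if_splits)
      then show ?thesis by (intro mult_left_le_one_le) auto
    qed (simp add: F_def)
    finally show ?thesis .
  qed
  have disj: "F k x = 0 \<or> F l x = 0" if "k \<noteq> l" for k l x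
    using A(2) that by (auto simp: F_def disjoint_family_on_def indicator_def)
  have sumF: "(\<lambda>k. F k x) sums (indicator U x * f x)" "(\<Sum>k<m. norm (F k x)) \<le> norm (f x)" for x m
  proof -
    show "(\<lambda>k. F k x) sums (indicator U x * f x)"
    proof (cases "x \<in> U")
      case True
      then obtain k where k: "x \<in> A k" using A(3) by blast
      have "F l x = (if l = k then f x else 0)" for l
        using k A(2) by (auto simp: F_def disjoint_family_on_def indicator_def)
      then show ?thesis using True sums_single[of k "\<lambda>_. f x"] by simp
    next
      case False
      then have "F l x = 0" for l using A(3) by (auto simp: F_def)
      then show ?thesis using False by simp
    qed
    show "(\<Sum>k<m. norm (F k x)) \<le> norm (f x)"
    proof (cases "\<exists>k<m. x \<in> A k")
      case True
      then obtain k where k: "k < m" "x \<in> A k" by blast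
      have "norm (F l x) = (if l = k then norm (f x) else 0)" for l
        using k A(2) by (auto simp: F_def disjoint_family_on_def indicator_def)
      then show ?thesis using k by simp
    next
      case False
      then have "(\<Sum>k<m. norm (F k x)) = 0" by (intro sum.neutral) (auto simp: F_def)
      then show ?thesis by simp
    qed
  qed
  have summF: "summable (\<lambda>k. \<integral>x. norm (F k x) \<partial>lebesgue)"
  proof (rule bounded_imp_summable)
    fix m
    have "(\<Sum>k\<le>m. \<integral>x. norm (F k x) \<partial>lebesgue) = (\<integral>x. (\<Sum>k<Suc m. norm (F k x)) \<partial>lebesgue)"
      using intF by (subst Bochner_Integration.integral_sum) (auto simp: lessThan_Suc_atMost)
    also have "\<dots> \<le> (\<integral>x. norm (f x) \<partial>lebesgue)"
      by (rule integral_mono) (use intF fL sumF(2) in \<open>auto simp del: sum.lessThan_Suc\<close>)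
    finally show "(\<Sum>k\<le>m. \<integral>x. norm (F k x) \<partial>lebesgue) \<le> (\<integral>x. norm (f x) \<partial>lebesgue)" .
  qed auto
  have summG: "summable (\<lambda>k. \<integral>c. norm (G k c) \<partial>lebesgue)"
    by (rule summable_comparison_test_ev[OF _ summF]) (use normeq in auto)

  have null: "negligible (g ` ({x. D x = 0} \<union> Z))"
  proof -
    have "negligible (g ` {x. D x = 0})"
    proof (rule baby_Sard)
      show "(g has_derivative (*v) (J x)) (at x within {x. D x = 0})" for x
        using der by (rule has_derivative_at_withinI)
      show "rank (matrix ((*v) (J x))) < CARD(2)" if "x \<in> {x. D x = 0}" for x
        using that by (simp add: D_def det_eq_0_rank)
    qed simp
    moreover have "negligible (g ` Z)"
      by (rule negligible_differentiable_image_negligible[OF _ Z(2) diff]) simp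
    ultimately show ?thesis by (simp add: image_Un)
  qed
  \<comment> \<open>Over a regular value \<open>c\<close> only the pieces that contain a preimage of
    \<open>c\<close> contribute, each with its sign.\<close>
  have good: "(\<lambda>k. G k c) sums (n * H c) \<and> summable (\<lambda>k. norm (G k c))"
    if c: "c \<notin> g ` ({x. D x = 0} \<union> Z)" for c
  proof (cases "H c = 0")
    case False
    define X where "X = {x. g x = c}"
    have X: "finite X" "(\<Sum>x\<in>X. sgn (D x)) = n"
      using count[OF False] c by (simp_all add: X_def D_def)
    have XU: "X \<subseteq> U" using c by (auto simp: X_def U_def)
    then have "\<forall>x\<in>X. \<exists>k. x \<in> A k" using A(3) by blast
    then obtain \<kappa> where \<kappa>: "\<And>x. x \<in> X \<Longrightarrow> x \<in> A (\<kappa> x)" by metis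
    have inj\<kappa>: "inj_on \<kappa> X"
      using \<kappa> A(4) by (intro inj_onI) (metis (mono_tags) X_def inj_on_def mem_Collect_eq)
    have off: "G k c = 0" if "k \<notin> \<kappa> ` X" for k
    proof -
      have "c \<notin> g ` A k"
      proof
        assume "c \<in> g ` A k"
        then obtain x where x: "x \<in> A k" "x \<in> X" by (auto simp: X_def)
        then have "\<kappa> x = k" using \<kappa>[OF x(2)] A(2) by (auto simp: disjoint_family_on_def)
        then show False using that x by blast
      qed
      then show ?thesis by (simp add: G_def)
    qed
    have "(\<lambda>k. G k c) sums (\<Sum>k\<in>\<kappa> ` X. G k c)"
      by (rule sums_finite) (use X(1) off in auto)
    also have "(\<Sum>k\<in>\<kappa> ` X. G k c) = (\<Sum>x\<in>X. sgn (D x) * H c)"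
      unfolding sum.reindex[OF inj\<kappa>]
    proof (rule sum.cong)
      fix x assume x: "x \<in> X"
      then have "c \<in> g ` A (\<kappa> x)" using \<kappa>[OF x] by (auto simp: X_def)
      then show "((\<lambda>k. G k c) \<circ> \<kappa>) x = sgn (D x) * H c"
        using A(5)[OF \<kappa>[OF x]] by (simp add: G_def)
    qed simp
    also have "\<dots> = n * H c" using X(2) by (simp add: sum_distrib_right[symmetric])
    finally have "(\<lambda>k. G k c) sums (n * H c)" .
    moreover have "summable (\<lambda>k. norm (G k c))"
      by (rule summable_finite[of "\<kappa> ` X"]) (use X(1) off in auto)
    ultimately show ?thesis by blast
  qed (simp add: G_def)
  have aeG: "AE c in lebesgue. c \<notin> g ` ({x. D x = 0} \<union> Z)"
    using null by (intro AE_not_in) (simp add: negligible_iff_null_sets)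
  have aeZ: "AE x in lebesgue. x \<notin> Z"
    using Z(2) by (intro AE_not_in) (simp add: negligible_iff_null_sets)

  have "(\<integral>x. f x \<partial>lebesgue) = (\<integral>x. (\<Sum>k. F k x) \<partial>lebesgue)"
  proof (rule integral_cong_AE)
    show "(\<lambda>x. \<Sum>k. F k x) \<in> borel_measurable lebesgue"
      using intF by (intro borel_measurable_suminf) auto
    show "AE x in lebesgue. f x = (\<Sum>k. F k x)"
      using aeZ
    proof eventually_elim
      case (elim x)
      have "(\<Sum>k. F k x) = indicator U x * f x" by (rule sums_unique[symmetric]) (rule sumF(1))
      also have "\<dots> = f x" using elim by (auto simp: U_def f_def)
      finally show ?case by simp
    qed
  qed (use fL in auto)
  also have "\<dots> = (\<Sum>k. \<integral>x. F k x \<partial>lebesgue)"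
  proof (rule integral_suminf[OF intF _ summF])
    show "AE x in lebesgue. summable (\<lambda>k. norm (F k x))"
    proof (intro AE_I2)
      fix x
      show "summable (\<lambda>k. norm (F k x))"
      proof (rule bounded_imp_summable)
        show "(\<Sum>k\<le>m. norm (F k x)) \<le> norm (f x)" for m
          using sumF(2)[of x "Suc m"] by (simp only: lessThan_Suc_atMost)
      qed simp
    qed
  qed
  also have "\<dots> = (\<Sum>k. \<integral>c. G k c \<partial>lebesgue)" by (simp add: eq)
  also have "\<dots> = (\<integral>c. (\<Sum>k. G k c) \<partial>lebesgue)"
    by (rule integral_suminf[OF intG _ summG, symmetric])
       (use aeG good in \<open>auto elim!: eventually_mono\<close>)
  also have "\<dots> = (\<integral>c. n * H c \<partial>lebesgue)"
  proof (rule integral_cong_AE)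
    show "(\<lambda>x. \<Sum>k. G k x) \<in> borel_measurable lebesgue"
      using intG by (intro borel_measurable_suminf) auto
    show "AE c in lebesgue. (\<Sum>k. G k c) = n * H c"
      using aeG
    proof eventually_elim
      case (elim c)
      show ?case by (rule sums_unique[symmetric]) (use good[OF elim] in blast)
    qed
  qed (use HL in auto)
  finally have "(\<integral>x. f x \<partial>lebesgue) = n * (\<integral>c. H c \<partial>lebesgue)" by simp
  then show ?thesis
    using borel_measurable_integrable[OF intf] borel_measurable_integrable[OF intH]
    by (simp add: integral_completion f_def D_def)
qed

section \<open>The last two coefficients as functions of a quadratic factor\<close>

lemma vec2_eq_iff: "(x :: real^2) = y \<longleftrightarrow> vec_nth x 1 = vec_nth y 1 \<and> vec_nth x 2 = vec_nth y 2"
  by (simp add: Finite_Cartesian_Product.vec_eq_iff forall_2)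

abbreviation plane :: "(real \<times> real) measure" where
  "plane \<equiv> lborel \<Otimes>\<^sub>M lborel"

lemma borel_measurable_vector2:
  "(\<lambda>(u, w). vector [u, w] :: real^2) \<in> plane \<rightarrow>\<^sub>M borel"
proof -
  have "(\<lambda>(u, w). vector [u, w] :: real^2) = (\<lambda>z. fst z *\<^sub>R axis 1 1 + snd z *\<^sub>R axis 2 1)"
    by (auto simp: fun_eq_iff vec2_eq_iff axis_def)
  then show ?thesis by simp
qed

lemma has_derivative_vec2:
  fixes f :: "real^2 \<Rightarrow> real^2"
  assumes "((\<lambda>x. vec_nth (f x) 1) has_derivative (\<lambda>h. vec_nth (f' h) 1)) (at x)"
    and "((\<lambda>x. vec_nth (f x) 2) has_derivative (\<lambda>h. vec_nth (f' h) 2)) (at x)"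
  shows "(f has_derivative f') (at x)"
  unfolding has_derivative_componentwise_within[of f]
proof
  fix i :: "real^2" assume "i \<in> Basis"
  then obtain k where i: "i = axis k 1" by (auto simp: Basis_vec_def)
  show "((\<lambda>x. f x \<bullet> i) has_derivative (\<lambda>x. f' x \<bullet> i)) (at x)"
    using exhaust_2[of k] assms by (auto simp: i inner_axis)
qed

text \<open>The change of variables lives on \<open>\<real>\<^sup>2\<close> as a vector space,
  Fubini's theorem on the product of two lines.\<close>

lemma distr_lborel_plane:
  "distr plane borel (\<lambda>(u, w). vector [u, w] :: real^2) = (lborel :: (real^2) measure)"
proof (rule lborel_eqI[symmetric])
  note meas = borel_measurable_vector2
  show "emeasure (distr plane borel (\<lambda>(u, w). vector [u, w])) (box l r)
      = (\<Prod>b\<in>Basis. (r - l) \<bullet> b)"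
    if le: "\<And>b. b \<in> Basis \<Longrightarrow> l \<bullet> b \<le> r \<bullet> b" for l r :: "real^2"
  proof -
    have lr: "vec_nth l i \<le> vec_nth r i" for i
      using le[of "axis i 1"] by (simp add: inner_axis)
    have "(\<lambda>(u, w). vector [u, w]) -` box l r \<inter> space plane
        = box (vec_nth l 1) (vec_nth r 1) \<times> box (vec_nth l 2) (vec_nth r 2)"
      by (auto simp: mem_box_cart forall_2 space_pair_measure)
    then have "emeasure (distr plane borel (\<lambda>(u, w). vector [u, w])) (box l r)
        = emeasure plane (box (vec_nth l 1) (vec_nth r 1) \<times> box (vec_nth l 2) (vec_nth r 2))"
      by (subst emeasure_distr[OF meas]) auto
    also have "\<dots> = ennreal ((vec_nth r 1 - vec_nth l 1) * (vec_nth r 2 - vec_nth l 2))"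
      using lr by (subst lborel.emeasure_pair_measure_Times) (auto simp: ennreal_mult)
    also have "(vec_nth r 1 - vec_nth l 1) * (vec_nth r 2 - vec_nth l 2) = (\<Prod>b\<in>Basis. (r - l) \<bullet> b)"
    proof -
      have "Basis = {axis 1 1, axis 2 (1::real) :: real^2}"
        by (auto simp: Basis_vec_def exhaust_2) (metis exhaust_2)
      then have B: "(Basis :: (real^2) set) = {axis 1 1, axis 2 1}" .
      have ne: "axis 1 1 \<noteq> (axis 2 1 :: real^2)" by (simp add: axis_eq_axis)
      have "(\<Prod>b\<in>Basis. (r - l) \<bullet> b) = ((r - l) \<bullet> axis 1 1) * ((r - l) \<bullet> axis 2 1)"
        unfolding B using ne by simp
      then show ?thesis by (simp add: inner_axis)
    qed
    finally show ?thesis .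
  qed
qed simp

lemma quo_cong: "(\<And>i. 1 \<le> i \<Longrightarrow> i < k \<Longrightarrow> a i = a' i) \<Longrightarrow> quo u w a k = quo u w a' k"
  by (induction u w a k rule: quo.induct) auto

text \<open>Differentiating the quotient by the divisor divides once more, which is why the
  derivatives are given by the recursion applied to the quotient.\<close>

lemma quo_has_derivative:
  fixes x :: "real^2" and a :: "nat \<Rightarrow> real"
  defines "b \<equiv> \<lambda>k. quo (vec_nth x 1) (vec_nth x 2) a (Suc k)"
  defines "r \<equiv> quo (vec_nth x 1) (vec_nth x 2) b"
  shows "((\<lambda>x. quo (vec_nth x 1) (vec_nth x 2) a k) has_derivative
     (\<lambda>h. - r (k - 1) * vec_nth h 1 - r (k - 2) * vec_nth h 2)) (at x)"
proof (induction k rule: induct_nat_012)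
  case (ge2 n)
  have bn: "b n = r (Suc n) + vec_nth x 1 * r n + vec_nth x 2 * r (n - 1)"
    unfolding r_def by (cases n) (auto simp: b_def)
  have qn: "quo (vec_nth x 1) (vec_nth x 2) a n = r n + vec_nth x 1 * r (n - 1) + vec_nth x 2 * r (n - 2)"
  proof -
    consider "n = 0" | "n = 1" | m where "n = Suc (Suc m)" by (metis One_nat_def nat.exhaust)
    then show ?thesis by cases (simp_all add: r_def b_def)
  qed
  have "((\<lambda>x. quo (vec_nth x 1) (vec_nth x 2) a (Suc (Suc n))) has_derivative
     (\<lambda>h. 0 - (vec_nth x 1 * (- r (Suc n - 1) * vec_nth h 1 - r (Suc n - 2) * vec_nth h 2) + vec_nth h 1 * b n)
        - (vec_nth x 2 * (- r (n - 1) * vec_nth h 1 - r (n - 2) * vec_nth h 2)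
            + vec_nth h 2 * quo (vec_nth x 1) (vec_nth x 2) a n))) (at x)"
    unfolding quo.simps b_def
    by (intro has_derivative_diff has_derivative_const has_derivative_mult
        ge2[unfolded b_def] bounded_linear.has_derivative[OF bounded_linear_vec_nth] has_derivative_ident)
  moreover have "0 - (vec_nth x 1 * (- r (Suc n - 1) * vec_nth h 1 - r (Suc n - 2) * vec_nth h 2) + vec_nth h 1 * b n)
        - (vec_nth x 2 * (- r (n - 1) * vec_nth h 1 - r (n - 2) * vec_nth h 2)
            + vec_nth h 2 * quo (vec_nth x 1) (vec_nth x 2) a n)
      = - r (Suc (Suc n) - 1) * vec_nth h 1 - r (Suc (Suc n) - 2) * vec_nth h 2" for h :: "real^2"
    unfolding bn qn by (simp add: algebra_simps numeral_2_eq_2)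
  ultimately show ?case by simp
qed (auto simp: r_def b_def)

text \<open>The values of the last two coefficients for which the division leaves no
  remainder.\<close>

definition last_coeffs :: "nat \<Rightarrow> (nat \<Rightarrow> real) \<Rightarrow> real \<times> real \<Rightarrow> real \<times> real" where
  "last_coeffs N a = (\<lambda>(u, w). (u * quo u w a (Suc N) + w * quo u w a N, w * quo u w a (Suc N)))"

definition set_last :: "nat \<Rightarrow> (nat \<Rightarrow> real) \<Rightarrow> real \<times> real \<Rightarrow> nat \<Rightarrow> real" where
  "set_last N a = (\<lambda>(c1, c2). a(Suc N := c1, Suc (Suc N) := c2))"

definition quotient_poly :: "nat \<Rightarrow> (nat \<Rightarrow> real) \<Rightarrow> real \<Rightarrow> real \<Rightarrow> complex poly" where
  "quotient_poly N a u w = monic_poly N (\<lambda>k. quo u w a (Suc k))"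

lemma quo_set_last: "k \<le> Suc N \<Longrightarrow> quo u w (set_last N a c) k = quo u w a k"
  by (rule quo_cong) (auto simp: set_last_def split: prod.splits)

lemma monic_poly_set_last:
  "monic_poly (Suc (Suc N)) (set_last N a c) = quad u w * quotient_poly N a u w
     + [:of_real (snd c - snd (last_coeffs N a (u, w))), of_real (fst c - fst (last_coeffs N a (u, w))):]"
proof -
  have "monic_poly N (\<lambda>k. quo u w (set_last N a c) (Suc k)) = quotient_poly N a u w"
    unfolding quotient_poly_def by (rule monic_poly_cong) (simp add: quo_set_last)
  then show ?thesis
    using monic_poly_divide_quad[of N "set_last N a c" u w]
    by (simp add: quo_set_last last_coeffs_def) (simp add: set_last_def case_prod_unfold algebra_simps)
qed

text \<open>The preimages of a point under \<open>last_coeffs\<close> are the quadratic factors of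
  one polynomial.\<close>

lemma quad_dvd_set_last_iff:
  "quad u w dvd monic_poly (Suc (Suc N)) (set_last N a c) \<longleftrightarrow> last_coeffs N a (u, w) = c"
proof -
  let ?rem = "[:complex_of_real (snd c - snd (last_coeffs N a (u, w))), of_real (fst c - fst (last_coeffs N a (u, w))):]"
  have "quad u w dvd monic_poly (Suc (Suc N)) (set_last N a c) \<longleftrightarrow> quad u w dvd ?rem"
    unfolding monic_poly_set_last[of N a c u w] by (rule dvd_add_right_iff) simp
  also have "\<dots> \<longleftrightarrow> ?rem = 0"
  proof
    assume dvd: "quad u w dvd ?rem"
    show "?rem = 0"
    proof (rule ccontr)
      assume "?rem \<noteq> 0"
      then have "degree (quad u w) \<le> degree ?rem" using dvd by (rule dvd_imp_degree_le[rotated])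
      moreover have "degree (quad u w) = 2" by (simp add: quad_def)
      moreover have "degree ?rem \<le> 1" by simp
      ultimately show False by simp
    qed
  qed simp
  also have "\<dots> \<longleftrightarrow> last_coeffs N a (u, w) = c"
    by (auto simp: prod_eq_iff simp flip: of_real_diff)
  finally show ?thesis .
qed

lemma set_last_div_quad:
  assumes "last_coeffs N a (u, w) = c"
  shows "monic_poly (Suc (Suc N)) (set_last N a c) div quad u w = quotient_poly N a u w"
proof -
  have "monic_poly (Suc (Suc N)) (set_last N a c) = quad u w * quotient_poly N a u w"
    unfolding monic_poly_set_last[of N a c u w] using assms by simp
  then show ?thesis by simp
qed

text \<open>The resultant of the quadratic factor and the quotient. It is real, so taking the real
  part only changes the type.\<close>

definition jacobian_last :: "nat \<Rightarrow> (nat \<Rightarrow> real) \<Rightarrow> real \<times> real \<Rightarrow> real" where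
  "jacobian_last N a = (\<lambda>(u, w). Re (quad_resultant u w (quotient_poly N a u w)))"

lemma of_real_jacobian_last:
  "of_real (jacobian_last N a (u, w)) = quad_resultant u w (quotient_poly N a u w)"
  by (simp add: jacobian_last_def quotient_poly_def quad_resultant_monic_poly)

lemma continuous_quo:
  fixes a :: "real^2 \<Rightarrow> nat \<Rightarrow> real"
  assumes "\<And>k. continuous_on UNIV (\<lambda>x. a x k)"
  shows "continuous_on UNIV (\<lambda>x. quo (vec_nth x 1) (vec_nth x 2) (a x) k)"
  by (induction k rule: induct_nat_012) (auto intro!: continuous_intros assms)

text \<open>The parabola is a smooth image of a line.\<close>

lemma negligible_parabola: "negligible {x::real^2. (vec_nth x 1)\<^sup>2 = 4 * vec_nth x 2}"
proof -
  let ?f = "\<lambda>x::real^2. vector [vec_nth x 1, (vec_nth x 1)\<^sup>2 / 4] :: real^2"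
  have "negligible (?f ` {x. vec_nth x 2 = 0})"
  proof (rule negligible_differentiable_image_negligible)
    show "negligible {x::real^2. vec_nth x 2 = 0}" by (rule negligible_standard_hyperplane_cart)
    have "((\<lambda>x. ?f x) has_derivative (\<lambda>h. vector [vec_nth h 1, vec_nth x 1 * vec_nth h 1 / 2])) (at x)" for x
      by (rule has_derivative_vec2)
         (auto intro!: derivative_eq_intros bounded_linear.has_derivative[OF bounded_linear_vec_nth])
    then show "?f differentiable_on {x. vec_nth x 2 = 0}"
      unfolding differentiable_on_def differentiable_def by (blast intro: has_derivative_at_withinI)
  qed simp
  moreover have "{x::real^2. (vec_nth x 1)\<^sup>2 = 4 * vec_nth x 2} \<subseteq> ?f ` {x. vec_nth x 2 = 0}"
  proof
    fix x :: "real^2" assume "x \<in> {x. (vec_nth x 1)\<^sup>2 = 4 * vec_nth x 2}"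
    then have "x = ?f (vector [vec_nth x 1, 0])" by (simp add: vec2_eq_iff)
    then show "x \<in> ?f ` {x. vec_nth x 2 = 0}" by (rule image_eqI) simp
  qed
  ultimately show ?thesis by (rule negligible_subset)
qed

text \<open>The degree formula applied to \<open>last_coeffs\<close>, whose degree is \<open>(N + 2)
  div 2\<close>. The parabola of quadratic polynomials with a double root is discarded as well:
  otherwise a polynomial with a double real root could occur as a regular value, and the signed
  count would not apply to it.\<close>

lemma degree_formula_last_real:
  fixes H :: "real \<times> real \<Rightarrow> real"
  assumes H: "integrable plane H"
    and HJ: "integrable plane (\<lambda>v. jacobian_last N a v * H (last_coeffs N a v))"
  shows "(\<integral>v. jacobian_last N a v * H (last_coeffs N a v) \<partial>plane)
     = real (Suc (Suc N) div 2) * (\<integral>c. H c \<partial>plane)"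
proof -
  define V where "V = (\<lambda>(u, w). vector [u, w] :: real^2)"
  define P where "P = (\<lambda>x::real^2. (vec_nth x 1, vec_nth x 2))"
  have PV [simp]: "P (V v) = v" for v by (auto simp: P_def V_def split: prod.splits)
  have VP [simp]: "V (P x) = x" for x by (simp add: P_def V_def vec2_eq_iff)
  have measP [measurable]: "P \<in> borel \<rightarrow>\<^sub>M plane"
    unfolding P_def by (intro measurable_Pair) (auto intro!: borel_measurable_continuous_onI continuous_intros)
  have measV [measurable]: "V \<in> plane \<rightarrow>\<^sub>M borel" unfolding V_def by (rule borel_measurable_vector2)
  have lb: "distr plane borel V = lborel" unfolding V_def by (rule distr_lborel_plane)
  have int_P: "integrable lborel (\<lambda>x. F (P x))" "(\<integral>x. F (P x) \<partial>lborel) = (\<integral>v. F v \<partial>plane)"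
    if F: "integrable plane F" for F :: "real \<times> real \<Rightarrow> real"
  proof -
    have m: "(\<lambda>x. F (P x)) \<in> borel_measurable borel"
      using borel_measurable_integrable[OF F] by measurable
    show "integrable lborel (\<lambda>x. F (P x))"
      unfolding lb[symmetric] by (subst integrable_distr_eq[OF measV m]) (use F in simp)
    show "(\<integral>x. F (P x) \<partial>lborel) = (\<integral>v. F v \<partial>plane)"
      unfolding lb[symmetric] by (subst integral_distr[OF measV m]) simp
  qed
  define b where "b = (\<lambda>x::real^2. \<lambda>k. quo (vec_nth x 1) (vec_nth x 2) a (Suc k))"
  define r where "r = (\<lambda>x::real^2. quo (vec_nth x 1) (vec_nth x 2) (b x))"
  define g where "g = (\<lambda>x. V (last_coeffs N a (P x)))"
  define J :: "real^2 \<Rightarrow> real^2^2" where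
    "J = (\<lambda>x. vector [vector [r x (Suc N), r x N],
                       vector [- vec_nth x 2 * r x N, r x (Suc N) + vec_nth x 1 * r x N]])"
  define Z where "Z = {x::real^2. (vec_nth x 1)\<^sup>2 = 4 * vec_nth x 2}"
  have detJ: "Determinants.det (J x) = jacobian_last N a (P x)" for x
    unfolding jacobian_last_def P_def quotient_poly_def
    by (simp add: quad_resultant_monic_poly det_2 J_def r_def b_def power2_eq_square algebra_simps)
  have cont_r: "continuous_on UNIV (\<lambda>x. r x k)" for k
    unfolding r_def by (rule continuous_quo) (auto simp: b_def intro!: continuous_quo)
  have der: "(g has_derivative (*v) (J x)) (at x)" for x
  proof -
    have q: "((\<lambda>x. quo (vec_nth x 1) (vec_nth x 2) a k) has_derivative
       (\<lambda>h. - r x (k - 1) * vec_nth h 1 - r x (k - 2) * vec_nth h 2)) (at x)" for k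
      unfolding r_def b_def by (rule quo_has_derivative)
    have proj: "((\<lambda>x. vec_nth x i) has_derivative (\<lambda>h. vec_nth h i)) (at x)" for i :: 2
      by (rule bounded_linear.has_derivative[OF bounded_linear_vec_nth has_derivative_ident])
    have rr: "r x (Suc N) = b x N - vec_nth x 1 * r x N - vec_nth x 2 * r x (N - 1)"
    proof (cases N)
      case (Suc M)
      then show ?thesis unfolding r_def by simp
    qed (simp add: r_def b_def)
    have rN: "r x N = quo (vec_nth x 1) (vec_nth x 2) a N - vec_nth x 1 * r x (N - 1) - vec_nth x 2 * r x (N - 2)"
    proof -
      consider "N = 0" | "N = 1" | M where "N = Suc (Suc M)" by (metis One_nat_def nat.exhaust)
      then show ?thesis by cases (simp_all add: r_def b_def)
    qed
    have 1: "((\<lambda>x. vec_nth (g x) 1) has_derivative (\<lambda>h. vec_nth (J x *v h) 1)) (at x)"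
    proof -
      have "((\<lambda>x. vec_nth x 1 * quo (vec_nth x 1) (vec_nth x 2) a (Suc N)
               + vec_nth x 2 * quo (vec_nth x 1) (vec_nth x 2) a N) has_derivative
        (\<lambda>h. (vec_nth x 1 * (- r x (Suc N - 1) * vec_nth h 1 - r x (Suc N - 2) * vec_nth h 2)
               + vec_nth h 1 * quo (vec_nth x 1) (vec_nth x 2) a (Suc N))
           + (vec_nth x 2 * (- r x (N - 1) * vec_nth h 1 - r x (N - 2) * vec_nth h 2)
               + vec_nth h 2 * quo (vec_nth x 1) (vec_nth x 2) a N))) (at x)"
        by (intro has_derivative_add has_derivative_mult proj q)
      moreover have "Suc N - 2 = N - 1" by simp
      ultimately show ?thesis
        by (rule_tac has_derivative_eq_rhs)
           (simp_all add: g_def V_def P_def last_coeffs_def J_def matrix_vector_mult_def sum_2 rr rN b_def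
              algebra_simps)
    qed
    have 2: "((\<lambda>x. vec_nth (g x) 2) has_derivative (\<lambda>h. vec_nth (J x *v h) 2)) (at x)"
    proof -
      have "((\<lambda>x. vec_nth x 2 * quo (vec_nth x 1) (vec_nth x 2) a (Suc N)) has_derivative
        (\<lambda>h. vec_nth x 2 * (- r x (Suc N - 1) * vec_nth h 1 - r x (Suc N - 2) * vec_nth h 2)
               + vec_nth h 2 * quo (vec_nth x 1) (vec_nth x 2) a (Suc N))) (at x)"
        by (intro has_derivative_mult proj q)
      moreover have "Suc N - 2 = N - 1" by simp
      ultimately show ?thesis
        by (rule_tac has_derivative_eq_rhs)
           (simp_all add: g_def V_def P_def last_coeffs_def J_def matrix_vector_mult_def sum_2 rr b_def
              algebra_simps)
    qed
    show ?thesis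
      using 1 2 by (rule has_derivative_vec2)
  qed
  have "(\<integral>x. Determinants.det (J x) * (H \<circ> P) (g x) \<partial>lborel)
      = real (Suc (Suc N) div 2) * (\<integral>c. (H \<circ> P) c \<partial>lborel)"
  proof (rule degree_formula_plane[OF der])
    show "continuous_on UNIV (\<lambda>x. vec_nth (vec_nth (J x) i) j)" for i j
    proof -
      have "continuous_on UNIV (\<lambda>x. r x (Suc N))" "continuous_on UNIV (\<lambda>x. r x N)"
        "continuous_on UNIV (\<lambda>x. - vec_nth x 2 * r x N)"
        "continuous_on UNIV (\<lambda>x. r x (Suc N) + vec_nth x 1 * r x N)"
        by (intro continuous_intros cont_r)+
      then show ?thesis using exhaust_2[of i] exhaust_2[of j] unfolding J_def by (elim disjE) simp_all
    qed
    show "closed Z" unfolding Z_def by (intro closed_Collect_eq continuous_intros)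
    show "negligible Z" unfolding Z_def by (rule negligible_parabola)
    show "integrable lborel (H \<circ> P)" using int_P(1)[OF H] by (simp add: comp_def)
    show "integrable lborel (\<lambda>x. Determinants.det (J x) * (H \<circ> P) (g x))"
      using int_P(1)[OF HJ] by (simp add: detJ g_def)
    show "finite {x. g x = c} \<and> (\<Sum>x | g x = c. sgn (Determinants.det (J x))) = real (Suc (Suc N) div 2)"
      if c: "c \<notin> g ` ({x. Determinants.det (J x) = 0} \<union> Z)" for c
    proof -
      define p where "p = monic_poly (Suc (Suc N)) (set_last N a (P c))"
      define Q where "Q = {(u, w). quad u w dvd p}"
      have Qiff: "P x \<in> Q \<longleftrightarrow> g x = c" for x
      proof -
        have "P x \<in> Q \<longleftrightarrow> last_coeffs N a (P x) = P c"
          unfolding Q_def p_def by (simp add: case_prod_unfold quad_dvd_set_last_iff)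
        also have "\<dots> \<longleftrightarrow> g x = c" unfolding g_def by (metis PV VP)
        finally show ?thesis .
      qed
      have res: "quad_resultant u w (p div quad u w) = of_real (Determinants.det (J (V (u, w))))"
        "u\<^sup>2 \<noteq> 4 * w" "quad_resultant u w (p div quad u w) \<noteq> 0" if "(u, w) \<in> Q" for u w
      proof -
        have gx: "g (V (u, w)) = c" using that Qiff[of "V (u, w)"] by simp
        then have "last_coeffs N a (u, w) = P c" unfolding g_def by (metis PV)
        then have "p div quad u w = quotient_poly N a u w" unfolding p_def by (rule set_last_div_quad)
        then show e: "quad_resultant u w (p div quad u w) = of_real (Determinants.det (J (V (u, w))))"
          by (simp add: detJ of_real_jacobian_last)
        have "V (u, w) \<notin> {x. Determinants.det (J x) = 0} \<union> Z" using c gx by auto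
        then show "u\<^sup>2 \<noteq> 4 * w" "quad_resultant u w (p div quad u w) \<noteq> 0"
          unfolding e by (auto simp: Z_def V_def)
      qed
      have "rsquarefree p"
        unfolding p_def by (rule rsquarefree_monic_poly, fold p_def) (use res in \<open>auto simp: Q_def\<close>)
      note cnt = signed_count_quad_factors[OF this[unfolded p_def], folded p_def, folded Q_def]
      have X: "{x. g x = c} = V ` Q" using Qiff by (force intro: image_eqI[of _ V "P _"])
      have injV: "inj_on V Q" by (metis PV inj_on_inverseI)
      have "(\<Sum>x\<in>V ` Q. sgn (Determinants.det (J x))) = (\<Sum>v\<in>Q. sgn (Determinants.det (J (V v))))"
        by (simp add: sum.reindex[OF injV])
      also have "\<dots> = (\<Sum>(u, w)\<in>Q. sgn (Re (quad_resultant u w (p div quad u w))))"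
        by (rule sum.cong) (use res(1) in auto)
      also have "\<dots> = real (Suc (Suc N) div 2)" by (rule cnt(2))
      finally show ?thesis unfolding X using cnt(1) by simp
    qed
  qed
  then show ?thesis
    using int_P(2)[OF H] int_P(2)[OF HJ] by (simp add: detJ g_def)
qed

section \<open>The unimodular substitution\<close>

abbreviation coeff_space :: "nat \<Rightarrow> (nat \<Rightarrow> real) measure" where
  "coeff_space d \<equiv> Pi\<^sub>M {1..d} (\<lambda>_. lborel)"

interpretation lborel_family: product_sigma_finite "\<lambda>_::nat. lborel :: real measure"
  by standard

lemma sigma_finite_coeff_space: "sigma_finite_measure (coeff_space d)"
  by (rule lborel_family.sigma_finite) simp

lemma measurable_quo:
  assumes "f \<in> borel_measurable M" "g \<in> borel_measurable M"
    and "\<And>i. 1 \<le> i \<Longrightarrow> i < k \<Longrightarrow> (\<lambda>x. h x i) \<in> borel_measurable M"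
  shows "(\<lambda>x. quo (f x) (g x) (h x) k) \<in> borel_measurable M"
  using assms(3)
proof (induction k rule: induct_nat_012)
  case (ge2 n)
  have "(\<lambda>x. quo (f x) (g x) (h x) n) \<in> borel_measurable M"
    "(\<lambda>x. quo (f x) (g x) (h x) (Suc n)) \<in> borel_measurable M"
    using ge2 by auto
  moreover have "(\<lambda>x. h x (Suc n)) \<in> borel_measurable M" using ge2.prems by simp
  ultimately show ?case using assms(1,2) by simp
qed auto

definition quo_map :: "nat \<Rightarrow> real \<Rightarrow> real \<Rightarrow> (nat \<Rightarrow> real) \<Rightarrow> nat \<Rightarrow> real" where
  "quo_map N u w a = (\<lambda>k\<in>{1..N}. quo u w a (Suc k))"

lemma measurable_quo_map:
  assumes "f \<in> borel_measurable M" "g \<in> borel_measurable M"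
    and "\<And>i. i \<in> {1..N} \<Longrightarrow> (\<lambda>x. h x i) \<in> borel_measurable M"
  shows "(\<lambda>x. quo_map N (f x) (g x) (h x)) \<in> M \<rightarrow>\<^sub>M coeff_space N"
  unfolding quo_map_def
  by (rule measurable_restrict) (use assms in \<open>auto intro!: measurable_quo\<close>)

lemma measurable_coeff [measurable]: "i \<in> {1..d} \<Longrightarrow> (\<lambda>a. a i) \<in> borel_measurable (coeff_space d)"
  using measurable_component_singleton[of i "{1..d}" "\<lambda>_. lborel :: real measure"] by simp

lemma measurable_quo_map_const: "quo_map N u w \<in> coeff_space N \<rightarrow>\<^sub>M coeff_space N"
  by (rule measurable_quo_map[OF borel_measurable_const borel_measurable_const measurable_coeff])

text \<open>Each new coordinate of the quotient is the new coordinate of the dividend shifted by a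
  function of the earlier ones, so the map preserves Lebesgue measure by Fubini's theorem and
  translation invariance.\<close>

lemma nn_integral_quo_map:
  assumes "f \<in> borel_measurable (coeff_space N)"
  shows "(\<integral>\<^sup>+a. f (quo_map N u w a) \<partial>coeff_space N) = (\<integral>\<^sup>+a. f a \<partial>coeff_space N)"
  using assms
proof (induction N arbitrary: f)
  case 0
  have "quo_map 0 u w a = a" if "a \<in> space (coeff_space 0)" for a
    using that by (simp add: quo_map_def space_PiM PiE_def extensional_def restrict_def fun_eq_iff)
  then show ?case by (intro nn_integral_cong) auto
next
  case (Suc N)
  have ins: "{1..Suc N} = insert (Suc N) {1..N}" by auto
  have f: "f \<in> borel_measurable (Pi\<^sub>M (insert (Suc N) {1..N}) (\<lambda>_. lborel))"
    using Suc.prems by (simp only: ins)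
  have fT: "(\<lambda>a. f (quo_map (Suc N) u w a)) \<in> borel_measurable (Pi\<^sub>M (insert (Suc N) {1..N}) (\<lambda>_. lborel))"
    using measurable_compose[OF measurable_quo_map_const Suc.prems] by (simp only: ins)
  have upd: "(\<lambda>(x, y). x(Suc N := y)) \<in> coeff_space N \<Otimes>\<^sub>M lborel \<rightarrow>\<^sub>M coeff_space (Suc N)"
    unfolding ins by (rule measurable_add_dim)
  have slice: "(\<lambda>y. f (x(Suc N := y))) \<in> borel_measurable lborel" if "x \<in> space (coeff_space N)" for x
    using measurable_compose[OF measurable_compose[OF measurable_Pair1'[OF that] upd] Suc.prems]
    by (simp only: prod.case)
  have inner: "(\<lambda>x. \<integral>\<^sup>+y. f (x(Suc N := y)) \<partial>lborel) \<in> borel_measurable (coeff_space N)"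
    using measurable_compose[OF upd Suc.prems]
    by (intro lborel.borel_measurable_nn_integral) (simp only: case_prod_unfold)
  have step: "quo_map (Suc N) u w (x(Suc N := y))
      = (quo_map N u w x)(Suc N := (- u * quo u w x (Suc N) - w * quo u w x N) + 1 * y)" for x y
  proof
    fix k
    have c: "quo u w (x(Suc N := y)) j = quo u w x j" if "j \<le> Suc N" for j
      by (rule quo_cong) (use that in auto)
    show "quo_map (Suc N) u w (x(Suc N := y)) k
      = ((quo_map N u w x)(Suc N := (- u * quo u w x (Suc N) - w * quo u w x N) + 1 * y)) k"
      by (cases "k = Suc N") (auto simp: quo_map_def c)
  qed
  have "(\<integral>\<^sup>+a. f (quo_map (Suc N) u w a) \<partial>coeff_space (Suc N))
      = (\<integral>\<^sup>+x. \<integral>\<^sup>+y. f (quo_map (Suc N) u w (x(Suc N := y))) \<partial>lborel \<partial>coeff_space N)"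
    unfolding ins
    by (rule lborel_family.product_nn_integral_insert[OF _ _ fT]) auto
  also have "\<dots> = (\<integral>\<^sup>+x. \<integral>\<^sup>+y. f ((quo_map N u w x)(Suc N := y)) \<partial>lborel \<partial>coeff_space N)"
  proof (rule nn_integral_cong)
    fix x assume x: "x \<in> space (coeff_space N)"
    have "quo_map N u w x \<in> space (coeff_space N)" by (simp add: quo_map_def space_PiM)
    from nn_integral_real_affine[OF slice[OF this, simplified], of 1 "- u * quo u w x (Suc N) - w * quo u w x N"]
    show "(\<integral>\<^sup>+y. f (quo_map (Suc N) u w (x(Suc N := y))) \<partial>lborel)
        = (\<integral>\<^sup>+y. f ((quo_map N u w x)(Suc N := y)) \<partial>lborel)"
      unfolding step by simp
  qed
  also have "\<dots> = (\<integral>\<^sup>+x. \<integral>\<^sup>+y. f (x(Suc N := y)) \<partial>lborel \<partial>coeff_space N)"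
    by (rule Suc.IH[OF inner])
  also have "\<dots> = (\<integral>\<^sup>+a. f a \<partial>coeff_space (Suc N))"
    unfolding ins by (rule lborel_family.product_nn_integral_insert[symmetric]) (use f in auto)
  finally show ?case .
qed

lemma distr_quo_map: "distr (coeff_space N) (coeff_space N) (quo_map N u w) = coeff_space N"
proof (rule measure_eqI)
  note T = measurable_quo_map_const
  fix A assume "A \<in> sets (distr (coeff_space N) (coeff_space N) (quo_map N u w))"
  then have A: "A \<in> sets (coeff_space N)" by simp
  have "emeasure (distr (coeff_space N) (coeff_space N) (quo_map N u w)) A
      = (\<integral>\<^sup>+a. indicator A a \<partial>distr (coeff_space N) (coeff_space N) (quo_map N u w))"
    using A by simp
  also have "\<dots> = (\<integral>\<^sup>+a. indicator A (quo_map N u w a) \<partial>coeff_space N)"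
    by (rule nn_integral_distr[OF T]) (use A in simp)
  also have "\<dots> = emeasure (coeff_space N) A"
    using A by (subst nn_integral_quo_map) auto
  finally show "emeasure (distr (coeff_space N) (coeff_space N) (quo_map N u w)) A = emeasure (coeff_space N) A" .
qed simp

lemma integral_quo_map:
  fixes F :: "(nat \<Rightarrow> real) \<Rightarrow> 'b::{banach, second_countable_topology}"
  assumes "F \<in> borel_measurable (coeff_space N)"
  shows "(\<integral>a. F (quo_map N u w a) \<partial>coeff_space N) = (\<integral>b. F b \<partial>coeff_space N)"
  using integral_distr[OF measurable_quo_map_const assms] by (simp only: distr_quo_map)

lemma measurable_set_last: "(\<lambda>(a, c). set_last N a c) \<in>
    coeff_space N \<Otimes>\<^sub>M plane \<rightarrow>\<^sub>M coeff_space (Suc (Suc N))"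
proof (rule measurable_PiM_single')
  fix i assume i: "i \<in> {1..Suc (Suc N)}"
  consider "i \<in> {1..N}" | "i = Suc N" | "i = Suc (Suc N)" using i by fastforce
  then show "(\<lambda>z. (case z of (a, c) \<Rightarrow> set_last N a c) i)
      \<in> coeff_space N \<Otimes>\<^sub>M plane \<rightarrow>\<^sub>M lborel"
    by cases (auto simp: set_last_def case_prod_unfold
      intro!: measurable_compose[OF measurable_fst measurable_coeff])
qed (auto simp: set_last_def space_pair_measure space_PiM PiE_def extensional_def Pi_def split: if_splits)

lemma distr_set_last: "distr (coeff_space N \<Otimes>\<^sub>M plane) (coeff_space (Suc (Suc N)))
    (\<lambda>(a, c). set_last N a c) = coeff_space (Suc (Suc N))"
proof (rule lborel_family.PiM_eqI)
  have LL: "sigma_finite_measure plane"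
    unfolding lborel_prod by standard
  fix A :: "nat \<Rightarrow> real set" assume A: "\<And>i. i \<in> {1..Suc (Suc N)} \<Longrightarrow> A i \<in> sets lborel"
  have pre: "(\<lambda>(a, c). set_last N a c) -` Pi\<^sub>E {1..Suc (Suc N)} A \<inter> space (coeff_space N \<Otimes>\<^sub>M plane)
      = Pi\<^sub>E {1..N} A \<times> (A (Suc N) \<times> A (Suc (Suc N)))"
  proof (intro equalityI subsetI)
    fix z assume z: "z \<in> (\<lambda>(a, c). set_last N a c) -` Pi\<^sub>E {1..Suc (Suc N)} A \<inter> space (coeff_space N \<Otimes>\<^sub>M plane)"
    obtain a c1 c2 where zz: "z = (a, (c1, c2))" by (metis prod.exhaust)
    have mem: "set_last N a (c1, c2) i \<in> A i" if "i \<in> {1..Suc (Suc N)}" for i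
      using z that by (auto simp: zz PiE_def Pi_def)
    have "a i \<in> A i" if "i \<in> {1..N}" for i
      using mem[of i] that by (auto simp: set_last_def split: if_splits)
    moreover have "a \<in> extensional {1..N}" using z by (auto simp: zz space_pair_measure space_PiM PiE_def)
    moreover have "c1 \<in> A (Suc N)" "c2 \<in> A (Suc (Suc N))"
      using mem[of "Suc N"] mem[of "Suc (Suc N)"] by (auto simp: set_last_def)
    ultimately show "z \<in> Pi\<^sub>E {1..N} A \<times> (A (Suc N) \<times> A (Suc (Suc N)))"
      by (auto simp: zz PiE_def)
  next
    fix z assume z: "z \<in> Pi\<^sub>E {1..N} A \<times> (A (Suc N) \<times> A (Suc (Suc N)))"
    obtain a c1 c2 where zz: "z = (a, (c1, c2))" by (metis prod.exhaust)
    have "set_last N a (c1, c2) \<in> Pi\<^sub>E {1..Suc (Suc N)} A"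
    proof (rule PiE_I)
      fix i assume i: "i \<in> {1..Suc (Suc N)}"
      consider "i \<in> {1..N}" | "i = Suc N" | "i = Suc (Suc N)" using i by fastforce
      then show "set_last N a (c1, c2) i \<in> A i" using z by cases (auto simp: zz set_last_def PiE_def Pi_def)
    qed (use z in \<open>auto simp: zz set_last_def PiE_def extensional_def\<close>)
    then show "z \<in> (\<lambda>(a, c). set_last N a c) -` Pi\<^sub>E {1..Suc (Suc N)} A \<inter> space (coeff_space N \<Otimes>\<^sub>M plane)"
      using z by (auto simp: zz space_pair_measure space_PiM PiE_def)
  qed
  have meas: "Pi\<^sub>E {1..N} A \<in> sets (coeff_space N)" "A (Suc N) \<in> sets lborel" "A (Suc (Suc N)) \<in> sets lborel"
    using A by (auto intro!: sets_PiM_I_finite)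
  have "emeasure (distr (coeff_space N \<Otimes>\<^sub>M plane) (coeff_space (Suc (Suc N)))
      (\<lambda>(a, c). set_last N a c)) (Pi\<^sub>E {1..Suc (Suc N)} A)
      = emeasure (coeff_space N \<Otimes>\<^sub>M plane) (Pi\<^sub>E {1..N} A \<times> (A (Suc N) \<times> A (Suc (Suc N))))"
    by (subst emeasure_distr[OF measurable_set_last])
       (use A in \<open>auto simp only: pre intro!: sets_PiM_I_finite\<close>)
  also have "\<dots> = (\<Prod>i\<in>{1..N}. emeasure lborel (A i)) * (emeasure lborel (A (Suc N)) * emeasure lborel (A (Suc (Suc N))))"
  proof -
    have "emeasure (coeff_space N) (Pi\<^sub>E {1..N} A) = (\<Prod>i\<in>{1..N}. emeasure lborel (A i))"
      by (rule lborel_family.emeasure_PiM) (use A in auto)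
    moreover have "emeasure plane (A (Suc N) \<times> A (Suc (Suc N)))
        = emeasure lborel (A (Suc N)) * emeasure lborel (A (Suc (Suc N)))"
      by (rule lborel.emeasure_pair_measure_Times) (use meas in auto)
    ultimately show ?thesis
      using sigma_finite_measure.emeasure_pair_measure_Times[OF LL meas(1), of "A (Suc N) \<times> A (Suc (Suc N))"] meas
      by simp
  qed
  also have "\<dots> = (\<Prod>i\<in>{1..Suc (Suc N)}. emeasure lborel (A i))"
    by (simp add: mult_ac)
  finally show "emeasure (distr (coeff_space N \<Otimes>\<^sub>M plane) (coeff_space (Suc (Suc N)))
      (\<lambda>(a, c). set_last N a c)) (Pi\<^sub>E {1..Suc (Suc N)} A) = (\<Prod>i\<in>{1..Suc (Suc N)}. emeasure lborel (A i))" .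
qed simp_all

section \<open>Measurability of the root domains\<close>

text \<open>Unlike Borel sets, these sets are stable under continuous images, and in Hausdorff
  spaces they are Borel. The root domains are images under multiplication of polynomials.\<close>

definition sigma_compact :: "'a::topological_space set \<Rightarrow> bool" where
  "sigma_compact S \<longleftrightarrow> (\<exists>K::nat \<Rightarrow> 'a set. (\<forall>n. compact (K n)) \<and> S = (\<Union>n. K n))"

lemma sigma_compact_image:
  assumes "sigma_compact S" "continuous_on UNIV f"
  shows "sigma_compact (f ` S)"
proof -
  obtain K where K: "\<And>n::nat. compact (K n)" "S = (\<Union>n. K n)"
    using assms(1) unfolding sigma_compact_def by blast
  have "compact (f ` K n)" for n
    by (rule compact_continuous_image[OF continuous_on_subset[OF assms(2)] K(1)]) simp
  then show ?thesis unfolding sigma_compact_def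
    by (intro exI[of _ "\<lambda>n. f ` K n"]) (auto simp: K(2))
qed

lemma sigma_compact_countable_UN:
  fixes K :: "'i \<Rightarrow> 'a::topological_space set"
  assumes "countable I" "\<And>i. i \<in> I \<Longrightarrow> compact (K i)"
  shows "sigma_compact (\<Union>i\<in>I. K i)"
proof (cases "I = {}")
  case True
  then show ?thesis unfolding sigma_compact_def by (intro exI[of _ "\<lambda>_. {}"]) auto
next
  case False
  have "range (from_nat_into I) = I" using False assms(1) by (rule range_from_nat_into)
  then have "(\<Union>i\<in>I. K i) = \<Union>(K ` range (from_nat_into I))" by (simp only:)
  then have "(\<Union>i\<in>I. K i) = (\<Union>n. K (from_nat_into I n))" by (simp only: image_image)
  moreover have "compact (K (from_nat_into I n))" for n
    by (rule assms(2)) (rule from_nat_into[OF False])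
  ultimately show ?thesis unfolding sigma_compact_def
    by (intro exI[of _ "\<lambda>n. K (from_nat_into I n)"] conjI allI)
qed

lemma sigma_compact_Times:
  assumes "sigma_compact S" "sigma_compact T"
  shows "sigma_compact (S \<times> T)"
proof -
  obtain K where K: "\<And>n::nat. compact (K n)" "S = (\<Union>n. K n)"
    using assms(1) unfolding sigma_compact_def by blast
  obtain L where L: "\<And>n::nat. compact (L n)" "T = (\<Union>n. L n)"
    using assms(2) unfolding sigma_compact_def by blast
  have "S \<times> T = (\<Union>(m, n)\<in>UNIV. K m \<times> L n)" by (auto simp: K(2) L(2))
  moreover have "sigma_compact (\<Union>(m, n)\<in>UNIV. K m \<times> L n)"
    by (rule sigma_compact_countable_UN) (auto intro: compact_Times K(1) L(1))
  ultimately show ?thesis by simp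
qed

lemma sigma_compact_Un:
  assumes "sigma_compact S" "sigma_compact T"
  shows "sigma_compact (S \<union> T)"
proof -
  obtain K where K: "\<And>n::nat. compact (K n)" "S = (\<Union>n. K n)"
    using assms(1) unfolding sigma_compact_def by blast
  obtain L where L: "\<And>n::nat. compact (L n)" "T = (\<Union>n. L n)"
    using assms(2) unfolding sigma_compact_def by blast
  have "S \<union> T = (\<Union>n. K n \<union> L n)" by (auto simp: K(2) L(2))
  then show ?thesis unfolding sigma_compact_def     by (intro exI[of _ "\<lambda>n. K n \<union> L n"] conjI allI compact_Un K(1) L(1))
qed

lemma sigma_compact_open:
  fixes S :: "'a::euclidean_space set"
  assumes "open S" shows "sigma_compact S"
proof -
  obtain C :: "nat \<Rightarrow> 'a set" where "\<And>n. compact (C n)" "\<Union>(range C) = S"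
    by (rule open_Union_compact_subsets[OF assms]) blast
  then show ?thesis unfolding sigma_compact_def by (intro exI[of _ C]) auto
qed

lemma sigma_compact_borel:
  fixes S :: "'a::t2_space set"
  assumes "sigma_compact S" shows "S \<in> sets borel"
proof -
  obtain K where K: "\<And>n::nat. compact (K n)" "S = (\<Union>n. K n)"
    using assms unfolding sigma_compact_def by blast
  have "K n \<in> sets borel" for n by (rule borel_closed[OF compact_imp_closed[OF K(1)]])
  then show ?thesis unfolding K(2) by (intro sets.countable_UN) auto
qed

lemma sigma_compact_singleton: "sigma_compact {x}"
  unfolding sigma_compact_def by (intro exI[of _ "\<lambda>_. {x}"]) auto

lemma sigma_compact_empty: "sigma_compact {}"
  unfolding sigma_compact_def by (intro exI[of _ "\<lambda>_. {}"]) auto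

text \<open>The value \<open>undefined\<close> outside \<open>{1..d}\<close> makes the function
  extensional, as a point of the coefficient space has to be.\<close>

definition coeffs_fun :: "nat \<Rightarrow> complex poly \<Rightarrow> nat \<Rightarrow> real" where
  "coeffs_fun d p = (\<lambda>k. if k \<in> {1..d} then Re (coeff p (d - k)) else undefined)"

lemma coeff_monic_poly:
  "coeff (monic_poly d a) n = (if n = d then 1 else if n < d then of_real (a (d - n)) else 0)"
proof (induction d arbitrary: n)
  case (Suc d)
  show ?case
    by (cases n) (auto simp: monic_poly_Suc Suc)
qed simp

lemma coeffs_fun_monic_poly: "a \<in> {1..d} \<rightarrow>\<^sub>E UNIV \<Longrightarrow> coeffs_fun d (monic_poly d a) = a"
  by (auto simp: coeffs_fun_def coeff_monic_poly fun_eq_iff PiE_def extensional_def)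

lemma coeffs_fun_in_PiE: "coeffs_fun d p \<in> {1..d} \<rightarrow>\<^sub>E UNIV"
  by (auto simp: coeffs_fun_def PiE_def extensional_def)

lemma monic_poly_coeffs_fun:
  assumes "degree p = d" "lead_coeff p = 1" "\<And>n. Im (coeff p n) = 0"
  shows "monic_poly d (coeffs_fun d p) = p"
proof (rule poly_eqI)
  fix n
  show "coeff (monic_poly d (coeffs_fun d p)) n = coeff p n"
    using assms coeff_eq_0[of p n] by (auto simp: coeff_monic_poly coeffs_fun_def complex_eq_iff)
qed

definition root_domain :: "nat \<Rightarrow> complex poly \<Rightarrow> bool" where
  "root_domain s p \<longleftrightarrow> (\<forall>\<xi>. poly p \<xi> = 0 \<longrightarrow> cmod \<xi> < 1) \<and> num_conj_pairs p = s"

lemma E_set_alt: "E_set d s = {a \<in> {1..d} \<rightarrow>\<^sub>E UNIV. root_domain s (monic_poly d a)}"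
  by (simp add: E_set_def root_domain_def)

lemma Im_coeff_monic_poly: "Im (coeff (monic_poly d a) n) = 0"
  by (simp add: coeff_monic_poly)

lemma E_setI:
  assumes "degree p = d" "lead_coeff p = 1" "\<And>n. Im (coeff p n) = 0" "root_domain s p"
  shows "coeffs_fun d p \<in> E_set d s"
  unfolding E_set_alt using assms coeffs_fun_in_PiE monic_poly_coeffs_fun[OF assms(1-3)] by simp

lemma Im_coeff_mult_0:
  assumes "\<And>n. Im (coeff p n) = 0" "\<And>n. Im (coeff q n) = 0"
  shows "Im (coeff (p * q) n) = 0"
  by (simp add: coeff_mult assms)

lemma root_domain_mult:
  assumes "p \<noteq> 0" "q \<noteq> 0"
  shows "root_domain s (p * q) \<longleftrightarrow> (\<exists>s1 s2. s = s1 + s2 \<and> root_domain s1 p \<and> root_domain s2 q)"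
  using num_conj_pairs_mult[OF assms] by (auto simp: root_domain_def)

lemma root_domain_linear: "root_domain s [:- x, 1:] \<longleftrightarrow> cmod x < 1 \<and> s = (if Im x > 0 then 1 else 0)"
  by (auto simp: root_domain_def num_conj_pairs_linear)

lemma root_domain_quad_cnj:
  assumes "Im z > 0"
  shows "root_domain s (quad (- 2 * Re z) ((cmod z)\<^sup>2)) \<longleftrightarrow> cmod z < 1 \<and> s = 1"
  unfolding quad_cnj using assms by (subst root_domain_mult) (auto simp: root_domain_linear)

lemma continuous_coeff_monic_poly: "continuous_on UNIV (\<lambda>a. coeff (monic_poly d a) n)"
  unfolding coeff_monic_poly
  by (cases "n = d"; cases "n < d") (auto intro!: continuous_intros continuous_on_product_coordinates)

lemma continuous_coeff_pCons:
  assumes "continuous_on UNIV f" "\<And>n. continuous_on UNIV (\<lambda>x. coeff (p x) n)"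
  shows "continuous_on UNIV (\<lambda>x. coeff (pCons (f x) (p x)) n)"
  using assms by (cases n) auto

lemma continuous_coeff_mult:
  fixes p q :: "'a::topological_space \<Rightarrow> complex poly"
  assumes "\<And>n. continuous_on UNIV (\<lambda>x. coeff (p x) n)" "\<And>n. continuous_on UNIV (\<lambda>x. coeff (q x) n)"
  shows "continuous_on UNIV (\<lambda>x. coeff (p x * q x) n)"
  unfolding coeff_mult by (intro continuous_intros assms)

lemma E_set_factor_linear:
  "(\<lambda>(x, b). coeffs_fun (Suc d) ([:- of_real x, 1:] * monic_poly d b)) ` ({-1<..<1} \<times> E_set d s) \<subseteq> E_set (Suc d) s"
proof -
  have "coeffs_fun (Suc d) ([:- of_real x, 1:] * monic_poly d b) \<in> E_set (Suc d) s"
    if "x \<in> {-1<..<1}" "b \<in> E_set d s" for x b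
  proof (rule E_setI)
    let ?p = "[:- of_real x, 1:] * monic_poly d b"
    show deg: "degree ?p = Suc d" by (subst degree_mult_eq) auto
    show "lead_coeff ?p = 1" unfolding lead_coeff_mult by simp
    show "Im (coeff ?p n) = 0" for n
      by (rule Im_coeff_mult_0) (auto simp: Im_coeff_monic_poly coeff_pCons split: nat.splits)
    show "root_domain s ?p"
      using that by (subst root_domain_mult) (auto simp: root_domain_linear E_set_alt)
  qed
  then show ?thesis by auto
qed

lemma E_set_factor_quad:
  "(\<lambda>(z, b). coeffs_fun (Suc (Suc d)) (quad (- 2 * Re z) ((cmod z)\<^sup>2) * monic_poly d b))
     ` ({z. Im z > 0 \<and> cmod z < 1} \<times> E_set d s) \<subseteq> E_set (Suc (Suc d)) (Suc s)"
proof -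
  have "coeffs_fun (Suc (Suc d)) (quad (- 2 * Re z) ((cmod z)\<^sup>2) * monic_poly d b) \<in> E_set (Suc (Suc d)) (Suc s)"
    if "Im z > 0" "cmod z < 1" "b \<in> E_set d s" for z b
  proof (rule E_setI)
    let ?p = "quad (- 2 * Re z) ((cmod z)\<^sup>2) * monic_poly d b"
    show "degree ?p = Suc (Suc d)" by (subst degree_mult_eq) (auto simp: quad_def)
    show "lead_coeff ?p = 1" unfolding lead_coeff_mult by (simp add: quad_def)
    show "Im (coeff ?p n) = 0" for n
      by (rule Im_coeff_mult_0) (auto simp: Im_coeff_monic_poly quad_def coeff_pCons split: nat.splits)
    show "root_domain (Suc s) ?p"
    proof -
      have "root_domain 1 (quad (- 2 * Re z) ((cmod z)\<^sup>2))" "root_domain s (monic_poly d b)"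
        using that root_domain_quad_cnj[OF that(1), of 1] by (auto simp: E_set_alt)
      then have "\<exists>s1 s2. Suc s = s1 + s2 \<and> root_domain s1 (quad (- 2 * Re z) ((cmod z)\<^sup>2))
          \<and> root_domain s2 (monic_poly d b)"
        by (intro exI[of _ "1::nat"] exI[of _ s] conjI) auto
      then show ?thesis by (simp only: root_domain_mult[OF quad_nonzero monic_poly_nonzero])
    qed
  qed
  then show ?thesis by auto
qed

text \<open>Splitting off a real root or a pair of conjugate roots.\<close>

lemma E_set_Suc_cases:
  assumes a: "a \<in> E_set (Suc d) s"
  shows "a \<in> (\<lambda>(x, b). coeffs_fun (Suc d) ([:- of_real x, 1:] * monic_poly d b)) ` ({-1<..<1} \<times> E_set d s)
    \<or> (\<exists>d' s'. d = Suc d' \<and> s = Suc s' \<and>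
        a \<in> (\<lambda>(z, b). coeffs_fun (Suc (Suc d')) (quad (- 2 * Re z) ((cmod z)\<^sup>2) * monic_poly d' b))
     ` ({z. Im z > 0 \<and> cmod z < 1} \<times> E_set d' s'))"
proof -
  let ?p = "monic_poly (Suc d) a"
  have ext: "a \<in> {1..Suc d} \<rightarrow>\<^sub>E UNIV" and dom: "root_domain s ?p" using a by (auto simp: E_set_alt)
  have roots: "cmod z < 1" if "poly ?p z = 0" for z using dom that by (auto simp: root_domain_def)
  have "\<not> constant (poly ?p)" by (simp add: constant_degree)
  then obtain z0 where z0: "poly ?p z0 = 0" using fundamental_theorem_of_algebra by blast
  \<comment> \<open>A quotient of polynomials with real coefficients is its own conjugate.\<close>
  have real_quotient: "Im (coeff q n) = 0" if "?p = r * q" "\<And>n. Im (coeff r n) = 0" "r \<noteq> 0" for r q n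
  proof -
    have cnjp: "map_poly cnj ?p = ?p" "map_poly cnj r = r"
      using that(2) by (auto simp: poly_eq_iff coeff_map_poly complex_eq_iff Im_coeff_monic_poly)
    have "map_poly cnj (r * q) = map_poly cnj r * map_poly cnj q"
      by (rule poly_eqI) (simp add: coeff_map_poly coeff_mult)
    then have "r * map_poly cnj q = r * q" using that(1) cnjp by metis
    then have "map_poly cnj q = q" using that(3) by simp
    then have "cnj (coeff q n) = coeff q n" by (metis coeff_map_poly complex_cnj_zero)
    then show ?thesis by (simp add: complex_eq_iff)
  qed
  show ?thesis
  proof (cases "Im z0 = 0")
    case True
    define x where "x = Re z0"
    have zx: "z0 = of_real x" using True by (simp add: x_def complex_eq_iff)
    obtain q where q: "?p = [:- of_real x, 1:] * q"
      using z0 unfolding zx poly_eq_0_iff_dvd by (elim dvdE)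
    have q0: "q \<noteq> 0" using q by auto
    have "degree ?p = Suc (degree q)" unfolding q using q0 by (subst degree_mult_eq) auto
    then have degq: "degree q = d" by simp
    have "lead_coeff ?p = lead_coeff q" unfolding q lead_coeff_mult by simp
    then have lc: "lead_coeff q = 1" by simp
    have imq: "Im (coeff q n) = 0" for n
      by (rule real_quotient[OF q]) (auto simp: coeff_pCons split: nat.splits)
    have domq: "root_domain s q"
      using dom unfolding q using q0 by (subst (asm) root_domain_mult) (auto simp: root_domain_linear)
    have "coeffs_fun d q \<in> E_set d s" by (rule E_setI[OF degq lc imq domq])
    moreover have "x \<in> {-1<..<1}" using roots[OF z0] by (simp add: zx abs_less_iff)
    moreover have "a = coeffs_fun (Suc d) ([:- of_real x, 1:] * monic_poly d (coeffs_fun d q))"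
      unfolding monic_poly_coeffs_fun[OF degq lc imq] q[symmetric] using coeffs_fun_monic_poly[OF ext] by simp
    ultimately have "a \<in> (\<lambda>(x, b). coeffs_fun (Suc d) ([:- of_real x, 1:] * monic_poly d b)) ` ({-1<..<1} \<times> E_set d s)"
      by (intro image_eqI[of _ _ "(x, coeffs_fun d q)"]) auto
    then show ?thesis ..
  next
    case False
    define z where "z = (if Im z0 > 0 then z0 else cnj z0)"
    have z: "Im z > 0" "poly ?p z = 0" "poly ?p (cnj z) = 0"
      using False z0 by (auto simp: z_def poly_monic_poly_cnj)
    have "[:- z, 1:] dvd ?p" using z(2) by (simp add: poly_eq_0_iff_dvd)
    then obtain q1 where q1: "?p = [:- z, 1:] * q1" by (elim dvdE)
    have "poly q1 (cnj z) = 0" using z(1,3) by (auto simp: q1 complex_eq_iff)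
    then obtain q where "q1 = [:- cnj z, 1:] * q" by (metis poly_eq_0_iff_dvd dvdE)
    then have q: "?p = quad (- 2 * Re z) ((cmod z)\<^sup>2) * q"
      unfolding quad_cnj q1 by (simp only: mult.assoc)
    have q0: "q \<noteq> 0" using q by auto
    have dq: "degree (quad (- 2 * Re z) ((cmod z)\<^sup>2)) = 2" by (simp add: quad_def)
    have "degree ?p = 2 + degree q" unfolding q using q0 dq by (subst degree_mult_eq) auto
    then obtain d' where d: "d = Suc d'" and degq: "degree q = d'" by (cases d) auto
    have "lead_coeff ?p = lead_coeff q" unfolding q lead_coeff_mult by (simp add: quad_def)
    then have lc: "lead_coeff q = 1" by simp
    have imq: "Im (coeff q n) = 0" for n
      by (rule real_quotient[OF q]) (auto simp: quad_def coeff_pCons split: nat.splits)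
    obtain s' where s: "s = Suc s'" and domq: "root_domain s' q"
    proof -
      obtain s1 s2 where s12: "s = s1 + s2" "root_domain s1 (quad (- 2 * Re z) ((cmod z)\<^sup>2))" "root_domain s2 q"
        using dom unfolding q by (subst (asm) root_domain_mult) (use q0 in auto)
      then have "s1 = 1" using root_domain_quad_cnj[OF z(1)] by blast
      then show thesis using s12 that[of s2] by simp
    qed
    have "coeffs_fun d' q \<in> E_set d' s'" by (rule E_setI[OF degq lc imq domq])
    moreover have "cmod z < 1" by (rule roots[OF z(2)])
    moreover have "a = coeffs_fun (Suc (Suc d')) (quad (- 2 * Re z) ((cmod z)\<^sup>2) * monic_poly d' (coeffs_fun d' q))"
      unfolding monic_poly_coeffs_fun[OF degq lc imq] q[symmetric] using coeffs_fun_monic_poly[OF ext] by (simp add: d)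
    ultimately have "a \<in> (\<lambda>(z, b). coeffs_fun (Suc (Suc d')) (quad (- 2 * Re z) ((cmod z)\<^sup>2) * monic_poly d' b))
     ` ({z. Im z > 0 \<and> cmod z < 1} \<times> E_set d' s')"
      using z(1) by (intro image_eqI[of _ _ "(z, coeffs_fun d' q)"]) auto
    then show ?thesis using d s by blast
  qed
qed

lemma continuous_coeffs_fun:
  assumes "\<And>n. continuous_on UNIV (\<lambda>x. coeff (p x) n)"
  shows "continuous_on UNIV (\<lambda>x. coeffs_fun d (p x))"
proof (rule continuous_on_coordinatewise_then_product)
  fix i
  show "continuous_on UNIV (\<lambda>x. coeffs_fun d (p x) i)"
    unfolding coeffs_fun_def using assms by (cases "i \<in> {1..d}") (auto intro!: continuous_intros)
qed

text \<open>Induction on the degree: a root domain is the union of at most two images of products of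
  smaller root domains with an interval or a half disc.\<close>

lemma sigma_compact_E_set: "sigma_compact (E_set d s)"
proof (induction d arbitrary: s rule: less_induct)
  case (less d)
  show ?case
  proof (cases d)
    case 0
    have "E_set 0 s = (if s = 0 then {\<lambda>_. undefined} else {})"
      by (auto simp: E_set_def num_conj_pairs_def)
    then show ?thesis using 0 by (simp add: sigma_compact_singleton sigma_compact_empty)
  next
    case (Suc d')
    let ?f = "\<lambda>(x::real, b). coeffs_fun (Suc d') ([:- of_real x, 1:] * monic_poly d' b)"
    let ?g = "\<lambda>d''. \<lambda>(z, b). coeffs_fun (Suc (Suc d'')) (quad (- 2 * Re z) ((cmod z)\<^sup>2) * monic_poly d'' b)"
    have cm: "continuous_on UNIV (\<lambda>v. coeff (monic_poly k (snd v)) n)" for k n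
      using continuous_on_compose2[OF continuous_coeff_monic_poly continuous_on_snd[OF continuous_on_id]] by simp
    have lin: "sigma_compact (?f ` ({-1<..<1} \<times> E_set d' s))"
    proof (rule sigma_compact_image)
      show "sigma_compact ({-1<..<1::real} \<times> E_set d' s)"
        by (intro sigma_compact_Times sigma_compact_open less) (auto simp: Suc)
      show "continuous_on UNIV ?f"
        unfolding case_prod_unfold
        by (intro continuous_coeffs_fun continuous_coeff_mult continuous_coeff_pCons cm continuous_intros)
    qed
    show ?thesis
    proof (cases "\<exists>d'' s'. d' = Suc d'' \<and> s = Suc s'")
      case True
      then obtain d'' s' where ds: "d' = Suc d''" "s = Suc s'" by blast
      have quad: "sigma_compact (?g d'' ` ({z. Im z > 0 \<and> cmod z < 1} \<times> E_set d'' s'))"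
      proof (rule sigma_compact_image)
        have "open {z. Im z > 0 \<and> cmod z < 1}"
          by (intro open_Collect_conj open_Collect_less continuous_intros)
        then show "sigma_compact ({z. Im z > 0 \<and> cmod z < 1} \<times> E_set d'' s')"
          by (intro sigma_compact_Times sigma_compact_open less) (auto simp: Suc ds)
        show "continuous_on UNIV (?g d'')"
          unfolding case_prod_unfold quad_def
          by (intro continuous_coeffs_fun continuous_coeff_mult continuous_coeff_pCons cm continuous_intros)
      qed
      have "E_set d s = ?f ` ({-1<..<1} \<times> E_set d' s) \<union> ?g d'' ` ({z. Im z > 0 \<and> cmod z < 1} \<times> E_set d'' s')"
        using E_set_Suc_cases[of _ d' s] E_set_factor_linear[of d' s] E_set_factor_quad[of d'' s']
        unfolding Suc ds by blast
      then show ?thesis using sigma_compact_Un[OF lin quad] by simp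
    next
      case False
      have "E_set d s = ?f ` ({-1<..<1} \<times> E_set d' s)"
        using E_set_Suc_cases[of _ d' s] E_set_factor_linear[of d' s] False unfolding Suc by blast
      then show ?thesis using lin by simp
    qed
  qed
qed

text \<open>The root domain is Borel in the space of all sequences, and the inclusion of the
  coefficient space into that space is measurable.\<close>

lemma sets_E_set: "E_set d s \<in> sets (coeff_space d)"
proof -
  have "E_set d s \<in> sets (borel :: (nat \<Rightarrow> real) measure)"
    by (rule sigma_compact_borel) (rule sigma_compact_E_set)
  then have S: "E_set d s \<in> sets (Pi\<^sub>M UNIV (\<lambda>_::nat. borel :: real measure))"
    by (simp only: sets_PiM_equal_borel)
  have id: "(\<lambda>a. a) \<in> coeff_space d \<rightarrow>\<^sub>M Pi\<^sub>M UNIV (\<lambda>_::nat. borel :: real measure)"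
  proof (rule measurable_PiM_single')
    fix i :: nat
    show "(\<lambda>a. a i) \<in> coeff_space d \<rightarrow>\<^sub>M borel"
    proof (cases "i \<in> {1..d}")
      case False
      then have "a i = undefined" if "a \<in> space (coeff_space d)" for a
        using that by (auto simp: space_PiM PiE_def extensional_def)
      then show ?thesis by (subst measurable_cong[where g = "\<lambda>_. undefined"]) auto
    qed (rule measurable_coeff)
  qed (auto simp: space_PiM)
  have "E_set d s = (\<lambda>a. a) -` E_set d s \<inter> space (coeff_space d)"
    by (auto simp: E_set_def space_PiM)
  then show ?thesis using measurable_sets[OF id S] by simp
qed

section \<open>The weighted integral and its recursion\<close>

lemma num_conj_pairs_le_degree: "p \<noteq> 0 \<Longrightarrow> num_conj_pairs p \<le> degree p"
proof -
  assume p: "p \<noteq> 0"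
  have fin: "finite {z. poly p z = 0}" by (rule poly_roots_finite[OF p])
  have "degree p = degree (Polynomial.smult (lead_coeff p) (\<Prod>z | poly p z = 0. [:- z, 1:] ^ Polynomial.order z p))"
    by (simp only: complex_poly_decompose)
  also have "\<dots> = (\<Sum>z | poly p z = 0. Polynomial.order z p)"
    using p by (simp add: degree_prod_sum_eq degree_power_eq)
  finally have "degree p = (\<Sum>z | poly p z = 0. Polynomial.order z p)" .
  moreover have "num_conj_pairs p \<le> (\<Sum>z | poly p z = 0. Polynomial.order z p)"
    unfolding num_conj_pairs_def by (rule sum_mono2) (use fin in auto)
  ultimately show ?thesis by simp
qed

lemma weight_eq_sum_E_set:
  assumes "a \<in> space (coeff_space d)"
  shows "weight t (monic_poly d a) = (\<Sum>s\<le>d. t ^ s * indicator (E_set d s) a)"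
proof (cases "\<forall>\<xi>. poly (monic_poly d a) \<xi> = 0 \<longrightarrow> cmod \<xi> < 1")
  case True
  have "indicator (E_set d s) a = (if s = num_conj_pairs (monic_poly d a) then 1 else 0 :: real)" for s
    using assms True by (auto simp: E_set_def indicator_def space_PiM)
  then have "(\<Sum>s\<le>d. t ^ s * indicator (E_set d s) a)
      = (\<Sum>s\<le>d. if s = num_conj_pairs (monic_poly d a) then t ^ s else 0)"
    by (intro sum.cong) auto
  also have "\<dots> = t ^ num_conj_pairs (monic_poly d a)"
    using num_conj_pairs_le_degree[of "monic_poly d a"] by simp
  finally show ?thesis using True by (simp add: weight_def)
next
  case False
  then have "weight t (monic_poly d a) = 0" unfolding weight_def by (rule if_not_P)
  moreover have "indicator (E_set d s) a = (0 :: real)" for s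
    using False by (auto simp: E_set_def indicator_def)
  ultimately show ?thesis by simp
qed

lemma measurable_weight_monic_poly: "(\<lambda>a. weight t (monic_poly d a)) \<in> borel_measurable (coeff_space d)"
proof -
  have "(\<lambda>a. \<Sum>s\<le>d. t ^ s * indicator (E_set d s) a) \<in> borel_measurable (coeff_space d)"
    using sets_E_set by (intro borel_measurable_sum borel_measurable_times) auto
  then show ?thesis
    by (subst measurable_cong[OF weight_eq_sum_E_set]) auto
qed

lemma measurable_poly_monic_poly:
  assumes "\<And>i. i \<in> {1..d} \<Longrightarrow> (\<lambda>x. h x i) \<in> borel_measurable M"
  shows "(\<lambda>x. poly (monic_poly d (h x)) z) \<in> borel_measurable M"
  using assms
proof (induction d)
  case (Suc d)
  then have "(\<lambda>x. poly (monic_poly d (h x)) z) \<in> borel_measurable M" "(\<lambda>x. h x (Suc d)) \<in> borel_measurable M"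
    by auto
  then show ?case by (simp add: monic_poly_Suc)
qed simp

text \<open>Induction on the degree, splitting off one root of modulus less than \<open>1\<close>.
  These bounds make all integrands bounded with bounded support.\<close>

lemma monic_disc_bounds:
  assumes "lead_coeff p = 1" "\<forall>\<xi>. poly p \<xi> = 0 \<longrightarrow> cmod \<xi> < 1"
  shows "cmod (coeff p n) \<le> 2 ^ degree p \<and> cmod (poly p z) \<le> (1 + cmod z) ^ degree p"
  using assms
proof (induction "degree p" arbitrary: p n)
  case 0
  then have "p = 1" using degree_0_id[of p] by (simp add: one_pCons)
  then show ?case by (simp add: coeff_1)
next
  case (Suc m)
  have "\<not> constant (poly p)" using Suc.hyps(2) by (simp add: constant_degree)
  then obtain \<xi> where \<xi>: "poly p \<xi> = 0" using fundamental_theorem_of_algebra by blast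
  then obtain q where q: "p = [:- \<xi>, 1:] * q" unfolding poly_eq_0_iff_dvd by (elim dvdE)
  have q0: "q \<noteq> 0" using q Suc.hyps(2) by auto
  have c\<xi>: "cmod \<xi> < 1" using Suc.prems \<xi> by blast
  have deg: "degree p = Suc (degree q)" unfolding q using q0 by (subst degree_mult_eq) auto
  have lc: "lead_coeff q = 1" using Suc.prems(1) unfolding q lead_coeff_mult by simp
  have rt: "\<forall>\<xi>. poly q \<xi> = 0 \<longrightarrow> cmod \<xi> < 1" using Suc.prems(2) by (simp add: q)
  have IH: "cmod (coeff q n) \<le> 2 ^ degree q \<and> cmod (poly q z) \<le> (1 + cmod z) ^ degree q" for n
    using Suc.hyps(1)[OF _ lc rt] Suc.hyps(2) deg by simp
  have "coeff p n = - \<xi> * coeff q n + (case n of 0 \<Rightarrow> 0 | Suc k \<Rightarrow> coeff q k)"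
    by (cases n) (simp_all add: q)
  then have "cmod (coeff p n) \<le> cmod \<xi> * cmod (coeff q n) + cmod (case n of 0 \<Rightarrow> 0 | Suc k \<Rightarrow> coeff q k)"
    by (metis norm_triangle_ineq norm_mult norm_minus_cancel)
  also have "cmod \<xi> * cmod (coeff q n) \<le> 1 * 2 ^ degree q"
    by (intro mult_mono) (use IH c\<xi> in auto)
  also have "cmod (case n of 0 \<Rightarrow> 0 | Suc k \<Rightarrow> coeff q k) \<le> 2 ^ degree q"
    using IH by (cases n) auto
  finally have 1: "cmod (coeff p n) \<le> 2 ^ degree p" by (simp add: deg)
  have "cmod (poly p z) = cmod (z - \<xi>) * cmod (poly q z)"
    by (simp add: q norm_mult[symmetric] algebra_simps)
  also have "cmod (z - \<xi>) \<le> 1 + cmod z"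
    using norm_triangle_ineq4[of z \<xi>] c\<xi> by simp
  also have "(1 + cmod z) * cmod (poly q z) \<le> (1 + cmod z) * (1 + cmod z) ^ degree q"
    using IH by (intro mult_left_mono) auto
  finally have "cmod (poly p z) \<le> (1 + cmod z) ^ degree p"
    by (simp add: deg mult_right_mono)
  with 1 show ?case by blast
qed

lemma weight_nonzeroD: "weight t p \<noteq> 0 \<Longrightarrow> \<forall>\<xi>. poly p \<xi> = 0 \<longrightarrow> cmod \<xi> < 1"
  unfolding weight_def by (metis (no_types, lifting))

lemma abs_weight_le_1: "0 \<le> t \<Longrightarrow> t \<le> 1 \<Longrightarrow> \<bar>weight t p\<bar> \<le> 1"
  by (auto simp: weight_def power_le_one)

lemma weight_nonzero_coeff_bound:
  assumes "weight t (monic_poly d a) \<noteq> 0" "1 \<le> i" "i \<le> d"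
  shows "\<bar>a i\<bar> \<le> 2 ^ d"
proof -
  have "cmod (coeff (monic_poly d a) (d - i)) \<le> 2 ^ degree (monic_poly d a)"
    using monic_disc_bounds[OF _ weight_nonzeroD[OF assms(1)]] by simp
  moreover have "d - i \<noteq> d" "d - i < d" "d - (d - i) = i" using assms(2,3) by auto
  ultimately show ?thesis by (simp add: coeff_monic_poly)
qed

text \<open>Products of values at a list of points. The recursion maps such an integrand to one with
  two more points.\<close>

definition evals :: "complex list \<Rightarrow> complex poly \<Rightarrow> complex" where
  "evals pts m = (\<Prod>z\<leftarrow>pts. poly m z)"

lemma evals_mult: "evals pts (p * q) = evals pts p * evals pts q"
  by (induction pts) (simp_all add: evals_def mult_ac)

lemma evals_append: "evals (xs @ ys) p = evals xs p * evals ys p"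
  by (simp add: evals_def)

lemma evals_pair: "evals [root_minus u w, root_plus u w] m = quad_resultant u w m"
  by (simp add: evals_def quad_resultant_def)

lemma measurable_evals:
  assumes "\<And>i. i \<in> {1..d} \<Longrightarrow> (\<lambda>x. h x i) \<in> borel_measurable M"
  shows "(\<lambda>x. evals pts (monic_poly d (h x))) \<in> borel_measurable M"
  by (induction pts) (use measurable_poly_monic_poly[OF assms] in \<open>auto simp: evals_def\<close>)

definition evals_bound :: "complex list \<Rightarrow> nat \<Rightarrow> real" where
  "evals_bound pts d = (\<Prod>z\<leftarrow>pts. (1 + cmod z) ^ d)"

lemma evals_le_bound:
  assumes "weight t (monic_poly d a) \<noteq> 0"
  shows "cmod (evals pts (monic_poly d a)) \<le> evals_bound pts d"
proof (induction pts)
  case (Cons z pts)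
  have "cmod (poly (monic_poly d a) z) \<le> (1 + cmod z) ^ d"
    using monic_disc_bounds[OF _ weight_nonzeroD[OF assms]] by simp
  then have "cmod (poly (monic_poly d a) z) * cmod (evals pts (monic_poly d a))
      \<le> (1 + cmod z) ^ d * evals_bound pts d"
    by (intro mult_mono) (use Cons in auto)
  then show ?case by (simp add: evals_def evals_bound_def norm_mult)
qed (simp add: evals_def evals_bound_def)

lemma evals_bound_nonneg: "0 \<le> evals_bound pts d"
  unfolding evals_bound_def by (induction pts) auto

definition weighted_integral :: "real \<Rightarrow> nat \<Rightarrow> complex list \<Rightarrow> complex" where
  "weighted_integral t d pts =
     (\<integral>a. of_real (weight t (monic_poly d a)) * evals pts (monic_poly d a) \<partial>coeff_space d)"

lemma emeasure_box_coeff_space: "emeasure (coeff_space d) (Pi\<^sub>E {1..d} (\<lambda>_. {-B..B})) < \<infinity>"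
  by (subst lborel_family.emeasure_PiM) (auto simp: power_less_top_ennreal emeasure_lborel_Icc_eq)

lemma emeasure_square: "emeasure plane ({-B..B::real} \<times> {-C..C::real}) < \<infinity>"
  by (subst lborel.emeasure_pair_measure_Times) (auto simp: ennreal_mult_less_top emeasure_lborel_Icc_eq)

lemma integrable_plane_bounded:
  fixes f :: "real \<times> real \<Rightarrow> 'b::{banach, second_countable_topology}"
  assumes "f \<in> borel_measurable plane"
    and "\<And>u w. f (u, w) \<noteq> 0 \<Longrightarrow> \<bar>u\<bar> \<le> C \<and> \<bar>w\<bar> \<le> C" and "\<And>v. norm (f v) \<le> K"
  shows "integrable plane f"
proof (rule integrableI_bounded_set)
  show "emeasure plane ({-C..C} \<times> {-C..C}) < \<infinity>" by (rule emeasure_square)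
  have "f v = 0" if "v \<notin> {-C..C} \<times> {-C..C}" for v
    using assms(2)[of "fst v" "snd v"] that by (cases "f v = 0") (auto simp: mem_Times_iff abs_le_iff)
  then show "AE v in plane. v \<notin> {-C..C} \<times> {-C..C} \<longrightarrow> f v = 0" by (intro AE_I2) blast
  show "AE v in plane. v \<in> {-C..C} \<times> {-C..C} \<longrightarrow> norm (f v) \<le> K"
    using assms(3) by (intro AE_I2) auto
qed (use assms(1) in auto)

lemma integrable_coeff_plane_bounded:
  fixes f :: "(nat \<Rightarrow> real) \<Rightarrow> real \<times> real \<Rightarrow> 'b::{banach, second_countable_topology}"
  assumes meas: "case_prod f \<in> borel_measurable (coeff_space N \<Otimes>\<^sub>M plane)"
    and supp1: "\<And>a v i. f a v \<noteq> 0 \<Longrightarrow> i \<in> {1..N} \<Longrightarrow> \<bar>a i\<bar> \<le> B"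
    and supp2: "\<And>a u w. f a (u, w) \<noteq> 0 \<Longrightarrow> \<bar>u\<bar> \<le> C \<and> \<bar>w\<bar> \<le> C"
    and bound: "\<And>a v. norm (f a v) \<le> K"
  shows "integrable (coeff_space N \<Otimes>\<^sub>M plane) (case_prod f)"
    and "a \<in> space (coeff_space N) \<Longrightarrow> integrable plane (f a)"
proof -
  show "a \<in> space (coeff_space N) \<Longrightarrow> integrable plane (f a)"
    using measurable_compose[OF measurable_Pair1' meas] supp2 bound
    by (intro integrable_plane_bounded[where C = C and K = K]) auto
  let ?A = "Pi\<^sub>E {1..N} (\<lambda>_. {-B..B})" and ?S = "{-C..C} \<times> {-C..C}"
  have A: "?A \<in> sets (coeff_space N)" "?S \<in> sets plane"
    by (auto intro!: sets_PiM_I_finite)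
  have sf: "sigma_finite_measure plane"
    unfolding lborel_prod by standard
  show "integrable (coeff_space N \<Otimes>\<^sub>M plane) (case_prod f)"
  proof (rule integrableI_bounded_set)
    show "?A \<times> ?S \<in> sets (coeff_space N \<Otimes>\<^sub>M plane)" by (rule pair_measureI[OF A])
    show "emeasure (coeff_space N \<Otimes>\<^sub>M plane) (?A \<times> ?S) < \<infinity>"
      unfolding sigma_finite_measure.emeasure_pair_measure_Times[OF sf A]
      using emeasure_box_coeff_space[of N B] emeasure_square[of C C] by (simp add: ennreal_mult_less_top)
    show "AE z in coeff_space N \<Otimes>\<^sub>M plane. z \<notin> ?A \<times> ?S \<longrightarrow> case_prod f z = 0"
    proof (intro AE_I2 impI)
      fix z assume sp: "z \<in> space (coeff_space N \<Otimes>\<^sub>M plane)" and nA: "z \<notin> ?A \<times> ?S"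
      obtain a u w where z: "z = (a, u, w)" by (metis prod.exhaust)
      show "case_prod f z = 0"
      proof (rule ccontr)
        assume "case_prod f z \<noteq> 0"
        then have nz: "f a (u, w) \<noteq> 0" by (simp add: z)
        have "a i \<in> {-B..B}" if "i \<in> {1..N}" for i
          using supp1[OF nz that] by (simp add: abs_le_iff minus_le_iff)
        then have "a \<in> ?A" using sp by (auto simp: z space_pair_measure space_PiM PiE_def)
        then show False using nA supp2[OF nz] by (simp add: z abs_le_iff minus_le_iff)
      qed
    qed
    show "AE z in coeff_space N \<Otimes>\<^sub>M plane. z \<in> ?A \<times> ?S \<longrightarrow> norm (case_prod f z) \<le> K"
      using bound by (intro AE_I2) auto
  qed (rule meas)
qed

text \<open>Complex integrands are needed because the evaluation points are complex.\<close>

lemma degree_formula_last: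
  fixes H :: "real \<times> real \<Rightarrow> complex"
  assumes H: "integrable plane H"
    and HJ: "integrable plane (\<lambda>v. of_real (jacobian_last N a v) * H (last_coeffs N a v))"
  shows "(\<integral>v. of_real (jacobian_last N a v) * H (last_coeffs N a v) \<partial>plane)
     = of_nat (Suc (Suc N) div 2) * (\<integral>c. H c \<partial>plane)"
proof (rule complex_eqI)
  have re: "integrable plane (\<lambda>v. jacobian_last N a v * Re (H (last_coeffs N a v)))"
    using integrable_Re[OF HJ] by simp
  have im: "integrable plane (\<lambda>v. jacobian_last N a v * Im (H (last_coeffs N a v)))"
    using integrable_Im[OF HJ] by simp
  show "Re (\<integral>v. of_real (jacobian_last N a v) * H (last_coeffs N a v) \<partial>plane)
     = Re (of_nat (Suc (Suc N) div 2) * (\<integral>c. H c \<partial>plane))"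
    using degree_formula_last_real[OF integrable_Re[OF H] re]
    by (simp add: integral_Re[OF HJ, symmetric] integral_Re[OF H, symmetric])
  show "Im (\<integral>v. of_real (jacobian_last N a v) * H (last_coeffs N a v) \<partial>plane)
     = Im (of_nat (Suc (Suc N) div 2) * (\<integral>c. H c \<partial>plane))"
    using degree_formula_last_real[OF integrable_Im[OF H] im]
    by (simp add: integral_Im[OF HJ, symmetric] integral_Im[OF H, symmetric])
qed

lemma measurable_last_coeffs_jacobian:
  shows "(\<lambda>(a, v). last_coeffs N a v) \<in> coeff_space N \<Otimes>\<^sub>M plane \<rightarrow>\<^sub>M plane"
    and "(\<lambda>(a, v). jacobian_last N a v) \<in> borel_measurable (coeff_space N \<Otimes>\<^sub>M plane)"
proof -
  let ?M = "coeff_space N \<Otimes>\<^sub>M plane :: ((nat \<Rightarrow> real) \<times> (real \<times> real)) measure"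
  have u: "(\<lambda>z. fst (snd z)) \<in> borel_measurable ?M" and w: "(\<lambda>z. snd (snd z)) \<in> borel_measurable ?M"
    by simp_all
  have a: "(\<lambda>z. fst z i) \<in> borel_measurable ?M" if "1 \<le> i" "i < Suc N" for i
    by (rule measurable_compose[OF measurable_fst measurable_coeff]) (use that in auto)
  have q: "(\<lambda>z. quo (fst (snd z)) (snd (snd z)) (fst z) k) \<in> borel_measurable ?M" if "k \<le> Suc N" for k
    by (rule measurable_quo[OF u w a]) (use that in auto)
  have r: "(\<lambda>z. quo (fst (snd z)) (snd (snd z)) (\<lambda>k. quo (fst (snd z)) (snd (snd z)) (fst z) (Suc k)) k)
      \<in> borel_measurable ?M" if "k \<le> Suc N" for k
    by (rule measurable_quo[OF u w q]) (use that in auto)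
  show "(\<lambda>(a, v). last_coeffs N a v) \<in> ?M \<rightarrow>\<^sub>M plane"
    unfolding last_coeffs_def case_prod_unfold
    by (intro measurable_Pair) (use u w q[of N] q[of "Suc N"] in simp_all)
  show "(\<lambda>(a, v). jacobian_last N a v) \<in> borel_measurable ?M"
    unfolding jacobian_last_def case_prod_unfold quotient_poly_def quad_resultant_monic_poly Re_complex_of_real
    using u w r[of N] r[of "Suc N"] by simp
qed

text \<open>For a fixed quadratic factor the coefficients of the quotient are exchanged for the
  first coefficients of the product, which preserves measure. Then the integrals are interchanged,
  and for fixed first coefficients the degree formula exchanges the quadratic factor for the last
  two coefficients. The integrability statement is kept for later almost-everywhere changes of the
  integrand.\<close>

theorem weighted_integral_recursion:
  assumes t: "0 \<le> t" "t \<le> 1"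
  shows "of_nat (Suc (Suc N) div 2) * weighted_integral t (Suc (Suc N)) pts
    = (\<integral>(u, w). of_real (weight t (quad u w)) * evals pts (quad u w)
        * weighted_integral t N (pts @ [root_minus u w, root_plus u w]) \<partial>plane)"
    (is "_ = integral\<^sup>L _ ?R")
    and "integrable plane (\<lambda>(u, w). of_real (weight t (quad u w)) * evals pts (quad u w)
        * weighted_integral t N (pts @ [root_minus u w, root_plus u w]))"
proof -
  let ?W = plane
  let ?M = "coeff_space N"
  define d where "d = Suc (Suc N)"
  define H where "H = (\<lambda>a c. complex_of_real (weight t (monic_poly d (set_last N a c))) * evals pts (monic_poly d (set_last N a c)))"
  define \<Psi> where "\<Psi> = (\<lambda>a v. of_real (jacobian_last N a v) * H a (last_coeffs N a v))"
  have sfW: "sigma_finite_measure ?W" unfolding lborel_prod by standard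
  interpret MW: pair_sigma_finite ?M ?W
    using sfW sigma_finite_coeff_space by (simp add: pair_sigma_finite_def)

  have Hmeas: "case_prod H \<in> borel_measurable (?M \<Otimes>\<^sub>M ?W)"
  proof -
    have "(\<lambda>a. complex_of_real (weight t (monic_poly d a)) * evals pts (monic_poly d a)) \<in> borel_measurable (coeff_space d)"
      by (intro borel_measurable_times measurable_compose[OF measurable_weight_monic_poly] measurable_evals
          measurable_coeff) auto
    from measurable_compose[OF measurable_set_last this[unfolded d_def]]
    show ?thesis by (simp add: H_def case_prod_unfold d_def)
  qed
  have \<Psi>meas: "case_prod \<Psi> \<in> borel_measurable (?M \<Otimes>\<^sub>M ?W)"
  proof -
    have "(\<lambda>z. (fst z, (case z of (a, v) \<Rightarrow> last_coeffs N a v))) \<in> ?M \<Otimes>\<^sub>M ?W \<rightarrow>\<^sub>M ?M \<Otimes>\<^sub>M ?W"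
      by (intro measurable_Pair measurable_fst measurable_last_coeffs_jacobian(1))
    from measurable_compose[OF this Hmeas] measurable_last_coeffs_jacobian(2)
    show ?thesis by (simp add: \<Psi>_def case_prod_unfold)
  qed

  define B where "B = (2::real) ^ d"
  have H0: "weight t (monic_poly d (set_last N a c)) \<noteq> 0" if "H a c \<noteq> 0" for a c
    using that by (auto simp: H_def)
  have Hbound: "cmod (H a c) \<le> evals_bound pts d" for a c
  proof (cases "H a c = 0")
    case False
    have "cmod (H a c) \<le> 1 * evals_bound pts d"
      unfolding H_def norm_mult using abs_weight_le_1[OF t] evals_le_bound[OF H0[OF False]]
      by (intro mult_mono) auto
    then show ?thesis by simp
  qed (simp add: evals_bound_nonneg)
  have Hsupp: "c \<in> {-B..B} \<times> {-B..B}" "i \<in> {1..N} \<Longrightarrow> \<bar>a i\<bar> \<le> B" if "H a c \<noteq> 0" for a c i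
  proof -
    note bd = weight_nonzero_coeff_bound[OF H0[OF that], folded B_def]
    show "i \<in> {1..N} \<Longrightarrow> \<bar>a i\<bar> \<le> B"
      using bd[of i] by (auto simp: set_last_def d_def split: prod.splits)
    show "c \<in> {-B..B} \<times> {-B..B}"
      using bd[of "Suc N"] bd[of "Suc (Suc N)"] by (cases c) (auto simp: set_last_def d_def abs_le_iff)
  qed
  \<comment> \<open>By this factorization \<open>\<Psi>\<close> is supported where both factors have
    their roots in the disc.\<close>
  have quot: "monic_poly d (set_last N a (last_coeffs N a (u, w))) = quad u w * quotient_poly N a u w" for a u w
    unfolding d_def monic_poly_set_last[of N a _ u w] by simp
  have \<Psi>supp: "u \<in> {-4..4} \<and> w \<in> {-4..4} \<and> cmod (\<Psi> a (u, w)) \<le> 4 ^ N * evals_bound pts d"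
    if "\<Psi> a (u, w) \<noteq> 0" for a u w
  proof -
    have "H a (last_coeffs N a (u, w)) \<noteq> 0" using that by (simp add: \<Psi>_def)
    from weight_nonzeroD[OF H0[OF this]]
    have rt: "cmod \<xi> < 1" if "poly (quad u w) \<xi> = 0 \<or> poly (quotient_poly N a u w) \<xi> = 0" for \<xi>
      using that unfolding quot by auto
    have "cmod (coeff (quad u w) n) \<le> 2 ^ degree (quad u w)" for n
      by (rule monic_disc_bounds[THEN conjunct1]) (use rt in \<open>auto simp: quad_def\<close>)
    then have "cmod (coeff (quad u w) n) \<le> 4" for n by (simp add: quad_def)
    from this[of 0] this[of 1] have uw: "u \<in> {-4..4}" "w \<in> {-4..4}"
      by (auto simp: quad_def abs_le_iff)
    have qb: "cmod (poly (quotient_poly N a u w) \<xi>) \<le> 2 ^ N" if "poly (quad u w) \<xi> = 0" for \<xi>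
    proof -
      have "cmod (poly (quotient_poly N a u w) \<xi>) \<le> (1 + cmod \<xi>) ^ degree (quotient_poly N a u w)"
        by (rule monic_disc_bounds[THEN conjunct2]) (use rt in \<open>auto simp: quotient_poly_def\<close>)
      also have "\<dots> \<le> 2 ^ N"
        using rt[of \<xi>] that by (auto simp: quotient_poly_def intro!: power_mono)
      finally show ?thesis .
    qed
    have "\<bar>jacobian_last N a (u, w)\<bar> = cmod (quad_resultant u w (quotient_poly N a u w))"
      by (simp only: of_real_jacobian_last[symmetric] norm_of_real)
    also have "\<dots> \<le> 2 ^ N * 2 ^ N"
      unfolding quad_resultant_def norm_mult
      by (intro mult_mono qb) (auto simp: poly_quad_eq_0_iff)
    finally have jb: "\<bar>jacobian_last N a (u, w)\<bar> \<le> 4 ^ N"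
      by (simp add: power_mult_distrib[symmetric])
    have "cmod (\<Psi> a (u, w)) = \<bar>jacobian_last N a (u, w)\<bar> * cmod (H a (last_coeffs N a (u, w)))"
      by (simp add: \<Psi>_def norm_mult)
    also have "\<dots> \<le> 4 ^ N * evals_bound pts d"
      by (intro mult_mono jb Hbound) auto
    finally show ?thesis using uw by simp
  qed

  have \<Psi>bound: "cmod (\<Psi> a v) \<le> 4 ^ N * evals_bound pts d" for a v
    using \<Psi>supp[of a "fst v" "snd v"] evals_bound_nonneg[of pts d] by (cases "\<Psi> a v = 0") auto
  have \<Psi>supp1: "\<bar>a i\<bar> \<le> B" if "\<Psi> a v \<noteq> 0" "i \<in> {1..N}" for a v i
    using Hsupp(2)[OF _ that(2), of a "last_coeffs N a v"] that(1) by (auto simp: \<Psi>_def)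
  have \<Psi>supp2: "\<bar>u\<bar> \<le> 4 \<and> \<bar>w\<bar> \<le> 4" if "\<Psi> a (u, w) \<noteq> 0" for a u w
    using \<Psi>supp[OF that] by (simp add: abs_le_iff)
  have Hsupp2: "\<bar>u\<bar> \<le> B \<and> \<bar>w\<bar> \<le> B" if "H a (u, w) \<noteq> 0" for a u w
    using Hsupp(1)[OF that] by (simp add: abs_le_iff)
  have int\<Psi>: "integrable (?M \<Otimes>\<^sub>M ?W) (case_prod \<Psi>)"
    "\<And>a. a \<in> space ?M \<Longrightarrow> integrable ?W (\<Psi> a)"
    by (rule integrable_coeff_plane_bounded[where C = 4 and B = B and K = "4 ^ N * evals_bound pts d", OF \<Psi>meas],
        (use \<Psi>supp1 \<Psi>supp2 \<Psi>bound in blast)+)+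
  have intH: "integrable (?M \<Otimes>\<^sub>M ?W) (case_prod H)"
    "\<And>a. a \<in> space ?M \<Longrightarrow> integrable ?W (H a)"
    by (rule integrable_coeff_plane_bounded[where C = B and B = B and K = "evals_bound pts d", OF Hmeas],
        (use Hsupp(2) Hsupp2 Hbound in blast)+)+

  have R: "?R = (\<lambda>v. \<integral>a. \<Psi> a v \<partial>?M)"
  proof
    fix v :: "real \<times> real"
    obtain u w where v: "v = (u, w)" by (metis prod.exhaust)
    let ?pts = "pts @ [root_minus u w, root_plus u w]"
    let ?F = "\<lambda>b. of_real (weight t (quad u w)) * evals pts (quad u w)
        * (of_real (weight t (monic_poly N b)) * evals ?pts (monic_poly N b))"
    have Fmeas: "?F \<in> borel_measurable ?M"
      by (intro borel_measurable_times borel_measurable_const measurable_compose[OF measurable_weight_monic_poly]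
          measurable_evals measurable_coeff) auto
    have "?R v = (\<integral>b. ?F b \<partial>?M)"
      unfolding weighted_integral_def v by simp
    also have "\<dots> = (\<integral>a. ?F (quo_map N u w a) \<partial>?M)"
      by (rule integral_quo_map[OF Fmeas, symmetric])
    also have "\<dots> = (\<integral>a. \<Psi> a v \<partial>?M)"
    proof (rule Bochner_Integration.integral_cong[OF refl])
      fix a
      have m: "monic_poly N (quo_map N u w a) = quotient_poly N a u w"
        unfolding quotient_poly_def by (rule monic_poly_cong) (simp add: quo_map_def)
      have q0: "quotient_poly N a u w \<noteq> 0" by (simp add: quotient_poly_def)
      show "?F (quo_map N u w a) = \<Psi> a v"
        unfolding m v \<Psi>_def H_def quot weight_mult[OF quad_nonzero q0] evals_mult evals_append evals_pair
          of_real_jacobian_last by simp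
    qed
    finally show "?R v = (\<integral>a. \<Psi> a v \<partial>?M)" .
  qed
  show "integrable ?W ?R"
    unfolding R by (rule MW.integrable_snd[OF int\<Psi>(1)])
  have "integral\<^sup>L ?W ?R = (\<integral>a. (\<integral>v. \<Psi> a v \<partial>?W) \<partial>?M)"
    unfolding R
    by (rule MW.Fubini_integral[OF int\<Psi>(1)])
  also have "\<dots> = (\<integral>a. of_nat (d div 2) * (\<integral>c. H a c \<partial>?W) \<partial>?M)"
  proof (rule Bochner_Integration.integral_cong[OF refl])
    fix a assume a: "a \<in> space ?M"
    show "(\<integral>v. \<Psi> a v \<partial>?W) = of_nat (d div 2) * (\<integral>c. H a c \<partial>?W)"
      using degree_formula_last[OF intH(2)[OF a], of N a] int\<Psi>(2)[OF a] unfolding \<Psi>_def d_def by blast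
  qed
  also have "\<dots> = of_nat (d div 2) * (\<integral>z. case_prod H z \<partial>(?M \<Otimes>\<^sub>M ?W))"
    using MW.integral_fst'[OF intH(1)] by simp
  also have "(\<integral>z. case_prod H z \<partial>(?M \<Otimes>\<^sub>M ?W)) = weighted_integral t d pts"
  proof -
    have meas: "(\<lambda>a. complex_of_real (weight t (monic_poly d a)) * evals pts (monic_poly d a)) \<in> borel_measurable (coeff_space d)"
      by (intro borel_measurable_times measurable_compose[OF measurable_weight_monic_poly] measurable_evals
          measurable_coeff) auto
    have "weighted_integral t d pts = (\<integral>z. complex_of_real (weight t (monic_poly d (case z of (a, c) \<Rightarrow> set_last N a c)))
        * evals pts (monic_poly d (case z of (a, c) \<Rightarrow> set_last N a c)) \<partial>(?M \<Otimes>\<^sub>M ?W))"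
      unfolding weighted_integral_def
      using integral_distr[OF measurable_set_last meas[unfolded d_def]] unfolding distr_set_last d_def .
    also have "\<dots> = (\<integral>z. case_prod H z \<partial>(?M \<Otimes>\<^sub>M ?W))"
      by (rule Bochner_Integration.integral_cong) (auto simp: H_def)
    finally show ?thesis by simp
  qed
  finally show "of_nat (Suc (Suc N) div 2) * weighted_integral t (Suc (Suc N)) pts = integral\<^sup>L ?W ?R"
    by (simp add: d_def)
qed

section \<open>Alternating sums over permutations\<close>

definition alt_sum :: "nat \<Rightarrow> ((nat \<Rightarrow> nat) \<Rightarrow> complex) \<Rightarrow> complex" where
  "alt_sum L F = (\<Sum>\<pi> | \<pi> permutes {..<L}. of_int (sign \<pi>) * F \<pi>)"

lemma alt_sum_cong: "(\<And>\<pi>. \<pi> permutes {..<L} \<Longrightarrow> F \<pi> = G \<pi>) \<Longrightarrow> alt_sum L F = alt_sum L G"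
  unfolding alt_sum_def by (rule sum.cong) auto

lemma alt_sum_swap:
  assumes "a < L" "b < L" "a \<noteq> b"
  shows "alt_sum L (\<lambda>\<pi>. F (\<pi> \<circ> Transposition.transpose a b)) = - alt_sum L F"
proof -
  let ?q = "Transposition.transpose a b"
  have q: "?q permutes {..<L}" using assms by (intro permutes_swap_id) auto
  have "alt_sum L F = (\<Sum>\<pi> | \<pi> permutes {..<L}. of_int (sign (\<pi> \<circ> ?q)) * F (\<pi> \<circ> ?q))"
    unfolding alt_sum_def by (rule sum_permutations_compose_right[OF q])
  also have "\<dots> = (\<Sum>\<pi> | \<pi> permutes {..<L}. - (of_int (sign \<pi>) * F (\<pi> \<circ> ?q)))"
  proof (rule sum.cong[OF refl])
    fix \<pi> assume "\<pi> \<in> {\<pi>. \<pi> permutes {..<L}}"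
    then have "permutation \<pi>" "permutation ?q"
      using q by (auto intro: permutation_permutes[THEN iffD2])
    then show "of_int (sign (\<pi> \<circ> ?q)) * F (\<pi> \<circ> ?q) = - (of_int (sign \<pi>) * F (\<pi> \<circ> ?q))"
      using assms(3) by (simp add: sign_compose sign_swap_id)
  qed
  finally show ?thesis by (simp add: alt_sum_def sum_negf)
qed

lemma alt_sum_symmetric_0:
  assumes "a < L" "b < L" "a \<noteq> b"
    and "\<And>\<pi>. \<pi> permutes {..<L} \<Longrightarrow> F (\<pi> \<circ> Transposition.transpose a b) = F \<pi>"
  shows "alt_sum L F = 0"
proof -
  have "alt_sum L F = - alt_sum L F"
    using alt_sum_swap[OF assms(1-3), of F] alt_sum_cong[OF assms(4)] by simp
  then show ?thesis by simp
qed

lemma alt_sum_powers_not_inj: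
  assumes "a < n" "b < n" "a \<noteq> b" "x a = x b"
  shows "alt_sum n (\<lambda>\<pi>. \<Prod>i<n. x i ^ \<pi> i) = 0"
proof (rule alt_sum_symmetric_0[OF assms(1-3)])
  fix \<pi>
  let ?q = "Transposition.transpose a b"
  have xq: "x (?q i) = x i" for i using assms(4) by (simp add: Transposition.transpose_def)
  have "(\<Prod>i<n. x i ^ (\<pi> \<circ> ?q) i) = (\<Prod>i<n. x (?q i) ^ \<pi> (?q i))" by (simp add: xq)
  also have "\<dots> = (\<Prod>i<n. x i ^ \<pi> i)"
    by (rule prod.permute[of ?q "{..<n}" "\<lambda>i. x i ^ \<pi> i", unfolded comp_def, symmetric])
       (use assms in \<open>auto intro: permutes_swap_id\<close>)
  finally show "(\<Prod>i<n. x i ^ (\<pi> \<circ> ?q) i) = (\<Prod>i<n. x i ^ \<pi> i)" .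
qed

text \<open>For distinct points, the alternating sum, as a polynomial in the last point, has degree
  at most \<open>n\<close>, vanishes at the other \<open>n\<close> points, and has as leading
  coefficient the alternating sum for one point less.\<close>

theorem vandermonde:
  "alt_sum n (\<lambda>\<pi>. \<Prod>i<n. x i ^ \<pi> i) = (\<Prod>j<n. \<Prod>i<j. x j - x i)"
proof (induction n)
  case 0
  then show ?case by (simp add: alt_sum_def)
next
  case (Suc n)
  show ?case
  proof (cases "inj_on x {..<Suc n}")
    case False
    then obtain a b where ab: "a < Suc n" "b < Suc n" "a < b" "x a = x b"
      unfolding inj_on_def by (metis lessThan_iff linorder_neqE_nat)
    have "(\<Prod>i<b. x b - x i) = 0" using ab by (intro prod_zero bexI[of _ a]) auto
    then have "(\<Prod>j<Suc n. \<Prod>i<j. x j - x i) = 0"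
      using ab(2) prod_zero[of "{..<Suc n}" "\<lambda>j. \<Prod>i<j. x j - x i"] by (auto simp del: prod_zero_iff)
    then show ?thesis using alt_sum_powers_not_inj[of a "Suc n" b x] ab by simp
  next
    case True
    define Q where "Q = (\<Sum>\<pi> | \<pi> permutes {..<Suc n}. monom (of_int (sign \<pi>) * (\<Prod>i<n. x i ^ \<pi> i)) (\<pi> n))"
    have poly_Q: "poly Q z = alt_sum (Suc n) (\<lambda>\<pi>. \<Prod>i<Suc n. (x(n := z)) i ^ \<pi> i)" for z
      unfolding Q_def alt_sum_def by (simp add: poly_sum poly_monom mult.assoc)
    have degQ: "degree Q \<le> n"
      unfolding Q_def
    proof (rule degree_sum_le)
      show "finite {\<pi>. \<pi> permutes {..<Suc n}}" by (rule finite_permutations) simp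
      fix \<pi> assume "\<pi> \<in> {\<pi>. \<pi> permutes {..<Suc n}}"
      then have "\<pi> n < Suc n" using permutes_in_image[of \<pi> "{..<Suc n}" n] by auto
      then show "degree (monom (of_int (sign \<pi>) * (\<Prod>i<n. x i ^ \<pi> i)) (\<pi> n)) \<le> n"
        by (meson degree_monom_le le_trans less_Suc_eq_le)
    qed
    have "coeff Q n = (\<Sum>\<pi> | \<pi> permutes {..<Suc n}. if \<pi> n = n then of_int (sign \<pi>) * (\<Prod>i<n. x i ^ \<pi> i) else 0)"
      unfolding Q_def coeff_sum by simp
    also have "\<dots> = (\<Sum>\<pi> \<in> {\<pi>. \<pi> permutes {..<Suc n} \<and> \<pi> n = n}. of_int (sign \<pi>) * (\<Prod>i<n. x i ^ \<pi> i))"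
      by (simp add: sum.inter_filter[symmetric] finite_permutations)
    also have "{\<pi>. \<pi> permutes {..<Suc n} \<and> \<pi> n = n} = {\<pi>. \<pi> permutes {..<n}}"
      by (auto simp: lessThan_Suc permutes_insert intro: permutes_superset permutes_subset permutes_not_in)
    finally have coefQ: "coeff Q n = (\<Prod>j<n. \<Prod>i<j. x j - x i)"
      using Suc.IH by (simp add: alt_sum_def)
    define T where "T = Polynomial.smult (coeff Q n) (\<Prod>i<n. [:- x i, 1:])"
    \<comment> \<open>Equal leading coefficients and \<open>n\<close> common roots determine a
      polynomial of degree at most \<open>n\<close>.\<close>
    have "Q = T"
    proof (rule poly_eqI_degree_lead_coeff)
      have deg: "degree (\<Prod>i<n. [:- x i, 1:]) = n" by (subst degree_prod_sum_eq) auto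
      have "lead_coeff (\<Prod>i<n. [:- x i, 1:]) = 1" by (simp add: lead_coeff_prod)
      then show "coeff Q n = coeff T n" using deg by (simp add: T_def)
      show "degree T \<le> n" unfolding T_def by (rule le_trans[OF degree_smult_le]) (simp add: deg)
      show "n \<le> card (x ` {..<n})"
      proof -
        have "inj_on x {..<n}" by (rule inj_on_subset[OF True]) auto
        then show ?thesis by (simp add: card_image)
      qed
      show "poly Q z = poly T z" if z: "z \<in> x ` {..<n}" for z
      proof -
        obtain i where i: "i < n" "z = x i" using z by auto
        have "poly Q z = 0" unfolding poly_Q
          by (rule alt_sum_powers_not_inj[of i _ n]) (use i in auto)
        moreover have "poly T z = 0" using i by (auto simp: T_def poly_prod)
        ultimately show ?thesis by simp
      qed
    qed (rule degQ)
    then have "poly Q (x n) = (\<Prod>j<n. \<Prod>i<j. x j - x i) * (\<Prod>i<n. x n - x i)"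
      by (simp add: T_def coefQ poly_prod)
    then show ?thesis unfolding poly_Q by simp
  qed
qed

definition vand :: "complex list \<Rightarrow> complex" where
  "vand xs = (\<Prod>j<length xs. \<Prod>i<j. xs ! j - xs ! i)"

lemma vand_Nil [simp]: "vand [] = 1"
  by (simp add: vand_def)

lemma vand_snoc: "vand (xs @ [x]) = vand xs * (\<Prod>z\<leftarrow>xs. x - z)"
proof -
  have "vand (xs @ [x]) = (\<Prod>j<length xs. \<Prod>i<j. (xs @ [x]) ! j - (xs @ [x]) ! i)
      * (\<Prod>i<length xs. x - (xs @ [x]) ! i)"
    by (simp add: vand_def)
  also have "(\<Prod>j<length xs. \<Prod>i<j. (xs @ [x]) ! j - (xs @ [x]) ! i) = vand xs"
    unfolding vand_def by (intro prod.cong refl) (simp add: nth_append)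
  also have "(\<Prod>i<length xs. x - (xs @ [x]) ! i) = (\<Prod>z\<leftarrow>xs. x - z)"
    by (simp add: prod.list_conv_set_nth nth_append atLeast0LessThan)
  finally show ?thesis .
qed

lemma vand_eq_alt_sum: "vand xs = alt_sum (length xs) (\<lambda>\<pi>. \<Prod>i<length xs. xs ! i ^ \<pi> i)"
  unfolding vand_def vandermonde ..

text \<open>Two further points that are the roots of a quadratic polynomial contribute its values at
  the old points and the difference of its roots. The former appear in the recursion for the
  weighted integral.\<close>

lemma vand_append_roots:
  "vand (xs @ [root_minus u w, root_plus u w])
    = vand xs * evals xs (quad u w) * (root_plus u w - root_minus u w)"
proof -
  have "(\<Prod>z\<leftarrow>xs. root_minus u w - z) * (\<Prod>z\<leftarrow>xs. root_plus u w - z) = evals xs (quad u w)"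
  proof (induction xs)
    case (Cons z xs)
    have "poly (quad u w) z = (root_minus u w - z) * (root_plus u w - z)"
      unfolding quad_factor by (simp add: algebra_simps)
    with Cons show ?case by (simp add: evals_def mult_ac)
  qed (simp add: evals_def)
  then show ?thesis
    using vand_snoc[of "xs @ [root_minus u w]" "root_plus u w"] vand_snoc[of xs "root_minus u w"]
    by (simp add: mult_ac)
qed

section \<open>The moments of the root domains of degree two\<close>

text \<open>The polynomial \<open>(\<beta>\<^sup>m - \<alpha>\<^sup>m) / (\<beta> -
  \<alpha>)\<close> in the coefficients of the quadratic polynomial with roots
  \<open>\<alpha>\<close> and \<open>\<beta>\<close>.\<close>

fun root_diff :: "nat \<Rightarrow> real \<Rightarrow> real \<Rightarrow> real" where
  "root_diff 0 u w = 0"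
| "root_diff (Suc 0) u w = 1"
| "root_diff (Suc (Suc m)) u w = - u * root_diff (Suc m) u w - w * root_diff m u w"

fun root_power_sum :: "nat \<Rightarrow> real \<Rightarrow> real \<Rightarrow> real" where
  "root_power_sum 0 u w = 2"
| "root_power_sum (Suc 0) u w = - u"
| "root_power_sum (Suc (Suc m)) u w = - u * root_power_sum (Suc m) u w - w * root_power_sum m u w"

lemma of_real_root_diff:
  "of_real (root_diff m u w) * (root_plus u w - root_minus u w) = root_plus u w ^ m - root_minus u w ^ m"
proof (induction m rule: induct_nat_012)
  case (ge2 m)
  define x y where "x = root_minus u w" and "y = root_plus u w"
  have u: "- complex_of_real u = x + y" and w: "complex_of_real w = x * y"
    using roots_quad[of u w] by (simp_all add: x_def y_def)
  have "of_real (root_diff (Suc (Suc m)) u w) * (y - x)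
      = (x + y) * (of_real (root_diff (Suc m) u w) * (y - x)) - x * y * (of_real (root_diff m u w) * (y - x))"
    unfolding u[symmetric] w[symmetric] by (simp add: algebra_simps)
  also have "\<dots> = (x + y) * (y ^ Suc m - x ^ Suc m) - x * y * (y ^ m - x ^ m)"
    using ge2 unfolding x_def y_def by simp
  also have "\<dots> = y ^ Suc (Suc m) - x ^ Suc (Suc m)" by (simp add: algebra_simps)
  finally show ?case by (simp add: x_def y_def)
qed auto

lemma root_power_sum_Suc: "root_power_sum (Suc m) u w = - u * root_diff (Suc m) u w - 2 * w * root_diff m u w"
proof (induction m rule: induct_nat_012)
  case (ge2 m)
  have "root_power_sum (Suc (Suc (Suc m))) u w
      = - u * root_power_sum (Suc (Suc m)) u w - w * root_power_sum (Suc m) u w"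
    by (rule root_power_sum.simps(3))
  also have "\<dots> = - u * root_diff (Suc (Suc (Suc m))) u w - 2 * w * root_diff (Suc (Suc m)) u w"
    unfolding ge2 by (simp add: algebra_simps)
  finally show ?case .
qed simp_all

text \<open>The power sums provide antiderivatives, so that the moments need no trigonometric
  functions.\<close>

lemma root_power_sum_deriv:
  "((\<lambda>u. root_power_sum m u w) has_real_derivative - real m * root_diff m u w) (at u)"
proof (induction m rule: induct_nat_012)
  case (ge2 m)
  have "((\<lambda>u. - u * root_power_sum (Suc m) u w - w * root_power_sum m u w) has_real_derivative
      (- 1 * root_power_sum (Suc m) u w + (- real (Suc m) * root_diff (Suc m) u w) * - u
        - w * (- real m * root_diff m u w))) (at u)"
    by (intro derivative_intros ge2 DERIV_mult DERIV_cmult)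
  moreover have "- 1 * root_power_sum (Suc m) u w + (- real (Suc m) * root_diff (Suc m) u w) * - u
        - w * (- real m * root_diff m u w) = - real (Suc (Suc m)) * root_diff (Suc (Suc m)) u w"
    unfolding root_power_sum_Suc by (simp add: algebra_simps)
  ultimately show ?case by (simp only: root_power_sum.simps(3))
qed (auto intro!: derivative_eq_intros)

lemma root_power_sum_triangle:
  "root_power_sum m (- (1 + w)) w = 1 + w ^ m" "root_power_sum m (1 + w) w = (- 1) ^ m * (1 + w ^ m)"
proof -
  show "root_power_sum m (- (1 + w)) w = 1 + w ^ m"
    by (induction m rule: induct_nat_012) (simp_all add: algebra_simps)
  show "root_power_sum m (1 + w) w = (- 1) ^ m * (1 + w ^ m)"
  proof (induction m rule: induct_nat_012)
    case (ge2 m)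
    show ?case unfolding root_power_sum.simps ge2 by (simp add: algebra_simps)
  qed simp_all
qed

lemma root_power_sum_parabola: "root_power_sum m (- 2 * s) (s\<^sup>2) = 2 * s ^ m"
  by (induction m rule: induct_nat_012) (simp_all add: algebra_simps power2_eq_square)

lemma continuous_root_diff: "isCont (\<lambda>u. root_diff m u w) u"
  by (induction m rule: induct_nat_012) (auto intro!: continuous_intros)

lemma measurable_root_diff: "(\<lambda>v. root_diff m (fst v) (snd v)) \<in> borel_measurable plane"
  by (induction m rule: induct_nat_012) auto

lemma integral_root_diff:
  assumes "a \<le> b" "m > 0"
  shows "(\<integral>u. root_diff m u w * indicator {a..b} u \<partial>lborel)
    = (root_power_sum m a w - root_power_sum m b w) / real m"
proof -
  have "(\<integral>u. root_diff m u w * indicator {a..b} u \<partial>lborel)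
      = - root_power_sum m b w / real m - (- root_power_sum m a w / real m)"
  proof (rule integral_FTC_Icc_real[OF assms(1)])
    show "((\<lambda>u. - root_power_sum m u w / real m) has_real_derivative root_diff m u w) (at u)" for u
      using root_power_sum_deriv[of m w u] assms(2) by (auto intro!: derivative_eq_intros)
  qed (rule continuous_root_diff)
  then show ?thesis using assms(2) by (simp add: diff_divide_distrib)
qed

definition unit_triangle :: "(real \<times> real) set" where
  "unit_triangle = {(u, w). \<bar>u\<bar> < 1 + w \<and> w < 1}"

definition conj_part :: "(real \<times> real) set" where
  "conj_part = {(u, w). u\<^sup>2 < 4 * w \<and> w < 1}"

text \<open>The quadratic polynomials with both roots in the unit disc form a triangle, and those
  with nonreal roots the part of it cut off by a parabola.\<close>

lemma weight_quad:
  "weight t (quad u w) = indicator unit_triangle (u, w) + (t - 1) * indicator conj_part (u, w)"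
proof (cases "u\<^sup>2 < 4 * w")
  case True
  define s where "s = sqrt (4 * w - u\<^sup>2)"
  have s: "s > 0" "s * s = 4 * w - u\<^sup>2" using True by (auto simp: s_def)
  define z where "z = Complex (- u / 2) (s / 2)"
  have "(cmod z)\<^sup>2 = (u / 2)\<^sup>2 + (s / 2)\<^sup>2" by (simp add: z_def cmod_power2)
  then have cz: "(cmod z)\<^sup>2 = w"
    using s(2) by (simp add: power2_eq_square field_simps)
  have "quad u w = quad (- 2 * Re z) ((cmod z)\<^sup>2)" by (simp only: cz) (simp add: z_def)
  then have q: "quad u w = [:- z, 1:] * [:- cnj z, 1:]" by (simp only: quad_cnj)
  have "weight t (quad u w) = weight t [:- z, 1:] * weight t [:- cnj z, 1:]"
    unfolding q by (rule weight_mult) simp_all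
  also have "\<dots> = (if cmod z < 1 then t else 0)"
    using s(1) unfolding weight_linear by (simp add: z_def)
  also have "cmod z < 1 \<longleftrightarrow> w < 1"
    unfolding cz[symmetric] by (simp add: abs_square_less_1)
  finally have wt: "weight t (quad u w) = (if w < 1 then t else 0)" .
  have "\<bar>u\<bar> < 1 + w"
  proof -
    have "4 * w \<le> (1 + w)\<^sup>2"
      using zero_le_power2[of "1 - w"] by (simp add: power2_eq_square algebra_simps)
    then have "\<bar>u\<bar>\<^sup>2 < (1 + w)\<^sup>2" using True by simp
    moreover have "w > 0" using True zero_le_power2[of u] by linarith
    ultimately show ?thesis using power2_less_imp_less[of "\<bar>u\<bar>" "1 + w"] by simp
  qed
  then show ?thesis using True wt by (simp add: unit_triangle_def conj_part_def)
next
  case False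
  define s where "s = sqrt (u\<^sup>2 - 4 * w)"
  have s: "s \<ge> 0" "s * s = u\<^sup>2 - 4 * w" using False by (auto simp: s_def)
  define x y where "x = (- u - s) / 2" and "y = (- u + s) / 2"
  have xy: "- (x + y) = u" "x * y = w"
    using s(2) by (simp_all add: x_def y_def field_simps power2_eq_square)
  have q: "quad u w = [:- of_real x, 1:] * [:- of_real y, 1:]"
    using quad_real[of x y] unfolding xy .
  have "weight t (quad u w) = weight t [:- of_real x, 1:] * weight t [:- of_real y, 1:]"
    unfolding q by (rule weight_mult) simp_all
  also have "\<dots> = (if \<bar>x\<bar> < 1 \<and> \<bar>y\<bar> < 1 then 1 else 0)"
    by (simp add: weight_linear)
  also have "\<bar>x\<bar> < 1 \<and> \<bar>y\<bar> < 1 \<longleftrightarrow> \<bar>u\<bar> < 1 + w \<and> w < 1"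
  proof
    assume A: "\<bar>x\<bar> < 1 \<and> \<bar>y\<bar> < 1"
    then have "1 - x > 0" "1 - y > 0" "1 + x > 0" "1 + y > 0" by linarith+
    then have "(1 - x) * (1 - y) > 0" "(1 + x) * (1 + y) > 0" by simp_all
    then have "\<bar>u\<bar> < 1 + w" by (simp add: xy(1)[symmetric] xy(2)[symmetric] algebra_simps abs_less_iff)
    moreover have "w < 1"
    proof -
      have "\<bar>x * y\<bar> < 1 * 1" unfolding abs_mult using A by (intro mult_strict_mono') auto
      then show ?thesis by (simp add: xy)
    qed
    ultimately show "\<bar>u\<bar> < 1 + w \<and> w < 1" by simp
  next
    assume A: "\<bar>u\<bar> < 1 + w \<and> w < 1"
    then have u2: "\<bar>u\<bar> < 2" by auto
    have "s * s < (2 - \<bar>u\<bar>) * (2 - \<bar>u\<bar>)"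
      using A by (simp add: s(2) power2_eq_square algebra_simps abs_if split: if_splits)
    then have "s < 2 - \<bar>u\<bar>" using u2 s(1) by (metis diff_gt_0_iff_gt less_imp_le mult_mono' not_less)
    then show "\<bar>x\<bar> < 1 \<and> \<bar>y\<bar> < 1" using s(1) by (auto simp: x_def y_def abs_if split: if_splits)
  qed
  finally show ?thesis using False by (simp add: unit_triangle_def conj_part_def)
qed

lemma sets_unit_triangle: "unit_triangle \<in> sets plane" and sets_conj_part: "conj_part \<in> sets plane"
proof -
  have "unit_triangle = {v. \<bar>fst v\<bar> < 1 + snd v \<and> snd v < 1}" "conj_part = {v. (fst v)\<^sup>2 < 4 * snd v \<and> snd v < 1}"
    by (auto simp: unit_triangle_def conj_part_def)
  moreover have "open {v::real\<times>real. \<bar>fst v\<bar> < 1 + snd v \<and> snd v < 1}" "open {v::real\<times>real. (fst v)\<^sup>2 < 4 * snd v \<and> snd v < 1}"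
    by (intro open_Collect_conj open_Collect_less continuous_intros)+
  ultimately show "unit_triangle \<in> sets plane" "conj_part \<in> sets plane"
    unfolding lborel_prod by simp_all
qed

lemma conj_part_subset: "conj_part \<subseteq> unit_triangle"
proof -
  have "\<bar>u\<bar> < 1 + w" if "u\<^sup>2 < 4 * w" "w < 1" for u w :: real
    using weight_quad[of 1 u w] weight_quad[of 2 u w] that
    by (cases "\<bar>u\<bar> < 1 + w") (auto simp: unit_triangle_def conj_part_def weight_def split: if_splits)
  then show ?thesis by (auto simp: unit_triangle_def conj_part_def)
qed

text \<open>The integral of \<open>x\<^sup>l\<close> over \<open>[-1, 1]\<close>.\<close>

definition moment1 :: "nat \<Rightarrow> real" where
  "moment1 l = (1 - (- 1) ^ Suc l) / (real l + 1)"

lemma integral_power_symmetric: "(\<integral>x. x ^ l * indicator {-1..1} x \<partial>lborel) = moment1 l"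
proof -
  have "(\<integral>x. x ^ l * indicator {-1..1} x \<partial>lborel) = 1 ^ Suc l / real (Suc l) - (-1) ^ Suc l / real (Suc l)"
    by (rule integral_FTC_Icc_real) (auto intro!: derivative_eq_intros simp del: power_Suc)
  then show ?thesis by (simp add: moment1_def diff_divide_distrib add_divide_distrib add.commute)
qed

lemma integral_plane_iterated:
  fixes f :: "real \<Rightarrow> real \<Rightarrow> real"
  assumes "integrable plane (\<lambda>(u, w). f u w)"
  shows "(\<integral>(u, w). f u w \<partial>plane) = (\<integral>w. (\<integral>u. f u w \<partial>lborel) \<partial>lborel)"
  using lborel_pair.integral_snd[of f] assms by simp

lemma root_diff_bound:
  assumes "(u, w) \<in> unit_triangle"
  shows "\<bar>root_diff m u w\<bar> \<le> 4 ^ m"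
proof -
  have uw: "\<bar>u\<bar> \<le> 2" "\<bar>w\<bar> \<le> 1" using assms by (auto simp: unit_triangle_def)
  show ?thesis
  proof (induction m rule: induct_nat_012)
    case (ge2 m)
    have "\<bar>root_diff (Suc (Suc m)) u w\<bar> \<le> \<bar>u\<bar> * \<bar>root_diff (Suc m) u w\<bar> + \<bar>w\<bar> * \<bar>root_diff m u w\<bar>"
      using abs_triangle_ineq4[of "- u * root_diff (Suc m) u w" "w * root_diff m u w"] by (simp add: abs_mult)
    also have "\<dots> \<le> 2 * 4 ^ Suc m + 1 * 4 ^ m"
      by (intro add_mono mult_mono uw ge2) auto
    also have "\<dots> \<le> 4 ^ Suc (Suc m)" by simp
    finally show ?case .
  qed simp_all
qed

lemma integrable_on_triangle:
  assumes "A \<in> sets plane" "A \<subseteq> unit_triangle"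
  shows "integrable plane (\<lambda>(u, w). indicator A (u, w) * (w ^ j * root_diff m u w))"
proof (rule integrable_plane_bounded)
  let ?f = "\<lambda>(u, w). indicator A (u, w) * (w ^ j * root_diff m u w) :: real"
  show "?f \<in> borel_measurable plane"
    using assms(1) measurable_root_diff[of m] by (simp add: case_prod_unfold)
  show "\<bar>u\<bar> \<le> 2 \<and> \<bar>w\<bar> \<le> 2" if "?f (u, w) \<noteq> 0" for u w
    using assms(2) that by (auto simp: unit_triangle_def indicator_def split: if_splits)
  show "norm (?f v) \<le> 4 ^ m" for v
  proof (cases "v \<in> A")
    case True
    obtain u w where v: "v = (u, w)" by (metis prod.exhaust)
    have tr: "(u, w) \<in> unit_triangle" using assms(2) True v by blast
    then have "\<bar>w\<bar> \<le> 1" by (auto simp: unit_triangle_def)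
    then have "\<bar>w\<bar> ^ j * \<bar>root_diff m u w\<bar> \<le> 1 * 4 ^ m"
      by (intro mult_mono root_diff_bound[OF tr] power_le_one) auto
    then show ?thesis using True by (simp add: v abs_mult power_abs)
  qed (simp add: case_prod_unfold)
qed

text \<open>At the end points \<open>u = \<minusplus>(1 + w)\<close> the roots are
  \<open>\<plusminus>1\<close> and \<open>\<plusminus>w\<close>, which evaluates the power
  sums.\<close>

lemma integral_triangle:
  assumes "m > 0"
  shows "(\<integral>(u, w). indicator unit_triangle (u, w) * (w ^ j * root_diff m u w) \<partial>plane)
    = (1 - (- 1) ^ m) / real m * (moment1 j + moment1 (j + m))"
proof -
  let ?c = "(1 - (- 1) ^ m) / real m"
  have inner: "(\<integral>u. indicator unit_triangle (u, w) * (w ^ j * root_diff m u w) \<partial>lborel)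
      = ?c * ((w ^ j + w ^ (j + m)) * indicator {-1..1} w)" if "w \<noteq> 1" for w
  proof (cases "w \<in> {-1..1}")
    case True
    then have w: "- (1 + w) \<le> 1 + w" "w < 1" using that by auto
    have "(\<integral>u. indicator unit_triangle (u, w) * (w ^ j * root_diff m u w) \<partial>lborel)
        = (\<integral>u. w ^ j * (root_diff m u w * indicator {- (1 + w)..1 + w} u) \<partial>lborel)"
    proof (rule integral_cong_AE)
      have "AE u in lborel. u \<notin> {- (1 + w), 1 + w}"
        by (intro AE_not_in) (auto intro: finite_imp_null_set_lborel)
      then show "AE u in lborel. indicator unit_triangle (u, w) * (w ^ j * root_diff m u w)
          = w ^ j * (root_diff m u w * indicator {- (1 + w)..1 + w} u)"
        by eventually_elim (use w in \<open>auto simp: unit_triangle_def indicator_def abs_less_iff\<close>)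
      have m: "(\<lambda>u. root_diff m u w) \<in> borel_measurable borel"
        by (intro borel_measurable_continuous_onI continuous_at_imp_continuous_on ballI continuous_root_diff)
      have "(\<lambda>u. indicator unit_triangle (u, w) :: real) \<in> borel_measurable lborel"
        by (rule measurable_compose[OF measurable_Pair2' borel_measurable_indicator[OF sets_unit_triangle]]) simp
      then show "(\<lambda>u. indicator unit_triangle (u, w) * (w ^ j * root_diff m u w)) \<in> borel_measurable lborel"
        using m by simp
      show "(\<lambda>u. w ^ j * (root_diff m u w * indicator {- (1 + w)..1 + w} u)) \<in> borel_measurable lborel"
        using m by simp
    qed
    also have "\<dots> = w ^ j * ((1 + w ^ m - (- 1) ^ m * (1 + w ^ m)) / real m)"
      using integral_root_diff[OF w(1) assms, of w] unfolding root_power_sum_triangle by simp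
    also have "\<dots> = ?c * (w ^ j + w ^ (j + m))" by (simp add: field_simps power_add)
    finally show ?thesis using True by simp
  next
    case False
    then have "indicator unit_triangle (u, w) = (0::real)" for u
      by (auto simp: unit_triangle_def)
    then show ?thesis using False by simp
  qed
  have int: "integrable lborel (\<lambda>w. w ^ l * indicator {-1..1::real} w)" for l
    by (rule borel_integrable_atLeastAtMost) auto
  have "(\<integral>(u, w). indicator unit_triangle (u, w) * (w ^ j * root_diff m u w) \<partial>plane)
      = (\<integral>w. (\<integral>u. indicator unit_triangle (u, w) * (w ^ j * root_diff m u w) \<partial>lborel) \<partial>lborel)"
    by (rule integral_plane_iterated) (rule integrable_on_triangle[OF sets_unit_triangle order_refl])
  also have "\<dots> = (\<integral>w. ?c * ((w ^ j + w ^ (j + m)) * indicator {-1..1} w) \<partial>lborel)"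
  proof (rule integral_cong_AE)
    have "AE w in lborel. w \<notin> {1::real}" by (intro AE_not_in) (auto intro: finite_imp_null_set_lborel)
    then show "AE w in lborel. (\<integral>u. indicator unit_triangle (u, w) * (w ^ j * root_diff m u w) \<partial>lborel)
        = ?c * ((w ^ j + w ^ (j + m)) * indicator {-1..1} w)"
      by eventually_elim (use inner in auto)
    show "(\<lambda>w. \<integral>u. indicator unit_triangle (u, w) * (w ^ j * root_diff m u w) \<partial>lborel) \<in> borel_measurable lborel"
      using borel_measurable_integrable[OF lborel_pair.integrable_snd[OF
        integrable_on_triangle[OF sets_unit_triangle order_refl, of j m]]] by simp
  qed simp
  also have "\<dots> = ?c * (moment1 j + moment1 (j + m))"
    using int by (simp add: distrib_right integral_power_symmetric)
  finally show ?thesis .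
qed

text \<open>At the end points \<open>u = \<minusplus>2 \<surd>w\<close> there is a double root
  \<open>\<plusminus>\<surd>w\<close>. Half-integral powers of \<open>w\<close> remain for the outer
  integral.\<close>

lemma integral_conj_part:
  assumes "m > 0"
  shows "(\<integral>(u, w). indicator conj_part (u, w) * (w ^ j * root_diff m u w) \<partial>plane)
    = (1 - (- 1) ^ m) / real m * (4 / (2 * real j + real m + 2))"
proof -
  let ?c = "(1 - (- 1) ^ m) / real m"
  define e where "e = real j + real m / 2"
  have e: "e > -1" by (simp add: e_def)
  have inner: "(\<integral>u. indicator conj_part (u, w) * (w ^ j * root_diff m u w) \<partial>lborel)
      = 2 * ?c * (w powr e * indicator {0..1} w)" if "w \<noteq> 1" for w
  proof (cases "0 < w \<and> w < 1")
    case True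
    define s where "s = sqrt w"
    have s: "s > 0" "s\<^sup>2 = w" using True by (auto simp: s_def)
    have cp: "(u, w) \<in> conj_part \<longleftrightarrow> \<bar>u\<bar> < 2 * s" for u
    proof -
      have "u\<^sup>2 < 4 * w \<longleftrightarrow> \<bar>u\<bar>\<^sup>2 < (2 * s)\<^sup>2" by (simp add: power_mult_distrib s(2))
      also have "\<dots> \<longleftrightarrow> \<bar>u\<bar> < 2 * s"         using s(1) power2_less_imp_less[of "\<bar>u\<bar>" "2 * s"] power_strict_mono[of "\<bar>u\<bar>" "2 * s" 2] by auto
      finally show ?thesis using True by (simp add: conj_part_def)
    qed
    have "(\<integral>u. indicator conj_part (u, w) * (w ^ j * root_diff m u w) \<partial>lborel)
        = (\<integral>u. w ^ j * (root_diff m u w * indicator {- 2 * s..2 * s} u) \<partial>lborel)"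
    proof (rule integral_cong_AE)
      have "AE u in lborel. u \<notin> {- 2 * s, 2 * s}"
        by (intro AE_not_in) (auto intro: finite_imp_null_set_lborel)
      then show "AE u in lborel. indicator conj_part (u, w) * (w ^ j * root_diff m u w)
          = w ^ j * (root_diff m u w * indicator {- 2 * s..2 * s} u)"
        by eventually_elim (auto simp: cp indicator_def abs_less_iff)
      have m: "(\<lambda>u. root_diff m u w) \<in> borel_measurable borel"
        by (intro borel_measurable_continuous_onI continuous_at_imp_continuous_on ballI continuous_root_diff)
      have "(\<lambda>u. indicator conj_part (u, w) :: real) \<in> borel_measurable lborel"
        by (rule measurable_compose[OF measurable_Pair2' borel_measurable_indicator[OF sets_conj_part]]) simp
      then show "(\<lambda>u. indicator conj_part (u, w) * (w ^ j * root_diff m u w)) \<in> borel_measurable lborel"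
        using m by simp
      show "(\<lambda>u. w ^ j * (root_diff m u w * indicator {- 2 * s..2 * s} u)) \<in> borel_measurable lborel"
        using m by simp
    qed
    also have "\<dots> = w ^ j * ((2 * s ^ m - 2 * (- s) ^ m) / real m)"
      using integral_root_diff[of "- 2 * s" "2 * s" m w] s(1) assms
        root_power_sum_parabola[of m s] root_power_sum_parabola[of m "- s"] by (simp add: s(2))
    also have "\<dots> = 2 * ?c * (w ^ j * s ^ m)"
      by (simp add: power_minus[of s] field_simps)
    also have "w ^ j * s ^ m = w powr e"
    proof -
      have "s ^ m = w powr (real m / 2)"
        using True s(1) by (simp add: s_def powr_half_sqrt[symmetric] powr_powr powr_realpow[symmetric])
      then show ?thesis using True by (simp add: e_def powr_add powr_realpow)
    qed
    finally show ?thesis using True by simp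
  next
    case False
    then have "(u, w) \<notin> conj_part" for u
      using order.strict_trans1[OF zero_le_power2, of u "4 * w"] by (auto simp: conj_part_def)
    then have "indicator conj_part (u, w) = (0::real)" for u by simp
    moreover have "w powr e * indicator {0..1} w = (0::real)" using False that by (cases "w = 0") auto
    ultimately show ?thesis by simp
  qed
  have "(\<integral>(u, w). indicator conj_part (u, w) * (w ^ j * root_diff m u w) \<partial>plane)
      = (\<integral>w. (\<integral>u. indicator conj_part (u, w) * (w ^ j * root_diff m u w) \<partial>lborel) \<partial>lborel)"
    by (rule integral_plane_iterated) (rule integrable_on_triangle[OF sets_conj_part conj_part_subset])
  also have "\<dots> = (\<integral>w. 2 * ?c * (w powr e * indicator {0..1} w) \<partial>lborel)"
  proof (rule integral_cong_AE)
    have "AE w in lborel. w \<notin> {1::real}" by (intro AE_not_in) (auto intro: finite_imp_null_set_lborel)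
    then show "AE w in lborel. (\<integral>u. indicator conj_part (u, w) * (w ^ j * root_diff m u w) \<partial>lborel)
        = 2 * ?c * (w powr e * indicator {0..1} w)"
      by eventually_elim (use inner in auto)
    show "(\<lambda>w. \<integral>u. indicator conj_part (u, w) * (w ^ j * root_diff m u w) \<partial>lborel) \<in> borel_measurable lborel"
      using borel_measurable_integrable[OF lborel_pair.integrable_snd[OF
        integrable_on_triangle[OF sets_conj_part conj_part_subset, of j m]]] by simp
  qed simp
  also have "\<dots> = 2 * ?c * (1 / (e + 1))"
  proof -
    have "((\<lambda>w. w powr e) has_integral 1 powr (e + 1) / (e + 1)) {0..1}"
      by (rule has_integral_powr_from_0[OF e]) simp
    then have h: "((\<lambda>w. w powr e) has_integral 1 / (e + 1)) {0..1}" by simp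
    have "(\<lambda>w. w powr e) absolutely_integrable_on {0..1}"
      by (rule nonnegative_absolutely_integrable_1) (use h in auto)
    then have "(LINT w:{0..1}|lebesgue. w powr e) = 1 / (e + 1)"
      using set_lebesgue_integral_eq_integral(2) h by (metis integral_unique)
    moreover have "(LINT w:{0..1}|lebesgue. w powr e) = (\<integral>w. w powr e * indicator {0..1} w \<partial>lborel)"
      unfolding set_lebesgue_integral_def by (subst integral_completion) (auto simp: mult.commute)
    ultimately show ?thesis by simp
  qed
  also have "\<dots> = ?c * (4 / (2 * real j + real m + 2))"
    by (simp add: e_def field_simps)
  finally show ?thesis .
qed

section \<open>The pair moments\<close>

text \<open>Half of an antisymmetric matrix: the moment with indices \<open>j\<close> and
  \<open>k\<close> is \<open>pair_entry t j k - pair_entry t k j\<close>. Only one of the two terms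
  can be nonzero, namely the one with first index even and second index odd.\<close>

definition pair_entry :: "real \<Rightarrow> nat \<Rightarrow> nat \<Rightarrow> real" where
  "pair_entry t j k = (if even j \<and> odd k
     then 4 / ((real j + 1) * (real j + real k + 2))
        + t * (8 / ((real k - real j) * (real j + real k + 2)))
     else 0)"

text \<open>The polynomial \<open>(\<alpha>\<^sup>j \<beta>\<^sup>k - \<alpha>\<^sup>k
  \<beta>\<^sup>j) / (\<beta> - \<alpha>)\<close> in the coefficients of the quadratic polynomial
  with roots \<open>\<alpha>\<close> and \<open>\<beta>\<close>.\<close>

definition pair_kernel :: "nat \<Rightarrow> nat \<Rightarrow> real \<Rightarrow> real \<Rightarrow> real" where
  "pair_kernel j k u w = (if j < k then w ^ j * root_diff (k - j) u w
     else - (w ^ k * root_diff (j - k) u w))"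

lemma of_real_pair_kernel:
  "of_real (pair_kernel j k u w) * (root_plus u w - root_minus u w)
    = root_minus u w ^ j * root_plus u w ^ k - root_minus u w ^ k * root_plus u w ^ j"
proof -
  have *: "of_real (w ^ j * root_diff (k - j) u w) * (root_plus u w - root_minus u w)
    = root_minus u w ^ j * root_plus u w ^ k - root_minus u w ^ k * root_plus u w ^ j" if "j \<le> k" for j k
  proof -
    have w: "complex_of_real w = root_minus u w * root_plus u w" by (simp add: roots_quad)
    have "of_real (w ^ j * root_diff (k - j) u w) * (root_plus u w - root_minus u w)
        = of_real w ^ j * (of_real (root_diff (k - j) u w) * (root_plus u w - root_minus u w))" by simp
    also have "\<dots> = (root_minus u w * root_plus u w) ^ j * (root_plus u w ^ (k - j) - root_minus u w ^ (k - j))"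
      unfolding of_real_root_diff w ..
    also have "\<dots> = root_minus u w ^ j * (root_plus u w ^ j * root_plus u w ^ (k - j))
        - (root_minus u w ^ j * root_minus u w ^ (k - j)) * root_plus u w ^ j"
      by (simp add: power_mult_distrib algebra_simps)
    finally show ?thesis using that by (simp add: power_add[symmetric])
  qed
  show ?thesis
  proof (cases "j < k")
    case True
    then show ?thesis using *[of j k] by (simp add: pair_kernel_def)
  next
    case False
    then show ?thesis using *[of k j] by (simp add: pair_kernel_def algebra_simps)
  qed
qed

lemma integrable_weight_root_diff:
  "integrable plane (\<lambda>(u, w). weight t (quad u w) * (w ^ j * root_diff m u w))"
  and integral_weight_root_diff: "m > 0 \<Longrightarrow>
    (\<integral>(u, w). weight t (quad u w) * (w ^ j * root_diff m u w) \<partial>plane)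
     = (1 - (- 1) ^ m) / real m * (moment1 j + moment1 (j + m) + (t - 1) * (4 / (2 * real j + real m + 2)))"
proof -
  let ?T = "\<lambda>v::real \<times> real. indicator unit_triangle (fst v, snd v) * (snd v ^ j * root_diff m (fst v) (snd v)) :: real"
  let ?C = "\<lambda>v::real \<times> real. indicator conj_part (fst v, snd v) * (snd v ^ j * root_diff m (fst v) (snd v)) :: real"
  have eq: "(\<lambda>(u, w). weight t (quad u w) * (w ^ j * root_diff m u w)) = (\<lambda>v. ?T v + (t - 1) * ?C v)"
    by (auto simp: weight_quad algebra_simps)
  have T: "integrable plane ?T" and C: "integrable plane ?C"
    using integrable_on_triangle[OF sets_unit_triangle order_refl, of j m]
      integrable_on_triangle[OF sets_conj_part conj_part_subset, of j m] by (simp_all only: case_prod_unfold)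
  show "integrable plane (\<lambda>(u, w). weight t (quad u w) * (w ^ j * root_diff m u w))"
    unfolding eq by (intro Bochner_Integration.integrable_add integrable_mult_right T C)
  assume m: "m > 0"
  have "(\<integral>(u, w). weight t (quad u w) * (w ^ j * root_diff m u w) \<partial>plane)
      = (\<integral>v. ?T v \<partial>plane) + (t - 1) * (\<integral>v. ?C v \<partial>plane)"
    unfolding eq using T C by simp
  also have "\<dots> = (1 - (- 1) ^ m) / real m * (moment1 j + moment1 (j + m))
      + (t - 1) * ((1 - (- 1) ^ m) / real m * (4 / (2 * real j + real m + 2)))"
    using integral_triangle[OF m, of j] integral_conj_part[OF m, of j] by (simp only: case_prod_unfold)
  also have "\<dots> = (1 - (- 1) ^ m) / real m * (moment1 j + moment1 (j + m) + (t - 1) * (4 / (2 * real j + real m + 2)))"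
    by (simp only: distrib_left mult_ac)
  finally show "(\<integral>(u, w). weight t (quad u w) * (w ^ j * root_diff m u w) \<partial>plane)
     = (1 - (- 1) ^ m) / real m * (moment1 j + moment1 (j + m) + (t - 1) * (4 / (2 * real j + real m + 2)))" .
qed

lemma integrable_pair_kernel:
  "integrable plane (\<lambda>(u, w). weight t (quad u w) * pair_kernel j k u w)"
proof (cases "j < k")
  case True
  then show ?thesis using integrable_weight_root_diff[of t j "k - j"] by (simp add: pair_kernel_def)
next
  case False
  then show ?thesis using integrable_minus[OF integrable_weight_root_diff[of t k "j - k"]]
    by (simp add: pair_kernel_def case_prod_unfold)
qed

lemma integral_pair_kernel:
  "(\<integral>(u, w). weight t (quad u w) * pair_kernel j k u w \<partial>plane) = pair_entry t j k - pair_entry t k j"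
proof -
  have less: "(\<integral>(u, w). weight t (quad u w) * (w ^ j * root_diff (k - j) u w) \<partial>plane)
      = pair_entry t j k - pair_entry t k j" if "j < k" for j k
  proof -
    define m where "m = k - j"
    have k: "k = j + m" and m: "m > 0" using that by (auto simp: m_def)
    have "(\<integral>(u, w). weight t (quad u w) * (w ^ j * root_diff m u w) \<partial>plane)
     = (1 - (- 1) ^ m) / real m * (moment1 j + moment1 (j + m) + (t - 1) * (4 / (2 * real j + real m + 2)))"
      by (rule integral_weight_root_diff[OF m])
    also have "\<dots> = pair_entry t j k - pair_entry t k j"
    proof (cases "even m")
      case True
      then show ?thesis by (auto simp: pair_entry_def k)
    next
      case odd: False
      define a b where "a = real j" and "b = real m"
      have ab: "a \<ge> 0" "b > 0" using m by (auto simp: a_def b_def)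
      have nz: "a + 1 \<noteq> 0" "b \<noteq> 0" "2 * a + b + 2 \<noteq> 0" "a + b + 1 \<noteq> 0" using ab by auto
      show ?thesis
      proof (cases "even j")
        case True
        have "2 / b * (2 / (a + 1) + (t - 1) * (4 / (2 * a + b + 2)))
            = 4 / ((a + 1) * (2 * a + b + 2)) + t * (8 / (b * (2 * a + b + 2)))"
          using nz by (simp add: divide_simps) (simp add: algebra_simps)
        then show ?thesis using True odd
          by (simp add: pair_entry_def k moment1_def a_def b_def algebra_simps)
      next
        case False
        have "2 / b * (2 / (a + b + 1) + (t - 1) * (4 / (2 * a + b + 2)))
            = - (4 / ((a + b + 1) * (2 * a + b + 2)) + t * (8 / (- b * (2 * a + b + 2))))"
          using nz by (simp add: divide_simps) (simp add: algebra_simps)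
        then show ?thesis using False odd
          by (simp add: pair_entry_def k moment1_def a_def b_def algebra_simps)
      qed
    qed
    finally show ?thesis by (simp add: m_def)
  qed
  consider "j < k" | "k < j" | "j = k" by linarith
  then show ?thesis
  proof cases
    case 1
    then show ?thesis using less[OF 1] by (simp add: pair_kernel_def)
  next
    case 2
    have "(\<integral>(u, w). weight t (quad u w) * pair_kernel j k u w \<partial>plane)
        = - (\<integral>(u, w). weight t (quad u w) * (w ^ k * root_diff (j - k) u w) \<partial>plane)"
      using 2 by (subst Bochner_Integration.integral_minus[symmetric]) (simp add: pair_kernel_def case_prod_unfold)
    then show ?thesis using less[OF 2] by simp
  qed (simp add: pair_kernel_def case_prod_unfold)
qed

section \<open>Integrating the Vandermonde product pair by pair\<close>

lemma AE_distinct_roots: "AE v in plane. (fst v)\<^sup>2 \<noteq> 4 * (snd v :: real)"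
proof (rule lborel_pair.AE_pair_measure)
  have "closed {v::real \<times> real. (fst v)\<^sup>2 = 4 * snd v}"
    by (intro closed_Collect_eq continuous_intros)
  then have "open {v::real \<times> real. (fst v)\<^sup>2 \<noteq> 4 * snd v}"
    by (simp add: closed_def Collect_neg_eq)
  then have "{v::real \<times> real. (fst v)\<^sup>2 \<noteq> 4 * snd v} \<in> sets plane"
    unfolding lborel_prod by simp
  then show "{v \<in> space plane. (fst v)\<^sup>2 \<noteq> 4 * (snd v :: real)} \<in> sets plane"
    by (simp add: space_pair_measure)
  show "AE u in lborel. AE w in lborel. (fst (u, w))\<^sup>2 \<noteq> 4 * (snd (u, w) :: real)"
  proof (rule AE_I2)
    fix u :: real
    have "AE w in lborel. w \<notin> {u\<^sup>2 / 4}" by (intro AE_not_in) (auto intro: finite_imp_null_set_lborel)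
    then show "AE w in lborel. (fst (u, w))\<^sup>2 \<noteq> 4 * (snd (u, w) :: real)" by eventually_elim auto
  qed
qed

text \<open>Two indices on which the remaining factor depends symmetrically may be antisymmetrised
  at the price of a factor \<open>2\<close>.\<close>

lemma alt_sum_diff_swap:
  assumes "a < L" "b < L" "a \<noteq> b"
    and "\<And>\<pi>. C (\<pi> \<circ> Transposition.transpose a b) = C \<pi>"
  shows "alt_sum L (\<lambda>\<pi>. C \<pi> * (f (\<pi> a) (\<pi> b) - f (\<pi> b) (\<pi> a))) = 2 * alt_sum L (\<lambda>\<pi>. C \<pi> * f (\<pi> a) (\<pi> b))"
proof -
  have "alt_sum L (\<lambda>\<pi>. C \<pi> * f (\<pi> b) (\<pi> a)) = - alt_sum L (\<lambda>\<pi>. C \<pi> * f (\<pi> a) (\<pi> b))"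
    using alt_sum_swap[OF assms(1-3), of "\<lambda>\<pi>. C \<pi> * f (\<pi> a) (\<pi> b)"] by (simp add: assms(4))
  moreover have "alt_sum L (\<lambda>\<pi>. C \<pi> * (f (\<pi> a) (\<pi> b) - f (\<pi> b) (\<pi> a)))
      = alt_sum L (\<lambda>\<pi>. C \<pi> * f (\<pi> a) (\<pi> b)) - alt_sum L (\<lambda>\<pi>. C \<pi> * f (\<pi> b) (\<pi> a))"
    by (simp add: alt_sum_def sum_subtractf algebra_simps)
  ultimately show ?thesis by simp
qed

lemma alt_sum_mult_right: "alt_sum L (\<lambda>\<pi>. F \<pi> * c) = alt_sum L F * c"
  by (simp add: alt_sum_def sum_distrib_right mult.assoc)

text \<open>The Leibniz expansion of a determinant in which the first rows consist of the powers of
  the given points, the next \<open>2 n\<close> rows are integrated in pairs, and the last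
  \<open>e\<close> rows, where \<open>e\<close> is \<open>0\<close> or \<open>1\<close>, are
  integrated one at a time.\<close>

definition pfaffian_sum :: "real \<Rightarrow> nat \<Rightarrow> nat \<Rightarrow> complex list \<Rightarrow> complex" where
  "pfaffian_sum t e n pts = alt_sum (length pts + 2 * n + e) (\<lambda>\<pi>.
     (\<Prod>i<length pts. pts ! i ^ \<pi> i)
     * (\<Prod>i<n. of_real (pair_entry t (\<pi> (length pts + 2 * i)) (\<pi> (length pts + 2 * i + 1))))
     * (\<Prod>i<e. of_real (moment1 (\<pi> (length pts + 2 * n + i)))))"

lemma weighted_integral_0: "weighted_integral t 0 pts = 1"
proof -
  have "evals pts 1 = 1" by (induction pts) (simp_all add: evals_def)
  then show ?thesis
    by (simp add: weighted_integral_def PiM_empty lebesgue_integral_count_space_finite)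
qed

lemma integral_power_open_interval:
  "(\<integral>x. indicator {-1<..<1::real} x * x ^ l \<partial>lborel) = moment1 l"
proof -
  have "(\<integral>x. indicator {-1<..<1::real} x * x ^ l \<partial>lborel)
      = (\<integral>x. x ^ l * indicator {-1..1} x \<partial>lborel :: real)"
  proof (rule integral_cong_AE)
    have "AE x in lborel. x \<notin> {-1, 1::real}"
      by (intro AE_not_in) (auto intro: finite_imp_null_set_lborel)
    then show "AE x in lborel. indicator {-1<..<1} x * x ^ l = x ^ l * indicator {-1..1::real} x"
      by eventually_elim (auto simp: indicator_def)
  qed auto
  then show ?thesis by (simp add: integral_power_symmetric)
qed

text \<open>The single coefficient is minus the root, which accounts for the reflection.\<close>

lemma weighted_integral_1:
  "weighted_integral t 1 pts = (\<integral>x. of_real (indicator {-1<..<1} x) * (\<Prod>z\<leftarrow>pts. z - of_real x) \<partial>lborel)"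
proof -
  let ?f = "\<lambda>y::real. of_real (indicator {-1<..<1} y) * (\<Prod>z\<leftarrow>pts. z + of_real y) :: complex"
  have m: "(\<lambda>y::real. \<Prod>z\<leftarrow>pts. z + complex_of_real y) \<in> borel_measurable borel"
    by (induction pts) auto
  have eq: "of_real (weight t (monic_poly 1 a)) * evals pts (monic_poly 1 a) = ?f (a 1)" for a
  proof -
    have p: "monic_poly 1 a = [:- (- of_real (a 1)), 1:]"
      using monic_poly_Suc[of 0 a] by (simp add: one_pCons)
    have "evals pts (monic_poly 1 a) = (\<Prod>z\<leftarrow>pts. z + of_real (a 1))"
      unfolding p by (induction pts) (simp_all add: evals_def add.commute)
    then show ?thesis unfolding p weight_linear by (auto simp: indicator_def abs_less_iff)
  qed
  have "weighted_integral t 1 pts = (\<integral>a. ?f (a 1) \<partial>Pi\<^sub>M {1::nat} (\<lambda>_. lborel))"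
    unfolding weighted_integral_def eq by (simp only: atLeastAtMost_singleton)
  also have "\<dots> = (\<integral>y. ?f y \<partial>lborel)"
    by (rule lborel_family.product_integral_singleton) (use m in simp)
  also have "\<dots> = \<bar>- 1\<bar> *\<^sub>R (\<integral>x. ?f (0 + - 1 * x) \<partial>lborel)"
    by (rule lborel_integral_real_affine) simp
  also have "\<dots> = (\<integral>x. of_real (indicator {-1<..<1} x) * (\<Prod>z\<leftarrow>pts. z - of_real x) \<partial>lborel)"
    by (auto intro!: Bochner_Integration.integral_cong simp: indicator_def)
  finally show ?thesis .
qed

lemma integrable_power_open_interval:
  "integrable lborel (\<lambda>x::real. indicator {-1<..<1} x * x ^ l)"
proof (rule integrableI_bounded_set)
  show "AE x in lborel. x \<in> {-1<..<1::real} \<longrightarrow> norm (indicator {-1<..<1} x * x ^ l) \<le> 1"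
    by (intro AE_I2) (auto simp: power_abs intro!: power_le_one)
qed (auto intro!: AE_I2 simp: emeasure_lborel_Ioo)

lemma pfaffian_sum_base:
  assumes "e \<le> 1" "even (length pts)"
  shows "vand pts * weighted_integral t e pts = pfaffian_sum t e 0 pts"
proof (cases "e = 0")
  case True
  then show ?thesis by (simp add: weighted_integral_0 pfaffian_sum_def vand_eq_alt_sum)
next
  case False
  then have e: "e = 1" using assms(1) by simp
  let ?p = "length pts"
  let ?C = "\<lambda>\<pi>::nat \<Rightarrow> nat. \<Prod>i<?p. pts ! i ^ \<pi> i"
  have flip: "(\<Prod>z\<leftarrow>pts. z - x) = (\<Prod>z\<leftarrow>pts. x - z)" for x
  proof -
    have "(\<Prod>z\<leftarrow>pts. z - x) = (- 1) ^ ?p * (\<Prod>z\<leftarrow>pts. x - z)"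
      by (induction pts) (simp_all add: algebra_simps)
    then show ?thesis using assms(2) by simp
  qed
  have pt: "vand pts * (of_real (indicator {-1<..<1} x) * (\<Prod>z\<leftarrow>pts. z - of_real x))
      = (\<Sum>\<pi> | \<pi> permutes {..<?p + 1}. of_int (sign \<pi>) * ?C \<pi> * of_real (indicator {-1<..<1} x * x ^ \<pi> ?p))" for x
  proof -
    have "vand pts * (of_real (indicator {-1<..<1} x) * (\<Prod>z\<leftarrow>pts. z - of_real x))
        = of_real (indicator {-1<..<1} x) * vand (pts @ [of_real x])"
      by (simp add: vand_snoc flip)
    also have "vand (pts @ [of_real x]) = alt_sum (?p + 1) (\<lambda>\<pi>. ?C \<pi> * of_real x ^ \<pi> ?p)"
      unfolding vand_eq_alt_sum by (auto intro!: alt_sum_cong prod.cong simp: nth_append)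
    finally show ?thesis
      by (simp add: alt_sum_def sum_distrib_left mult_ac)
  qed
  have "vand pts * weighted_integral t 1 pts
      = (\<integral>x. vand pts * (of_real (indicator {-1<..<1} x) * (\<Prod>z\<leftarrow>pts. z - of_real x)) \<partial>lborel)"
    unfolding weighted_integral_1 by simp
  also have "\<dots> = (\<Sum>\<pi> | \<pi> permutes {..<?p + 1}. \<integral>x. of_int (sign \<pi>) * ?C \<pi> * of_real (indicator {-1<..<1} x * x ^ \<pi> ?p) \<partial>lborel)"
    unfolding pt
    by (rule Bochner_Integration.integral_sum)
       (intro integrable_mult_right integrable_of_real integrable_power_open_interval)
  also have "\<dots> = (\<Sum>\<pi> | \<pi> permutes {..<?p + 1}. of_int (sign \<pi>) * ?C \<pi> * of_real (moment1 (\<pi> ?p)))"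
    by (simp only: integral_mult_right_zero integral_complex_of_real integral_power_open_interval)
  also have "\<dots> = pfaffian_sum t 1 0 pts"
    by (simp add: pfaffian_sum_def alt_sum_def mult.assoc)
  finally show ?thesis by (simp add: e)
qed

text \<open>Induction on the number of pairs. The recursion evaluates the smaller case at two more
  points, the roots \<open>\<alpha>\<close> and \<open>\<beta>\<close> of the quadratic factor. The
  enlarged Vandermonde product contains the extra factor \<open>\<beta> - \<alpha>\<close>, and
  dividing the alternating sum by it antisymmetrises the two new rows into
  \<open>pair_kernel\<close>. Its integral is the antisymmetrised \<open>pair_entry\<close>, so the
  antisymmetrisation can be undone afterwards. The number of points is even so that in odd degree
  the left-over root can be moved to the end without a sign.\<close>

theorem vand_times_weighted_integral:
  assumes t: "0 \<le> t" "t \<le> 1" and e: "e \<le> 1" and "even (length pts)"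
  shows "fact n * vand pts * weighted_integral t (2 * n + e) pts = pfaffian_sum t e n pts"
  using assms(4)
proof (induction n arbitrary: pts)
  case 0
  then show ?case using pfaffian_sum_base[OF e] by simp
next
  case (Suc n)
  let ?W = plane
  define p where "p = length pts"
  define L where "L = p + 2 * Suc n + e"
  define C where "C = (\<lambda>\<pi>. (\<Prod>i<p. pts ! i ^ \<pi> i)
     * (\<Prod>i<n. complex_of_real (pair_entry t (\<pi> (p + 2 + 2 * i)) (\<pi> (p + 2 + 2 * i + 1))))
     * (\<Prod>i<e. complex_of_real (moment1 (\<pi> (p + 2 + 2 * n + i)))))"
  have pL: "p < L" "p + 1 < L" "p \<noteq> p + 1" by (auto simp: L_def)
  have Cswap: "C (\<pi> \<circ> Transposition.transpose p (p + 1)) = C \<pi>" for \<pi>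
    unfolding C_def by (intro arg_cong2[where f = "(*)"] prod.cong refl) (auto simp: Transposition.transpose_def)
  let ?R = "\<lambda>v. case v of (u, w) \<Rightarrow> of_real (weight t (quad u w)) * evals pts (quad u w)
        * weighted_integral t (2 * n + e) (pts @ [root_minus u w, root_plus u w])"
  let ?S = "\<lambda>v. case v of (u, w) \<Rightarrow> \<Sum>\<pi> | \<pi> permutes {..<L}. of_int (sign \<pi>) * C \<pi> / 2
        * of_real (weight t (quad u w) * pair_kernel (\<pi> p) (\<pi> (p + 1)) u w)"
  \<comment> \<open>Division by \<open>\<beta> - \<alpha>\<close> is possible off the parabola of
    double roots, which is a null set.\<close>
  have pointwise: "fact n * vand pts * ?R (u, w) = ?S (u, w)" if "u\<^sup>2 \<noteq> 4 * w" for u w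
  proof -
    define x y where "x = root_minus u w" and "y = root_plus u w"
    have xy: "y - x \<noteq> 0" using that root_minus_eq_root_plus_iff[of u w] by (auto simp: x_def y_def)
    have "fact n * vand pts * ?R (u, w) * (y - x)
        = of_real (weight t (quad u w)) * (fact n * vand (pts @ [x, y]) * weighted_integral t (2 * n + e) (pts @ [x, y]))"
      unfolding x_def y_def vand_append_roots by (simp add: mult_ac)
    also have "\<dots> = of_real (weight t (quad u w)) * pfaffian_sum t e n (pts @ [x, y])"
      using Suc.IH[of "pts @ [x, y]"] Suc.prems by simp
    also have "pfaffian_sum t e n (pts @ [x, y]) = alt_sum L (\<lambda>\<pi>. C \<pi> * (x ^ \<pi> p * y ^ \<pi> (p + 1)))"
    proof -
      have split: "(\<Prod>i<Suc (Suc p). (pts @ [x, y]) ! i ^ \<pi> i)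
          = (\<Prod>i<p. pts ! i ^ \<pi> i) * (x ^ \<pi> p * y ^ \<pi> (p + 1))" for \<pi>
      proof -
        have "(\<Prod>i<p. (pts @ [x, y]) ! i ^ \<pi> i) = (\<Prod>i<p. pts ! i ^ \<pi> i)"
          by (intro prod.cong) (auto simp: nth_append p_def)
        then show ?thesis by (simp add: nth_append p_def mult_ac)
      qed
      have len: "length (pts @ [x, y]) = Suc (Suc p)" by (simp add: p_def)
      show ?thesis
        unfolding pfaffian_sum_def len split C_def
        by (simp add: L_def mult_ac)
    qed
    also have "\<dots> = alt_sum L (\<lambda>\<pi>. C \<pi> * (x ^ \<pi> p * y ^ \<pi> (p + 1) - x ^ \<pi> (p + 1) * y ^ \<pi> p)) / 2"
      using alt_sum_diff_swap[where f = "\<lambda>j k. x ^ j * y ^ k" and C = C, OF pL Cswap] by simp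
    also have "alt_sum L (\<lambda>\<pi>. C \<pi> * (x ^ \<pi> p * y ^ \<pi> (p + 1) - x ^ \<pi> (p + 1) * y ^ \<pi> p))
        = alt_sum L (\<lambda>\<pi>. C \<pi> * of_real (pair_kernel (\<pi> p) (\<pi> (p + 1)) u w)) * (y - x)"
      unfolding x_def y_def alt_sum_mult_right[symmetric] mult.assoc of_real_pair_kernel ..
    finally have "fact n * vand pts * ?R (u, w) * (y - x)
        = of_real (weight t (quad u w)) * (alt_sum L (\<lambda>\<pi>. C \<pi> * of_real (pair_kernel (\<pi> p) (\<pi> (p + 1)) u w)) / 2) * (y - x)"
      by simp
    then have "fact n * vand pts * ?R (u, w)
        = of_real (weight t (quad u w)) * (alt_sum L (\<lambda>\<pi>. C \<pi> * of_real (pair_kernel (\<pi> p) (\<pi> (p + 1)) u w)) / 2)"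
      using xy by (simp only: mult_cancel_right) blast
    then show ?thesis
      by (simp add: alt_sum_def sum_distrib_left sum_divide_distrib mult_ac)
  qed
  have N: "2 * Suc n + e = Suc (Suc (2 * n + e))" "Suc (Suc (2 * n + e)) div 2 = Suc n" using e by auto
  note rec = weighted_integral_recursion[OF t, where N = "2 * n + e" and pts = pts, unfolded N(2)]
  have intS: "integrable ?W (\<lambda>v. of_int (sign \<pi>) * C \<pi> / 2
        * of_real (weight t (quad (fst v) (snd v)) * pair_kernel (\<pi> p) (\<pi> (p + 1)) (fst v) (snd v)))" for \<pi>
    using integrable_pair_kernel[of t "\<pi> p" "\<pi> (p + 1)"]
    by (intro integrable_mult_right integrable_of_real) (simp add: case_prod_unfold)
  have "fact (Suc n) * vand pts * weighted_integral t (2 * Suc n + e) pts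
      = fact n * vand pts * (of_nat (Suc n) * weighted_integral t (Suc (Suc (2 * n + e))) pts)"
    unfolding N(1) by (simp add: mult_ac)
  also have "\<dots> = (\<integral>v. fact n * vand pts * ?R v \<partial>?W)"
    unfolding rec(1) by simp
  also have "\<dots> = (\<integral>v. ?S v \<partial>?W)"
  proof (rule integral_cong_AE)
    show "(\<lambda>v. fact n * vand pts * ?R v) \<in> borel_measurable ?W"
      using borel_measurable_integrable[OF rec(2)] by simp
    show "?S \<in> borel_measurable ?W"
      unfolding case_prod_unfold using borel_measurable_integrable[OF intS] by (intro borel_measurable_sum)
    show "AE v in ?W. fact n * vand pts * ?R v = ?S v"
      using AE_distinct_roots
    proof eventually_elim
      case (elim v)
      then show ?case using pointwise[OF elim] by (simp only: prod.collapse)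
    qed
  qed
  also have "\<dots> = (\<Sum>\<pi> | \<pi> permutes {..<L}. of_int (sign \<pi>) * C \<pi> / 2
        * of_real (pair_entry t (\<pi> p) (\<pi> (p + 1)) - pair_entry t (\<pi> (p + 1)) (\<pi> p)))"
  proof -
    have "(\<integral>v. ?S v \<partial>?W) = (\<Sum>\<pi> | \<pi> permutes {..<L}. \<integral>v. of_int (sign \<pi>) * C \<pi> / 2
        * of_real (weight t (quad (fst v) (snd v)) * pair_kernel (\<pi> p) (\<pi> (p + 1)) (fst v) (snd v)) \<partial>?W)"
      unfolding case_prod_unfold by (rule Bochner_Integration.integral_sum) (rule intS)
    then show ?thesis
      by (simp only: integral_mult_right_zero integral_complex_of_real integral_pair_kernel[unfolded case_prod_unfold])
  qed
  also have "\<dots> = alt_sum L (\<lambda>\<pi>. C \<pi> * (of_real (pair_entry t (\<pi> p) (\<pi> (p + 1))) - of_real (pair_entry t (\<pi> (p + 1)) (\<pi> p)))) / 2"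
    by (simp add: alt_sum_def sum_divide_distrib mult.assoc)
  also have "\<dots> = alt_sum L (\<lambda>\<pi>. C \<pi> * of_real (pair_entry t (\<pi> p) (\<pi> (p + 1))))"
    using alt_sum_diff_swap[where f = "\<lambda>j k. complex_of_real (pair_entry t j k)" and C = C, OF pL Cswap] by simp
  also have "\<dots> = pfaffian_sum t e (Suc n) pts"
  proof -
    have shift: "(\<Prod>i<Suc n. complex_of_real (pair_entry t (\<pi> (p + 2 * i)) (\<pi> (p + 2 * i + 1))))
        = of_real (pair_entry t (\<pi> p) (\<pi> (p + 1)))
          * (\<Prod>i<n. of_real (pair_entry t (\<pi> (p + 2 + 2 * i)) (\<pi> (p + 2 + 2 * i + 1))))" for \<pi>
      by (simp add: prod.lessThan_Suc_shift add.assoc del: prod.lessThan_Suc)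
    show ?thesis
      unfolding pfaffian_sum_def p_def[symmetric] L_def[symmetric] shift C_def
      by (intro alt_sum_cong) (simp add: mult_ac)
  qed
  finally show ?case .
qed

section \<open>Parity reduces the alternating sum to a determinant\<close>

definition leibniz :: "nat \<Rightarrow> (nat \<Rightarrow> nat \<Rightarrow> real) \<Rightarrow> real" where
  "leibniz n R = (\<Sum>\<rho> | \<rho> permutes {..<n}. of_int (sign \<rho>) * (\<Prod>j<n. R j (\<rho> j)))"

lemma det_of_eq_leibniz: "det_of n c = leibniz n (\<lambda>j k. c (j + 1) (k + 1))"
proof -
  have "det_of n c = (\<Sum>p | p permutes {0..<n}. of_int (sign p) *
      (\<Prod>i = 0..<n. Matrix.mat n n (\<lambda>(i, l). c (i + 1) (l + 1)) $$ (i, p i)))"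
    unfolding det_of_def by (rule det_def') simp
  also have "\<dots> = leibniz n (\<lambda>j k. c (j + 1) (k + 1))"
    unfolding leibniz_def atLeast0LessThan
  proof (rule sum.cong[OF refl])
    fix p assume "p \<in> {p. p permutes {..<n}}"
    then have "p i < n" if "i < n" for i using that permutes_in_image[of p "{..<n}" i] by auto
    then show "of_int (sign p) * (\<Prod>i<n. Matrix.mat n n (\<lambda>(i, l). c (i + 1) (l + 1)) $$ (i, p i))
        = of_int (sign p) * (\<Prod>j<n. c (j + 1) (p j + 1))"
      by (intro arg_cong2[where f = "(*)"] prod.cong) auto
  qed
  finally show ?thesis .
qed

text \<open>A permutation that preserves parity, built from its actions on even and on odd
  numbers.\<close>

definition interleave :: "(nat \<Rightarrow> nat) \<Rightarrow> (nat \<Rightarrow> nat) \<Rightarrow> nat \<Rightarrow> nat" where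
  "interleave \<sigma> \<tau> x = (if even x then 2 * \<sigma> (x div 2) else 2 * \<tau> (x div 2) + 1)"

lemma interleave_simps [simp]:
  "interleave \<sigma> \<tau> (2 * i) = 2 * \<sigma> i" "interleave \<sigma> \<tau> (Suc (2 * i)) = Suc (2 * \<tau> i)"
  by (simp_all add: interleave_def)

lemma nat_parity_cases: obtains i where "x = 2 * i" | i where "x = Suc (2 * i)"
  by (metis evenE oddE Suc_eq_plus1)

lemma interleave_permutes:
  assumes "\<sigma> permutes {..<n + e}" "\<tau> permutes {..<n}" "e \<le> 1"
  shows "interleave \<sigma> \<tau> permutes {..<2 * n + e}"
proof (rule inj_imp_permutes)
  have inj: "\<sigma> i = \<sigma> j \<longleftrightarrow> i = j" "\<tau> i = \<tau> j \<longleftrightarrow> i = j" for i j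
    using permutes_inj[OF assms(1)] permutes_inj[OF assms(2)] by (auto dest: injD)
  show "inj_on (interleave \<sigma> \<tau>) {..<2 * n + e}"
  proof (rule inj_onI)
    fix x y assume "interleave \<sigma> \<tau> x = interleave \<sigma> \<tau> y"
    then show "x = y"
      by (cases x rule: nat_parity_cases; cases y rule: nat_parity_cases) (auto simp: inj, presburger+)
  qed
  have im: "\<sigma> i < n + e \<longleftrightarrow> i < n + e" "\<tau> i < n \<longleftrightarrow> i < n" for i
    using permutes_in_image[OF assms(1), of i] permutes_in_image[OF assms(2), of i] by auto
  show "interleave \<sigma> \<tau> x \<in> {..<2 * n + e}" if "x \<in> {..<2 * n + e}" for x
  proof (cases x rule: nat_parity_cases)
    case (1 i)
    then have "\<sigma> i < n + e" using that assms(3) im by auto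
    then show ?thesis using assms(3) by (simp add: 1)
  next
    case (2 i)
    then have "\<tau> i < n" using that assms(3) im by auto
    then show ?thesis by (simp add: 2)
  qed
  show "interleave \<sigma> \<tau> x = x" if "x \<notin> {..<2 * n + e}" for x
  proof (cases x rule: nat_parity_cases)
    case (1 i)
    then have "i \<notin> {..<n + e}" using that assms(3) by auto
    then show ?thesis by (simp add: 1 permutes_not_in[OF assms(1)])
  next
    case (2 i)
    then have "i \<notin> {..<n}" using that assms(3) by auto
    then show ?thesis by (simp add: 2 permutes_not_in[OF assms(2)])
  qed
qed simp

lemma interleave_id_eq_map_permutation:
  assumes "\<sigma> permutes {..<k}"
  shows "interleave \<sigma> id = map_permutation {..<k} (\<lambda>i. 2 * i) \<sigma>"
    and "interleave id \<sigma> = map_permutation {..<k} (\<lambda>i. Suc (2 * i)) \<sigma>"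
proof -
  have inj: "inj_on (\<lambda>i. 2 * i) {..<k}" "inj_on (\<lambda>i. Suc (2 * i)) {..<k}" for k :: nat
    by (auto simp: inj_on_def)
  have off: "map_permutation {..<k} f \<sigma> x = x" if "inj_on f {..<k}" "x \<notin> f ` {..<k}" for f :: "nat \<Rightarrow> nat" and x
    using map_permutation_permutes[OF inj_on_imp_bij_betw[OF that(1)] assms] that(2) by (rule permutes_not_in)
  show "interleave \<sigma> id = map_permutation {..<k} (\<lambda>i. 2 * i) \<sigma>"
  proof
    fix x
    show "interleave \<sigma> id x = map_permutation {..<k} (\<lambda>i. 2 * i) \<sigma> x"
    proof (cases "x \<in> (\<lambda>i. 2 * i) ` {..<k}")
      case True
      then obtain i where i: "x = 2 * i" "i \<in> {..<k}" by blast
      show ?thesis unfolding i(1) using map_permutation_apply[OF inj(1) i(2), of \<sigma>] by simp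
    next
      case False
      have "interleave \<sigma> id x = x"
      proof (cases x rule: nat_parity_cases)
        case (1 i)
        then have "i \<notin> {..<k}" using False by auto
        then show ?thesis by (simp add: 1 permutes_not_in[OF assms])
      qed simp
      then show ?thesis using off[OF inj(1) False] by simp
    qed
  qed
  show "interleave id \<sigma> = map_permutation {..<k} (\<lambda>i. Suc (2 * i)) \<sigma>"
  proof
    fix x
    show "interleave id \<sigma> x = map_permutation {..<k} (\<lambda>i. Suc (2 * i)) \<sigma> x"
    proof (cases "x \<in> (\<lambda>i. Suc (2 * i)) ` {..<k}")
      case True
      then obtain i where i: "x = Suc (2 * i)" "i \<in> {..<k}" by blast
      show ?thesis unfolding i(1) using map_permutation_apply[OF inj(2) i(2), of \<sigma>] by simp
    next
      case False
      have "interleave id \<sigma> x = x"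
      proof (cases x rule: nat_parity_cases)
        case (2 i)
        then have "i \<notin> {..<k}" using False by auto
        then show ?thesis by (simp add: 2 permutes_not_in[OF assms])
      qed simp
      then show ?thesis using off[OF inj(2) False] by simp
    qed
  qed
qed

text \<open>The even and the odd part act on disjoint sets, and each is a transported copy of the
  given permutation.\<close>

lemma sign_interleave:
  assumes "\<sigma> permutes {..<n + e}" "\<tau> permutes {..<n}" "e \<le> 1"
  shows "sign (interleave \<sigma> \<tau>) = sign \<sigma> * sign \<tau>"
proof -
  have "interleave \<sigma> \<tau> = interleave \<sigma> id \<circ> interleave id \<tau>"
  proof
    fix x show "interleave \<sigma> \<tau> x = (interleave \<sigma> id \<circ> interleave id \<tau>) x"
      by (cases x rule: nat_parity_cases) auto
  qed
  moreover have "permutation (interleave \<sigma> id)" "permutation (interleave id \<tau>)"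
    using interleave_permutes[OF assms(1) permutes_id assms(3)]
      interleave_permutes[OF permutes_id assms(2), of 0] finite_lessThan by (auto simp: permutation_permutes)
  ultimately have "sign (interleave \<sigma> \<tau>) = sign (interleave \<sigma> id) * sign (interleave id \<tau>)"
    by (simp only: sign_compose)
  also have "sign (interleave \<sigma> id) = sign \<sigma>"
    unfolding interleave_id_eq_map_permutation(1)[OF assms(1)]
    by (rule sign_map_permutation) (use assms in \<open>auto simp: inj_on_def\<close>)
  also have "sign (interleave id \<tau>) = sign \<tau>"
    unfolding interleave_id_eq_map_permutation(2)[OF assms(2)]
    by (rule sign_map_permutation) (use assms in \<open>auto simp: inj_on_def\<close>)
  finally show ?thesis .
qed

text \<open>Every permutation that preserves parity arises by interleaving.\<close>

lemma uninterleave_permutes: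
  assumes \<pi>: "\<pi> permutes {..<2 * n + e}" and par: "\<And>i. even (\<pi> i) \<longleftrightarrow> even i" and e: "e \<le> 1"
  shows "(\<lambda>i. \<pi> (2 * i) div 2) permutes {..<n + e}" and "(\<lambda>i. \<pi> (Suc (2 * i)) div 2) permutes {..<n}"
proof -
  have ev: "2 * (\<pi> (2 * i) div 2) = \<pi> (2 * i)" and od: "Suc (2 * (\<pi> (Suc (2 * i)) div 2)) = \<pi> (Suc (2 * i))" for i
    using par[of "2 * i"] par[of "Suc (2 * i)"] by auto
  have im: "\<pi> i < 2 * n + e \<longleftrightarrow> i < 2 * n + e" for i using permutes_in_image[OF \<pi>, of i] by auto
  have inj: "\<pi> i = \<pi> j \<longleftrightarrow> i = j" for i j using permutes_inj[OF \<pi>] by (auto dest: injD)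
  show "(\<lambda>i. \<pi> (2 * i) div 2) permutes {..<n + e}"
  proof (rule inj_imp_permutes)
    show "inj_on (\<lambda>i. \<pi> (2 * i) div 2) {..<n + e}"
      by (rule inj_onI) (metis ev inj mult_left_cancel zero_neq_numeral)
    show "\<pi> (2 * i) div 2 \<in> {..<n + e}" if "i \<in> {..<n + e}" for i
      using im[of "2 * i"] ev[of i] that e by auto
    show "\<pi> (2 * i) div 2 = i" if "i \<notin> {..<n + e}" for i
      using permutes_not_in[OF \<pi>, of "2 * i"] that by simp
  qed simp
  show "(\<lambda>i. \<pi> (Suc (2 * i)) div 2) permutes {..<n}"
  proof (rule inj_imp_permutes)
    show "inj_on (\<lambda>i. \<pi> (Suc (2 * i)) div 2) {..<n}"
      by (rule inj_onI) (metis od inj mult_left_cancel zero_neq_numeral Suc_inject)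
    show "\<pi> (Suc (2 * i)) div 2 \<in> {..<n}" if "i \<in> {..<n}" for i
      using im[of "Suc (2 * i)"] od[of i] that e by auto
    show "\<pi> (Suc (2 * i)) div 2 = i" if "i \<notin> {..<n}" for i
      using permutes_not_in[OF \<pi>, of "Suc (2 * i)"] that e by simp
  qed simp
qed

text \<open>Rows belong to odd exponents and columns to even ones. The row with index
  \<open>n\<close>, which is there in odd degree only, belongs to the unpaired root.\<close>

definition moment_row :: "real \<Rightarrow> nat \<Rightarrow> nat \<Rightarrow> nat \<Rightarrow> real" where
  "moment_row t n j k = (if j < n then pair_entry t (2 * k) (Suc (2 * j)) else moment1 (2 * k))"

text \<open>A term survives only if the permutation sends the first index of each pair to an even
  and the second to an odd number, so it interleaves \<open>\<sigma>\<close> and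
  \<open>\<tau>\<close>. For fixed \<open>\<tau>\<close>, reindexing the product by
  \<open>\<tau>\<close> turns the sum over \<open>\<sigma>\<close> into the determinant, and there
  are \<open>n!\<close> choices of \<open>\<tau>\<close>.\<close>

lemma pfaffian_sum_eq_leibniz:
  assumes e: "e \<le> 1"
  shows "pfaffian_sum t e n [] = of_real (fact n * leibniz (n + e) (moment_row t n))"
proof -
  define F where "F = (\<lambda>\<pi>. (\<Prod>i<n. pair_entry t (\<pi> (2 * i)) (\<pi> (Suc (2 * i)))) * (\<Prod>i<e. moment1 (\<pi> (2 * n + i))))"
  define Sg where "Sg = {\<sigma>. \<sigma> permutes {..<n + e}}"
  define Tu where "Tu = {\<tau>. \<tau> permutes {..<n}}"
  define Pp where "Pp = {\<pi>. \<pi> permutes {..<2 * n + e} \<and> (\<forall>i. even (\<pi> i) \<longleftrightarrow> even i)}"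
  have m0: "moment1 l = 0" if "odd l" for l using that by (simp add: moment1_def)
  have vanish: "F \<pi> = 0" if \<pi>: "\<pi> permutes {..<2 * n + e}" and nP: "\<pi> \<notin> Pp" for \<pi>
  proof -
    obtain x where x: "even (\<pi> x) \<noteq> even x" using \<pi> nP by (auto simp: Pp_def)
    then have "\<pi> x \<noteq> x" by auto
    then have xl: "x < 2 * n + e" using permutes_not_in[OF \<pi>] by fastforce
    show ?thesis
    proof (cases "x < 2 * n")
      case True
      define i where "i = x div 2"
      have "x = 2 * i \<or> x = Suc (2 * i)" "i < n" using True by (auto simp: i_def)
      then have "pair_entry t (\<pi> (2 * i)) (\<pi> (Suc (2 * i))) = 0" using x by (auto simp: pair_entry_def)
      then have "(\<Prod>i<n. pair_entry t (\<pi> (2 * i)) (\<pi> (Suc (2 * i)))) = 0"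
        using \<open>i < n\<close> by (intro prod_zero) auto
      then show ?thesis by (simp add: F_def)
    next
      case False
      then have "x = 2 * n" "e = 1" using xl e by auto
      then show ?thesis using x m0[of "\<pi> x"] by (simp add: F_def)
    qed
  qed
  have "pfaffian_sum t e n [] = of_real (\<Sum>\<pi> | \<pi> permutes {..<2 * n + e}. of_int (sign \<pi>) * F \<pi>)"
    unfolding pfaffian_sum_def alt_sum_def F_def by simp
  also have "(\<Sum>\<pi> | \<pi> permutes {..<2 * n + e}. of_int (sign \<pi>) * F \<pi>) = (\<Sum>\<pi>\<in>Pp. of_int (sign \<pi>) * F \<pi>)"
    by (rule sum.mono_neutral_right) (use vanish in \<open>auto simp: Pp_def finite_permutations\<close>)
  also have "\<dots> = (\<Sum>(\<sigma>, \<tau>)\<in>Sg \<times> Tu. of_int (sign \<sigma> * sign \<tau>) * (\<Prod>j<n + e. moment_row t n (\<tau> j) (\<sigma> j)))"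
  proof (rule sum.reindex_bij_witness[of _ "\<lambda>(\<sigma>, \<tau>). interleave \<sigma> \<tau>" "\<lambda>\<pi>. (\<lambda>i. \<pi> (2 * i) div 2, \<lambda>i. \<pi> (Suc (2 * i)) div 2)"])
    fix \<pi> assume \<pi>: "\<pi> \<in> Pp"
    then have \<pi>': "\<pi> permutes {..<2 * n + e}" and par: "\<And>i. even (\<pi> i) \<longleftrightarrow> even i" by (auto simp: Pp_def)
    let ?\<sigma> = "\<lambda>i. \<pi> (2 * i) div 2" and ?\<tau> = "\<lambda>i. \<pi> (Suc (2 * i)) div 2"
    have perm: "?\<sigma> permutes {..<n + e}" "?\<tau> permutes {..<n}" using uninterleave_permutes[OF \<pi>' par e] by auto
    then show "(?\<sigma>, ?\<tau>) \<in> Sg \<times> Tu" by (simp add: Sg_def Tu_def)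
    have il: "interleave ?\<sigma> ?\<tau> = \<pi>"
    proof
      fix x show "interleave ?\<sigma> ?\<tau> x = \<pi> x"
        using par[of x] by (cases x rule: nat_parity_cases) auto
    qed
    then show "(case (?\<sigma>, ?\<tau>) of (\<sigma>, \<tau>) \<Rightarrow> interleave \<sigma> \<tau>) = \<pi>" by simp
    have \<tau>im: "?\<tau> i < n" if "i < n" for i using permutes_in_image[OF perm(2), of i] that by auto
    have "F (interleave ?\<sigma> ?\<tau>) = (\<Prod>j<n + e. moment_row t n (?\<tau> j) (?\<sigma> j))"
    proof -
      have tail: "(\<Prod>i<e. moment1 (interleave ?\<sigma> ?\<tau> (2 * n + i))) = (\<Prod>i<e. moment_row t n (?\<tau> (n + i)) (?\<sigma> (n + i)))"
      proof (rule prod.cong[OF refl])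
        fix i assume "i \<in> {..<e}"
        then have i: "i = 0" using e by auto
        have "?\<tau> n = n" using permutes_not_in[OF perm(2), of n] by simp
        then show "moment1 (interleave ?\<sigma> ?\<tau> (2 * n + i)) = moment_row t n (?\<tau> (n + i)) (?\<sigma> (n + i))"
          by (simp add: i moment_row_def)
      qed
      have "(\<Prod>i<n. pair_entry t (interleave ?\<sigma> ?\<tau> (2 * i)) (interleave ?\<sigma> ?\<tau> (Suc (2 * i))))
          = (\<Prod>i<n. moment_row t n (?\<tau> i) (?\<sigma> i))"
        using \<tau>im by (intro prod.cong) (auto simp: moment_row_def)
      then show ?thesis
        unfolding F_def tail using e by (auto simp: le_Suc_eq)
    qed
    then show "(case (?\<sigma>, ?\<tau>) of (\<sigma>, \<tau>) \<Rightarrow> of_int (sign \<sigma> * sign \<tau>) * (\<Prod>j<n + e. moment_row t n (\<tau> j) (\<sigma> j)))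
        = of_int (sign \<pi>) * F \<pi>"
      using sign_interleave[OF perm e] unfolding il by simp
  next
    fix st assume "st \<in> Sg \<times> Tu"
    then obtain \<sigma> \<tau> where st: "st = (\<sigma>, \<tau>)" "\<sigma> permutes {..<n + e}" "\<tau> permutes {..<n}" by (auto simp: Sg_def Tu_def)
    show "(case st of (\<sigma>, \<tau>) \<Rightarrow> interleave \<sigma> \<tau>) \<in> Pp"
      using interleave_permutes[OF st(2,3) e] by (auto simp: Pp_def st(1) interleave_def)
    show "(\<lambda>i. (case st of (\<sigma>, \<tau>) \<Rightarrow> interleave \<sigma> \<tau>) (2 * i) div 2,
        \<lambda>i. (case st of (\<sigma>, \<tau>) \<Rightarrow> interleave \<sigma> \<tau>) (Suc (2 * i)) div 2) = st"
      by (simp add: st(1))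
  qed
  also have "\<dots> = (\<Sum>\<tau>\<in>Tu. \<Sum>\<sigma>\<in>Sg. of_int (sign \<sigma> * sign \<tau>) * (\<Prod>j<n + e. moment_row t n (\<tau> j) (\<sigma> j)))"
    by (subst sum.swap) (simp add: sum.cartesian_product)
  also have "\<dots> = (\<Sum>\<tau>\<in>Tu. leibniz (n + e) (moment_row t n))"
  proof (rule sum.cong[OF refl])
    fix \<tau> assume "\<tau> \<in> Tu"
    then have \<tau>: "\<tau> permutes {..<n + e}" by (auto simp: Tu_def intro: permutes_subset)
    have perm\<tau>: "permutation \<tau>" using \<tau> by (auto simp: permutation_permutes)
    have "leibniz (n + e) (moment_row t n)
        = (\<Sum>\<sigma>\<in>Sg. of_int (sign (\<sigma> \<circ> inv_into UNIV \<tau>)) * (\<Prod>j<n + e. moment_row t n j ((\<sigma> \<circ> inv_into UNIV \<tau>) j)))"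
      unfolding leibniz_def Sg_def by (rule sum_permutations_compose_right[OF permutes_inv[OF \<tau>]])
    also have "\<dots> = (\<Sum>\<sigma>\<in>Sg. of_int (sign \<sigma> * sign \<tau>) * (\<Prod>j<n + e. moment_row t n (\<tau> j) (\<sigma> j)))"
    proof (rule sum.cong[OF refl])
      fix \<sigma> assume "\<sigma> \<in> Sg"
      then have "permutation \<sigma>" by (auto simp: Sg_def permutation_permutes)
      then have "sign (\<sigma> \<circ> inv_into UNIV \<tau>) = sign \<sigma> * sign \<tau>"
        using perm\<tau> by (simp add: sign_compose sign_inverse permutation_inverse)
      moreover have "(\<Prod>j<n + e. moment_row t n j ((\<sigma> \<circ> inv_into UNIV \<tau>) j)) = (\<Prod>j<n + e. moment_row t n (\<tau> j) (\<sigma> j))"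
        using prod.permute[OF \<tau>, of "\<lambda>j. moment_row t n j ((\<sigma> \<circ> inv_into UNIV \<tau>) j)"]
        by (simp add: permutes_inverses[OF \<tau>] comp_def)
      ultimately show "of_int (sign (\<sigma> \<circ> inv_into UNIV \<tau>)) * (\<Prod>j<n + e. moment_row t n j ((\<sigma> \<circ> inv_into UNIV \<tau>) j))
          = of_int (sign \<sigma> * sign \<tau>) * (\<Prod>j<n + e. moment_row t n (\<tau> j) (\<sigma> j))" by simp
    qed
    finally show "(\<Sum>\<sigma>\<in>Sg. of_int (sign \<sigma> * sign \<tau>) * (\<Prod>j<n + e. moment_row t n (\<tau> j) (\<sigma> j)))
        = leibniz (n + e) (moment_row t n)" by simp
  qed
  also have "\<dots> = fact n * leibniz (n + e) (moment_row t n)"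
    by (simp add: Tu_def card_permutations)
  finally show ?thesis .
qed

section \<open>Expansion in powers of the weight\<close>

lemma sum_Pow_by_card:
  fixes g :: "nat set \<Rightarrow> real"
  assumes "finite A"
  shows "(\<Sum>J\<in>Pow A. x ^ card J * g J) = (\<Sum>s\<le>card A. x ^ s * (\<Sum>J | J \<subseteq> A \<and> card J = s. g J))"
proof -
  have "(\<Sum>J\<in>Pow A. x ^ card J * g J)
      = (\<Sum>s\<le>card A. \<Sum>J\<in>{J. J \<in> Pow A \<and> card J = s}. x ^ card J * g J)"
    by (rule sum.group[symmetric]) (use assms in \<open>auto intro: card_mono\<close>)
  also have "\<dots> = (\<Sum>s\<le>card A. x ^ s * (\<Sum>J | J \<subseteq> A \<and> card J = s. g J))"
    by (intro sum.cong refl) (simp add: sum_distrib_left)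
  finally show ?thesis .
qed

lemma coefficients_eq:
  fixes x y :: "nat \<Rightarrow> real"
  assumes "\<And>t. 0 \<le> t \<Longrightarrow> t \<le> 1 \<Longrightarrow> (\<Sum>s\<le>d. t ^ s * x s) = (\<Sum>s\<le>m. t ^ s * y s)"
    and "s \<le> d" "s \<le> m"
  shows "x s = y s"
proof -
  define p where "p = (\<Sum>s\<le>d. monom (x s) s) - (\<Sum>s\<le>m. monom (y s) s)"
  have "p = 0"
  proof (rule ccontr)
    assume "p \<noteq> 0"
    then have "finite {t. poly p t = 0}" by (rule poly_roots_finite)
    moreover have "{0..1} \<subseteq> {t. poly p t = 0}"
      using assms(1) by (auto simp: p_def poly_sum poly_monom mult.commute)
    ultimately have "finite {0..1::real}" by (rule finite_subset[rotated])
    then show False using infinite_Icc[of "0::real" 1] by simp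
  qed
  then have "coeff p s = 0" by simp
  then show ?thesis using assms(2,3) by (simp add: p_def coeff_sum)
qed

text \<open>Multilinearity in the first \<open>m\<close> rows: \<open>J\<close> collects the rows in
  which the summand with \<open>x\<close> is chosen.\<close>

lemma leibniz_expand_rows:
  assumes "m \<le> n"
  shows "leibniz n (\<lambda>j k. if j < m then a j k + x * b j k else r j k)
    = (\<Sum>J\<in>Pow {..<m}. x ^ card J * leibniz n (\<lambda>j k. if j \<in> J then b j k else if j < m then a j k else r j k))"
proof -
  have split: "(\<Prod>j<n. f j) = (\<Prod>j<m. f j) * (\<Prod>j\<in>{m..<n}. f j)" for f :: "nat \<Rightarrow> real"
    using assms by (simp add: lessThan_atLeast0 prod.atLeastLessThan_concat)
  have pt: "(\<Prod>j<n. if j < m then a j (\<rho> j) + x * b j (\<rho> j) else r j (\<rho> j))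
      = (\<Sum>J\<in>Pow {..<m}. x ^ card J * (\<Prod>j<n. if j \<in> J then b j (\<rho> j) else if j < m then a j (\<rho> j) else r j (\<rho> j)))" for \<rho>
  proof -
    have "(\<Prod>j<m. x * b j (\<rho> j) + a j (\<rho> j))
        = (\<Sum>J\<in>Pow {..<m}. x ^ card J * (\<Prod>j<m. if j \<in> J then b j (\<rho> j) else a j (\<rho> j)))"
    proof (subst prod_add, simp, rule sum.cong[OF refl])
      fix J assume J: "J \<in> Pow {..<m}"
      have "(\<Prod>j<m. if j \<in> J then b j (\<rho> j) else a j (\<rho> j)) = (\<Prod>j\<in>J. b j (\<rho> j)) * (\<Prod>j\<in>{..<m} - J. a j (\<rho> j))"
        using J by (subst prod.If_cases) (auto simp: Int_absorb1 Diff_eq intro!: arg_cong2[where f = "(*)"] prod.cong)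
      then show "(\<Prod>j\<in>J. x * b j (\<rho> j)) * (\<Prod>j\<in>{..<m} - J. a j (\<rho> j))
          = x ^ card J * (\<Prod>j<m. if j \<in> J then b j (\<rho> j) else a j (\<rho> j))"
        by (simp add: prod.distrib)
    qed
    moreover have "(\<Prod>j<n. if j < m then a j (\<rho> j) + x * b j (\<rho> j) else r j (\<rho> j))
        = (\<Prod>j<m. x * b j (\<rho> j) + a j (\<rho> j)) * (\<Prod>j\<in>{m..<n}. r j (\<rho> j))"
      unfolding split by (intro arg_cong2[where f = "(*)"] prod.cong) auto
    moreover have "(\<Prod>j<n. if j \<in> J then b j (\<rho> j) else if j < m then a j (\<rho> j) else r j (\<rho> j))
        = (\<Prod>j<m. if j \<in> J then b j (\<rho> j) else a j (\<rho> j)) * (\<Prod>j\<in>{m..<n}. r j (\<rho> j))" if "J \<in> Pow {..<m}" for J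
      unfolding split by (intro arg_cong2[where f = "(*)"] prod.cong) (use that in auto)
    ultimately show ?thesis
      by (simp add: sum_distrib_right mult.assoc)
  qed
  have "leibniz n (\<lambda>j k. if j < m then a j k + x * b j k else r j k)
    = (\<Sum>\<rho> | \<rho> permutes {..<n}. \<Sum>J\<in>Pow {..<m}. of_int (sign \<rho>) * (x ^ card J *
        (\<Prod>j<n. if j \<in> J then b j (\<rho> j) else if j < m then a j (\<rho> j) else r j (\<rho> j))))"
    unfolding leibniz_def pt sum_distrib_left ..
  also have "\<dots> = (\<Sum>J\<in>Pow {..<m}. \<Sum>\<rho> | \<rho> permutes {..<n}. of_int (sign \<rho>) * (x ^ card J *
        (\<Prod>j<n. if j \<in> J then b j (\<rho> j) else if j < m then a j (\<rho> j) else r j (\<rho> j))))"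
    by (rule sum.swap)
  also have "\<dots> = (\<Sum>J\<in>Pow {..<m}. x ^ card J * leibniz n (\<lambda>j k. if j \<in> J then b j k else if j < m then a j k else r j k))"
    unfolding leibniz_def sum_distrib_left by (simp add: mult.left_commute)
  finally show ?thesis .
qed

lemma leibniz_transpose: "leibniz n (\<lambda>j k. R k j) = leibniz n R"
proof -
  have "leibniz n (\<lambda>j k. R k j)
      = (\<Sum>\<rho> | \<rho> permutes {..<n}. of_int (sign (inv_into UNIV \<rho>)) * (\<Prod>j<n. R (inv_into UNIV \<rho> j) j))"
    unfolding leibniz_def by (rule sum_permutations_inverse)
  also have "\<dots> = leibniz n R"
    unfolding leibniz_def
  proof (rule sum.cong[OF refl])
    fix \<rho> assume "\<rho> \<in> {\<rho>. \<rho> permutes {..<n}}"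
    then have \<rho>: "\<rho> permutes {..<n}" by simp
    have "(\<Prod>j<n. R (inv_into UNIV \<rho> j) j) = (\<Prod>j<n. R j (\<rho> j))"
      using prod.permute[OF \<rho>, of "\<lambda>j. R (inv_into UNIV \<rho> j) j"]
      by (simp add: permutes_inverses[OF \<rho>] comp_def)
    moreover have "sign (inv_into UNIV \<rho>) = sign \<rho>"
      using \<rho> by (intro sign_inverse) (auto simp: permutation_permutes)
    ultimately show "of_int (sign (inv_into UNIV \<rho>)) * (\<Prod>j<n. R (inv_into UNIV \<rho> j) j)
        = of_int (sign \<rho>) * (\<Prod>j<n. R j (\<rho> j))" by simp
  qed
  finally show ?thesis .
qed

lemma leibniz_scale_rows:
  assumes "m \<le> n"
  shows "leibniz n (\<lambda>j k. if j < m then c * R j k else d * R j k) = c ^ m * d ^ (n - m) * leibniz n R"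
proof -
  have split: "(\<Prod>j<n. f j) = (\<Prod>j<m. f j) * (\<Prod>j\<in>{m..<n}. f j)" for f :: "nat \<Rightarrow> real"
    using assms by (simp add: lessThan_atLeast0 prod.atLeastLessThan_concat)
  have "(\<Prod>j<n. if j < m then c * R j (\<rho> j) else d * R j (\<rho> j)) = c ^ m * d ^ (n - m) * (\<Prod>j<n. R j (\<rho> j))" for \<rho>
  proof -
    have "(\<Prod>j<n. if j < m then c * R j (\<rho> j) else d * R j (\<rho> j))
        = (\<Prod>j<n. if j < m then c else d) * (\<Prod>j<n. R j (\<rho> j))"
      unfolding prod.distrib[symmetric] by (rule prod.cong) auto
    also have "(\<Prod>j<n. if j < m then c else d) = c ^ m * d ^ (n - m)"
      unfolding split by simp
    finally show ?thesis .
  qed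
  then show ?thesis by (simp add: leibniz_def sum_distrib_left mult.left_commute)
qed

lemma sum_shift_subsets:
  fixes g :: "nat set \<Rightarrow> real"
  shows "(\<Sum>J\<in>Pow {..<m}. x ^ card J * g (Suc ` J)) = (\<Sum>J\<in>Pow {1..m}. x ^ card J * g J)"
proof -
  have im: "(`) Suc ` Pow {..<m} = Pow {1..m}"
    by (simp add: image_Pow_surj image_Suc_lessThan)
  have inj: "inj_on ((`) Suc) (Pow {..<m})" by (rule inj_on_image_Pow) simp
  show ?thesis
    unfolding im[symmetric] sum.reindex[OF inj] by (simp add: card_image)
qed

lemma root_vol_eq_measure: "root_vol d s = measure (coeff_space d) (E_set d s)"
  unfolding root_vol_def lebesgue_dim_def by (rule measure_completion) (rule sets_E_set)

lemma finite_measure_E_set: "emeasure (coeff_space d) (E_set d s) < \<infinity>"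
proof -
  have "E_set d s \<subseteq> Pi\<^sub>E {1..d} (\<lambda>_. {-(2 ^ d)..2 ^ d})"
  proof
    fix a assume a: "a \<in> E_set d s"
    then have "weight 1 (monic_poly d a) \<noteq> 0" by (auto simp: E_set_def weight_def)
    then have "\<bar>a i\<bar> \<le> 2 ^ d" if "i \<in> {1..d}" for i
      using weight_nonzero_coeff_bound[of 1 d a i] that by auto
    then show "a \<in> Pi\<^sub>E {1..d} (\<lambda>_. {-(2 ^ d)..2 ^ d})"
      using a by (auto simp: E_set_def PiE_def Pi_def abs_le_iff) (metis minus_le_iff)
  qed
  then have "emeasure (coeff_space d) (E_set d s) \<le> emeasure (coeff_space d) (Pi\<^sub>E {1..d} (\<lambda>_. {-(2 ^ d)..2 ^ d}))"
    by (rule emeasure_mono) (auto intro!: sets_PiM_I_finite)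
  also have "\<dots> < \<infinity>" by (rule emeasure_box_coeff_space)
  finally show ?thesis .
qed

text \<open>Without evaluation points only the weight is integrated.\<close>

lemma weighted_integral_Nil: "weighted_integral t d [] = of_real (\<Sum>s\<le>d. t ^ s * root_vol d s)"
proof -
  have int: "integrable (coeff_space d) (\<lambda>a. t ^ s * indicator (E_set d s) a)" for s
    using sets_E_set finite_measure_E_set by (intro integrable_mult_right integrable_real_indicator)
  have "weighted_integral t d [] = (\<integral>a. complex_of_real (\<Sum>s\<le>d. t ^ s * indicator (E_set d s) a) \<partial>coeff_space d)"
    unfolding weighted_integral_def
    by (rule Bochner_Integration.integral_cong) (simp_all add: evals_def weight_eq_sum_E_set)
  also have "\<dots> = of_real (\<integral>a. (\<Sum>s\<le>d. t ^ s * indicator (E_set d s) a) \<partial>coeff_space d)"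
    by (rule integral_complex_of_real)
  also have "(\<integral>a. (\<Sum>s\<le>d. t ^ s * indicator (E_set d s) a) \<partial>coeff_space d)
      = (\<Sum>s\<le>d. \<integral>a. t ^ s * indicator (E_set d s) a \<partial>coeff_space d)"
    by (rule Bochner_Integration.integral_sum) (rule int)
  also have "\<dots> = (\<Sum>s\<le>d. t ^ s * root_vol d s)"
    using sets_E_set by (simp add: root_vol_eq_measure)
  finally show ?thesis .
qed

lemma generating_function:
  assumes "0 \<le> t" "t \<le> 1" "e \<le> 1"
  shows "(\<Sum>s\<le>2 * n + e. t ^ s * root_vol (2 * n + e) s) = leibniz (n + e) (moment_row t n)"
proof -
  have "complex_of_real (fact n * (\<Sum>s\<le>2 * n + e. t ^ s * root_vol (2 * n + e) s))
      = of_real (fact n * leibniz (n + e) (moment_row t n))"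
    using vand_times_weighted_integral[OF assms, of "[]" n]
    by (simp add: weighted_integral_Nil pfaffian_sum_eq_leibniz[OF assms(3)])
  then show ?thesis by (simp only: of_real_eq_iff) simp
qed

definition real_moment :: "nat \<Rightarrow> nat \<Rightarrow> real" where
  "real_moment j k = 1 / ((2 * real k - 1) * (2 * real j + 2 * real k - 1))"

definition conj_moment :: "nat \<Rightarrow> nat \<Rightarrow> real" where
  "conj_moment j k = 1 / ((2 * real j)\<^sup>2 - (2 * real k - 1)\<^sup>2)"

text \<open>The factors \<open>4\<close> and \<open>2 t\<close> are the source of the powers of
  \<open>2\<close> in the theorem.\<close>

lemma pair_entry_eq_moments:
  "pair_entry t (2 * k) (Suc (2 * j)) = 4 * (real_moment (Suc j) (Suc k) + 2 * t * conj_moment (Suc j) (Suc k))"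
proof -
  have "(2 * real (Suc j))\<^sup>2 - (2 * real (Suc k) - 1)\<^sup>2
      = (2 * real j + 1 - 2 * real k) * (2 * real j + 2 * real k + 3)"
    by (simp add: power2_eq_square algebra_simps)
  then show ?thesis
    by (simp add: pair_entry_def real_moment_def conj_moment_def algebra_simps)
qed

lemma moment_row_eq:
  "moment_row t n = (\<lambda>j k. if j < n then 4 * (real_moment (Suc j) (Suc k) + 2 * t * conj_moment (Suc j) (Suc k))
     else 2 * (1 / (2 * real (Suc k) - 1)))"
proof (intro ext)
  fix j k
  have "moment1 (2 * k) = 2 * (1 / (2 * real (Suc k) - 1))" by (simp add: moment1_def algebra_simps)
  then show "moment_row t n j k
      = (if j < n then 4 * (real_moment (Suc j) (Suc k) + 2 * t * conj_moment (Suc j) (Suc k))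
         else 2 * (1 / (2 * real (Suc k) - 1)))"
    by (simp add: moment_row_def pair_entry_eq_moments)
qed

lemma leibniz_moment_row_rows:
  assumes "e \<le> 1"
  shows "leibniz (n + e) (moment_row t n) = 4 ^ n * 2 ^ e * (\<Sum>J\<in>Pow {1..n}. (2 * t) ^ card J *
    leibniz (n + e) (\<lambda>j k. if Suc j \<in> J then conj_moment (Suc j) (Suc k)
      else if j < n then real_moment (Suc j) (Suc k) else 1 / (2 * real (Suc k) - 1)))"
proof -
  define R where "R = (\<lambda>j k. if j < n then real_moment (Suc j) (Suc k) + 2 * t * conj_moment (Suc j) (Suc k)
     else 1 / (2 * real (Suc k) - 1))"
  have "moment_row t n = (\<lambda>j k. if j < n then 4 * R j k else 2 * R j k)"
    unfolding moment_row_eq R_def by (intro ext) simp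
  then have "leibniz (n + e) (moment_row t n) = 4 ^ n * 2 ^ e * leibniz (n + e) R"
    using leibniz_scale_rows[of n "n + e" 4 R 2] by simp
  also have "leibniz (n + e) R = (\<Sum>J\<in>Pow {..<n}. (2 * t) ^ card J *
    leibniz (n + e) (\<lambda>j k. if j \<in> J then conj_moment (Suc j) (Suc k)
      else if j < n then real_moment (Suc j) (Suc k) else 1 / (2 * real (Suc k) - 1)))"
    unfolding R_def by (rule leibniz_expand_rows) simp
  also have "\<dots> = (\<Sum>J\<in>Pow {..<n}. (2 * t) ^ card J *
    leibniz (n + e) (\<lambda>j k. if Suc j \<in> Suc ` J then conj_moment (Suc j) (Suc k)
      else if j < n then real_moment (Suc j) (Suc k) else 1 / (2 * real (Suc k) - 1)))"
    by (simp add: inj_image_mem_iff)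
  finally show ?thesis
    using sum_shift_subsets[where x = "2 * t" and m = n and g = "\<lambda>J. leibniz (n + e) (\<lambda>j k. if Suc j \<in> J then conj_moment (Suc j) (Suc k)
      else if j < n then real_moment (Suc j) (Suc k) else 1 / (2 * real (Suc k) - 1))"] by simp
qed

text \<open>The expansion along the rows of the transposed matrix.\<close>

lemma leibniz_moment_row_cols:
  "leibniz n (moment_row t n) = 4 ^ n * (\<Sum>J\<in>Pow {1..n}. (2 * t) ^ card J *
    leibniz n (\<lambda>j k. if Suc k \<in> J then conj_moment (Suc j) (Suc k) else real_moment (Suc j) (Suc k)))"
proof -
  have cong: "leibniz n R = leibniz n R'" if "\<And>j k. j < n \<Longrightarrow> k < n \<Longrightarrow> R j k = R' j k" for R R'
    unfolding leibniz_def
  proof (rule sum.cong[OF refl])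
    fix \<rho> assume "\<rho> \<in> {\<rho>. \<rho> permutes {..<n}}"
    then have "\<rho> j < n" if "j < n" for j using permutes_in_image[of \<rho> "{..<n}" j] that by auto
    then show "of_int (sign \<rho>) * (\<Prod>j<n. R j (\<rho> j)) = of_int (sign \<rho>) * (\<Prod>j<n. R' j (\<rho> j))"
      using that by (intro arg_cong2[where f = "(*)"] prod.cong) auto
  qed
  define R where "R = (\<lambda>k j. if k < n then real_moment (Suc j) (Suc k) + 2 * t * conj_moment (Suc j) (Suc k) else 0)"
  have "leibniz n (moment_row t n) = leibniz n (\<lambda>j k. if j < n then 4 * R k j else 4 * R k j)"
    by (rule cong) (simp add: moment_row_eq R_def)
  also have "\<dots> = 4 ^ n * leibniz n (\<lambda>j k. R k j)"
    using leibniz_scale_rows[of n n 4 "\<lambda>j k. R k j" 4] by simp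
  also have "leibniz n (\<lambda>j k. R k j) = leibniz n R" by (rule leibniz_transpose)
  also have "leibniz n R = (\<Sum>J\<in>Pow {..<n}. (2 * t) ^ card J *
    leibniz n (\<lambda>k j. if k \<in> J then conj_moment (Suc j) (Suc k) else if k < n then real_moment (Suc j) (Suc k) else 0))"
    unfolding R_def by (rule leibniz_expand_rows) simp
  also have "\<dots> = (\<Sum>J\<in>Pow {..<n}. (2 * t) ^ card J *
    leibniz n (\<lambda>j k. if Suc k \<in> Suc ` J then conj_moment (Suc j) (Suc k) else real_moment (Suc j) (Suc k)))"
  proof (rule sum.cong[OF refl])
    fix J
    have "leibniz n (\<lambda>k j. if k \<in> J then conj_moment (Suc j) (Suc k) else if k < n then real_moment (Suc j) (Suc k) else 0)
        = leibniz n (\<lambda>k j. if Suc k \<in> Suc ` J then conj_moment (Suc j) (Suc k) else real_moment (Suc j) (Suc k))"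
      by (rule cong) (auto simp: inj_image_mem_iff)
    also have "\<dots> = leibniz n (\<lambda>j k. if Suc k \<in> Suc ` J then conj_moment (Suc j) (Suc k) else real_moment (Suc j) (Suc k))"
      by (rule leibniz_transpose[symmetric])
    finally show "(2 * t) ^ card J *
      leibniz n (\<lambda>k j. if k \<in> J then conj_moment (Suc j) (Suc k) else if k < n then real_moment (Suc j) (Suc k) else 0)
      = (2 * t) ^ card J * leibniz n (\<lambda>j k. if Suc k \<in> Suc ` J then conj_moment (Suc j) (Suc k) else real_moment (Suc j) (Suc k))"
      by simp
  qed
  finally show ?thesis
    using sum_shift_subsets[where x = "2 * t" and m = n and g = "\<lambda>J. leibniz n (\<lambda>j k. if Suc k \<in> J then conj_moment (Suc j) (Suc k) else real_moment (Suc j) (Suc k))"]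
    by simp
qed

lemma leibniz_c_entry:
  "leibniz n (\<lambda>j k. if Suc j \<in> J then conj_moment (Suc j) (Suc k)
      else if j < n then real_moment (Suc j) (Suc k) else 1 / (2 * real (Suc k) - 1)) = det_of n (c_entry J)"
  unfolding det_of_eq_leibniz leibniz_def
  by (intro sum.cong refl arg_cong2[where f = "(*)"] prod.cong)
     (auto simp: c_entry_def conj_moment_def real_moment_def)

lemma leibniz_c'_entry:
  "leibniz n (\<lambda>j k. if Suc k \<in> J then conj_moment (Suc j) (Suc k) else real_moment (Suc j) (Suc k)) = det_of n (c'_entry J)"
  unfolding det_of_eq_leibniz leibniz_def
  by (intro sum.cong refl arg_cong2[where f = "(*)"] prod.cong)
     (auto simp: c'_entry_def conj_moment_def real_moment_def)

lemma leibniz_c_tilde_entry: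
  "leibniz (Suc n) (\<lambda>j k. if Suc j \<in> J then conj_moment (Suc j) (Suc k)
      else if j < n then real_moment (Suc j) (Suc k) else 1 / (2 * real (Suc k) - 1))
    = det_of (Suc n) (c_tilde_entry (Suc n) J)"
  unfolding det_of_eq_leibniz leibniz_def
  by (intro sum.cong refl arg_cong2[where f = "(*)"] prod.cong)
     (auto simp: c_tilde_entry_def conj_moment_def real_moment_def)

lemma scale_card_sum:
  fixes g :: "nat set \<Rightarrow> real"
  shows "c * (\<Sum>J\<in>Pow {1..n}. (2 * t) ^ card J * g J)
    = (\<Sum>s\<le>n. t ^ s * (c * 2 ^ s * (\<Sum>J | J \<subseteq> {1..n} \<and> card J = s. g J)))"
  using sum_Pow_by_card[of "{1..n}" "2 * t" g]
  by (simp add: sum_distrib_left power_mult_distrib mult_ac)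

lemma root_vol_even:
  assumes "s \<le> n"
  shows "root_vol (2 * n) s = 4 ^ n * 2 ^ s * (\<Sum>J | J \<subseteq> {1..n} \<and> card J = s. det_of n (c_entry J))"
proof -
  have "(\<Sum>s\<le>2 * n. t ^ s * root_vol (2 * n) s)
      = (\<Sum>s\<le>n. t ^ s * (4 ^ n * 2 ^ s * (\<Sum>J | J \<subseteq> {1..n} \<and> card J = s. det_of n (c_entry J))))"
    if "0 \<le> t" "t \<le> 1" for t
    using generating_function[OF that, of 0 n] leibniz_moment_row_rows[of 0 n t]
    unfolding scale_card_sum[symmetric] by (simp add: leibniz_c_entry)
  then show ?thesis by (rule coefficients_eq) (use assms in auto)
qed

lemma sum_det_c_entry_eq_c'_entry:
  assumes "s \<le> n"
  shows "(\<Sum>J | J \<subseteq> {1..n} \<and> card J = s. det_of n (c_entry J))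
    = (\<Sum>J | J \<subseteq> {1..n} \<and> card J = s. det_of n (c'_entry J))"
proof -
  have "(\<Sum>s\<le>n. t ^ s * (4 ^ n * 2 ^ s * (\<Sum>J | J \<subseteq> {1..n} \<and> card J = s. det_of n (c_entry J))))
      = (\<Sum>s\<le>n. t ^ s * (4 ^ n * 2 ^ s * (\<Sum>J | J \<subseteq> {1..n} \<and> card J = s. det_of n (c'_entry J))))" for t
    using leibniz_moment_row_rows[of 0 n t] leibniz_moment_row_cols[of n t]
    unfolding scale_card_sum[symmetric] by (simp add: leibniz_c_entry leibniz_c'_entry)
  then have "4 ^ n * 2 ^ s * (\<Sum>J | J \<subseteq> {1..n} \<and> card J = s. det_of n (c_entry J))
      = 4 ^ n * 2 ^ s * (\<Sum>J | J \<subseteq> {1..n} \<and> card J = s. det_of n (c'_entry J))"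
    by (rule coefficients_eq) (use assms in auto)
  then show ?thesis by simp
qed

lemma root_vol_odd:
  assumes "s \<le> n"
  shows "root_vol (2 * n + 1) s = 4 ^ n * 2 * 2 ^ s *
    (\<Sum>J | J \<subseteq> {1..n} \<and> card J = s. det_of (Suc n) (c_tilde_entry (Suc n) J))"
proof -
  have "(\<Sum>s\<le>2 * n + 1. t ^ s * root_vol (2 * n + 1) s)
      = (\<Sum>s\<le>n. t ^ s * (4 ^ n * 2 * 2 ^ s * (\<Sum>J | J \<subseteq> {1..n} \<and> card J = s. det_of (Suc n) (c_tilde_entry (Suc n) J))))"
    if "0 \<le> t" "t \<le> 1" for t
    using generating_function[OF that, of 1 n] leibniz_moment_row_rows[of 1 n t]
    unfolding scale_card_sum[symmetric] by (simp add: leibniz_c_tilde_entry)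
  then show ?thesis by (rule coefficients_eq) (use assms in auto)
qed

text \<open>The powers of \<open>2\<close> collect a factor \<open>4\<close> from each pair, a
  further \<open>2\<close> from each conjugate pair, and in odd degree a \<open>2\<close> from the
  unpaired root.\<close>

theorem theorem4p4:
  fixes n :: nat
  assumes "n \<ge> 1"
  shows "(\<forall>s::nat. s \<le> n \<longrightarrow>
            root_vol (2 * n) s / 2 ^ (2 * n + s)
              = (\<Sum>J | J \<subseteq> {1..n} \<and> card J = s. det_of n (c_entry J)) \<and>
            (\<Sum>J | J \<subseteq> {1..n} \<and> card J = s. det_of n (c_entry J))
              = (\<Sum>J | J \<subseteq> {1..n} \<and> card J = s. det_of n (c'_entry J))) \<and>
         (\<forall>s::nat. s \<le> n - 1 \<longrightarrow>
            root_vol (2 * n - 1) s / 2 ^ (2 * n + s - 1)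
              = (\<Sum>J | J \<subseteq> {1..n - 1} \<and> card J = s. det_of n (c_tilde_entry n J)))"
proof (intro conjI allI impI)
  fix s assume s: "s \<le> n"
  show "root_vol (2 * n) s / 2 ^ (2 * n + s) = (\<Sum>J | J \<subseteq> {1..n} \<and> card J = s. det_of n (c_entry J))"
    by (simp add: root_vol_even[OF s] power_add power_mult)
  show "(\<Sum>J | J \<subseteq> {1..n} \<and> card J = s. det_of n (c_entry J))
      = (\<Sum>J | J \<subseteq> {1..n} \<and> card J = s. det_of n (c'_entry J))"
    by (rule sum_det_c_entry_eq_c'_entry[OF s])
next
  fix s assume s: "s \<le> n - 1"
  obtain m where n: "n = Suc m" using assms by (cases n) auto
  have "(2::real) ^ (2 * n + s - 1) = 4 ^ m * 2 * 2 ^ s" by (simp add: n power_add power_mult)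
  then show "root_vol (2 * n - 1) s / 2 ^ (2 * n + s - 1)
      = (\<Sum>J | J \<subseteq> {1..n - 1} \<and> card J = s. det_of n (c_tilde_entry n J))"
    using root_vol_odd[of s m] s by (simp add: n)
qed

end
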